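(* Let $(\mathcal X,d,\mu)$ be a space of homogeneous type. Let $\beta,\gamma\in(0,\eta)$, $s\in(-(\beta\wedge\gamma),\beta\wedge\gamma)$ and $p,q\in(0,\infty]$ satisfy $$(\ast)\qquad\beta\in\Big(\max\Big\{0,-s+\omega\Big(\frac1p-1\Big)_+\Big\},\eta\Big)\quad\text{and}\quad\gamma\in\Big(\omega\Big(\frac1p-1\Big)_+,\eta\Big).$$ (i) Suppose $p\in(p(s,\beta\wedge\gamma),\infty]$. Let $\widetilde\beta,\widetilde\gamma$ satisfy $s\in(-(\widetilde\beta\wedge\widetilde\gamma),\widetilde\beta\wedge\widetilde\gamma)$, $p\in(p(s,\widetilde\beta\wedge\widetilde\gamma),\infty]$ and $(\ast)$ with $\beta,\gamma$ replaced by $\widetilde\beta,\widetilde\gamma$. Then, for any $f\in B^s_{p,q}(\mathcal X)\subset(\mathcal G^\eta_0(\beta,\gamma))'$, one has $f\in(\mathcal G^\eta_0(\widetilde\beta,\widetilde\gamma))'$, and there exists a positive constant $C$, independent of $f$, such that $$\|f\|_{(\mathcal G^\eta_0(\widetilde\beta,\widetilde\gamma))'}\le C\|f\|_{B^s_{p,q}(\mathcal X)}.$$ (ii) Suppose $p\in(p(s,\beta\wedge\gamma),\infty)$ and $q\in(p(s,\beta\wedge\gamma),\infty]$. Let $\widetilde\beta,\widetilde\gamma$ satisfy $s\in(-(\widetilde\beta\wedge\widetilde\gamma),\widetilde\beta\wedge\widetilde\gamma)$, $p\in(p(s,\widetilde\beta\wedge\widetilde\gamma),\infty)$, $q\in(p(s,\widetilde\beta\wedge\widetilde\gamma),\infty]$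 and $(\ast)$ with $\beta,\gamma$ replaced by $\widetilde\beta,\widetilde\gamma$. Then, for any $f\in F^s_{p,q}(\mathcal X)\subset(\mathcal G^\eta_0(\beta,\gamma))'$, one has $f\in(\mathcal G^\eta_0(\widetilde\beta,\widetilde\gamma))'$, and there exists a positive constant $C$, independent of $f$, such that $$\|f\|_{(\mathcal G^\eta_0(\widetilde\beta,\widetilde\gamma))'}\le C\|f\|_{F^s_{p,q}(\mathcal X)}.$$
   Context: Space. $d$ is a quasi-metric on $\mathcal X$: $d\ge0$, $d(x,y)=0$ iff $x=y$, $d$ symmetric, $d(x,z)\le A_0[d(x,y)+d(y,z)]$ for some $A_0\in[1,\infty)$. $B(x,r):=\{y:d(x,y)<r\}$. $(\mathcal X,d,\mu)$ is a space of homogeneous type: $\mu$ is a measure for which balls are measurable with $0<\mu(B)<\infty$, and $\mu(2B)\le C_{(\mu)}\mu(B)$ for every ball $B$; $\omega:=\log_2C_{(\mu)}$. $\mu(\mathcal X)$ may be finite or infinite. $V_r(x):=\mu(B(x,r))$, $V(x,y):=\mu(B(x,d(x,y)))$ ($=0$ if $x=y$). $a\wedge b:=\min\{a,b\}$, $r_+:=\max\{r,0\}$. $m_E(g):=\frac1{\mu(E)}\int_Eg\,d\mu$. $\mathbb Z_+=\{0,1,2,\dots\}$, $\mathbb N=\{1,2,\dots\}$. Dyadic cubes. Fix $0<c_0\le C_0<\infty$, a small $\delta\in(0,1)$ (e.g. $\delta\le(2A_0)^{-10}$) with $12A_0^3C_0\delta\le c_0$, and points $\{z^k_\alpha:k\in\mathbb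 Z,\alpha\in\mathcal A_k\}$, nested ($\mathcal A_k\subset\mathcal A_{k+1}$ and $z^{k+1}_\alpha=z^k_\alpha$ for $\alpha\in\mathcal A_k$), with $d(z^k_\alpha,z^k_\beta)\ge c_0\delta^k$ if $\alpha\ne\beta$ and $\min_{\alpha\in\mathcal A_k}d(x,z^k_\alpha)<C_0\delta^k$ for all $x$. $\mathcal Y^k:=\{z^{k+1}_\alpha:\alpha\in\mathcal A_{k+1}\setminus\mathcal A_k\}$, $d(x,\mathcal Y^k):=\inf_{y\in\mathcal Y^k}d(x,y)$. $\{Q^k_\alpha\}$ is an associated (Hytönen–Kairema) system of dyadic cubes: for each $k$, $\{Q^k_\alpha\}_{\alpha\in\mathcal A_k}$ is disjoint with union $\mathcal X$; for $k\le l$ each $Q^l_\beta$ is contained in or disjoint from each $Q^k_\alpha$; $B(z^k_\alpha,(3A_0^2)^{-1}c_0\delta^k)\subset Q^k_\alpha\subset B(z^k_\alpha,2A_0C_0\delta^k)$. Fix $j_0\in\mathbb N$ large with $\delta^{j_0}\le(2A_0)^{-3}C_0$; $\{Q^{k,m}_\alpha\}_{m=1}^{N(k,\alpha)}$ enumerates the cubes $Q^{k+j_0}_\tau$ contained in $Q^k_\alpha$. exp-IATI. $\eta\in(0,1)$ is a fixed exponent for which such approximations exist on $\mathcal X$. Put $$E_k(x,y):=\frac{1}{\sqrt{V_{\delta^k}(x)V_{\delta^k}(y)}}\exp\Big\{-\nu\Big[\frac{d(x,y)}{\delta^k}\Big]^a\Big\}\exp\Big\{-\nu\Big[\frac{\max\{d(x,\mathcal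 Y^k),d(y,\mathcal Y^k)\}}{\delta^k}\Big]^a\Big\}.$$ An exp-IATI is a sequence $\{Q_k\}_{k\in\mathbb Z_+}$ of bounded linear integral operators on $L^2(\mathcal X)$, with kernels $Q_k(x,y)$, with $\sum_{k=0}^\infty Q_k=I$ in $L^2(\mathcal X)$, such that for some constants $C,\nu\in(0,\infty)$, $a\in(0,1]$, for all $k\in\mathbb N$ and all points: (a) $|Q_k(x,y)|\le CE_k(x,y)$; (b) if $d(x,x')\le\delta^k$, then $|Q_k(x,y)-Q_k(x',y)|+|Q_k(y,x)-Q_k(y,x')|\le C[d(x,x')/\delta^k]^\eta E_k(x,y)$; (c) if $d(x,x')\le\delta^k$ and $d(y,y')\le\delta^k$, then $|[Q_k(x,y)-Q_k(x',y)]-[Q_k(x,y')-Q_k(x',y')]|\le C[d(x,x')/\delta^k]^\eta[d(y,y')/\delta^k]^\eta E_k(x,y)$; (d) $\int Q_k(x,y)\,d\mu(y)=0=\int Q_k(y,x)\,d\mu(y)$; while $Q_0$ satisfies (a)–(c) with $k=0$ and with the second exponential factor removed from $E_0$, and $\int Q_0(x,y)\,d\mu(y)=1=\int Q_0(y,x)\,d\mu(y)$. Test functions and distributions. Fix $x_0\in\mathcal X$. For $\beta\in(0,1]$, $\gamma\in(0,\infty)$, $\mathcal G(\beta,\gamma)$ is the set of functions $f$ for which there is $C>0$ such that, with $D_\gamma(x):=\frac{1}{V_1(x_0)+V(x_0,x)}[1+d(x_0,x)]^{-\gamma}$: $|f(x)|\le CD_\gamma(x)$ for all $x$, and $|f(x)-f(y)|\le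 C[\frac{d(x,y)}{1+d(x_0,x)}]^\beta D_\gamma(x)$ whenever $d(x,y)\le(2A_0)^{-1}[1+d(x_0,x)]$; its norm is the infimum of such $C$. For $\beta,\gamma\in(0,\eta]$, $\mathcal G^\eta_0(\beta,\gamma)$ is the completion of $\mathcal G(\eta,\eta)$ in $\mathcal G(\beta,\gamma)$, and $(\mathcal G^\eta_0(\beta,\gamma))'$ is its dual. For $f$ in this dual, $Q_k(f)(x)=Q_kf(x):=\langle f,Q_k(x,\cdot)\rangle$. "$f\in(\mathcal G^\eta_0(\widetilde\beta,\widetilde\gamma))'$" means that the restriction of $f$ to $\mathcal G(\eta,\eta)$ extends (uniquely, by density) to a continuous linear functional on $\mathcal G^\eta_0(\widetilde\beta,\widetilde\gamma)$; $\|f\|_{(\mathcal G^\eta_0(\widetilde\beta,\widetilde\gamma))'}$ is its functional norm. The integer $N$. With an exp-IATI $\{Q_k\}$ one associates a fixed $N\in\mathbb N$ for which the following (known) reproducing formula holds: for $\beta,\gamma\in(0,\eta)$ and arbitrary points $y^{k,m}_\alpha\in Q^{k,m}_\alpha$ there are bounded linear integral operators $\{\widetilde Q_k\}_{k\in\mathbb Z_+}$ on $L^2(\mathcal X)$ with, for all $f\in(\mathcal G^\eta_0(\beta,\gamma))'$, $$f=\sum_{\alpha\in\mathcal A_0}\sum_m\int_{Q^{0,m}_\alpha}\widetilde Q_0(\cdot,y)\,d\mu(y)\,Q^{0,m}_{\alpha,1}(f)+\sum_{k=1}^N\sum_{\alpha,m}\mu(Q^{k,m}_\alpha)\widetilde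 Q_k(\cdot,y^{k,m}_\alpha)Q^{k,m}_{\alpha,1}(f)+\sum_{k=N+1}^\infty\sum_{\alpha,m}\mu(Q^{k,m}_\alpha)\widetilde Q_k(\cdot,y^{k,m}_\alpha)Q_kf(y^{k,m}_\alpha)$$ in $(\mathcal G^\eta_0(\beta,\gamma))'$, where $Q^{k,m}_{\alpha,1}(f):=m_{Q^{k,m}_\alpha}(Q_kf)$ and, with $R_k(x,y):=\frac{1}{V_{\delta^k}(x)+V(x,y)}[\frac{\delta^k}{\delta^k+d(x,y)}]^\gamma$ and $C$ independent of the points $y^{k,m}_\alpha$: $|\widetilde Q_k(x,y)|\le CR_k(x,y)$; $|\widetilde Q_k(x,y)-\widetilde Q_k(x',y)|\le C[\frac{d(x,x')}{\delta^k+d(x,y)}]^\beta R_k(x,y)$ if $d(x,x')\le(2A_0)^{-1}[\delta^k+d(x,y)]$; $\int\widetilde Q_k(x,y)\,d\mu(y)=\int\widetilde Q_k(y,x)\,d\mu(y)$ equals $1$ if $k\le N$ and $0$ if $k>N$. Index and spaces. For $|s|<t$, $p(s,t):=\max\{\frac{\omega}{\omega+t},\frac{\omega}{\omega+t+s}\}$. Fix an exp-IATI $\{Q_k\}_{k\in\mathbb Z_+}$ and its $N$, and let $\Sigma_p(f):=\{\sum_{k=0}^N\sum_{\alpha\in\mathcal A_k}\sum_{m=1}^{N(k,\alpha)}\mu(Q^{k,m}_\alpha)[m_{Q^{k,m}_\alpha}(|Q_k(f)|)]^p\}^{1/p}$. $B^s_{p,q}(\mathcal X)$ (resp. $F^s_{p,q}(\mathcal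 X)$) is the set of $f\in(\mathcal G^\eta_0(\beta,\gamma))'$ with $\|f\|_{B^s_{p,q}(\mathcal X)}:=\Sigma_p(f)+[\sum_{k=N+1}^\infty\delta^{-ksq}\|Q_k(f)\|_{L^p(\mathcal X)}^q]^{1/q}<\infty$ (resp. $\|f\|_{F^s_{p,q}(\mathcal X)}:=\Sigma_p(f)+\|[\sum_{k=N+1}^\infty\delta^{-ksq}|Q_k(f)|^q]^{1/q}\|_{L^p(\mathcal X)}<\infty$), with usual modifications for $p=\infty$ or $q=\infty$. *)

theory Defs
  imports "HOL-Probability.Essential_Supremum"
begin

text \<open>Integrability exponents p, q in (0,\<infinity>] are of type \<^typ>\<open>ennreal\<close>.\<close>

definition epow :: "ennreal \<Rightarrow> real \<Rightarrow> ennreal" where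
  "epow x r = (if x = top then top else ennreal (enn2real x powr r))"
  \<comment> \<open>only used for exponents r > 0\<close>

definition Lp_norm :: "'a measure \<Rightarrow> ennreal \<Rightarrow> ('a \<Rightarrow> ennreal) \<Rightarrow> ennreal" where
  "Lp_norm M p g =
     (if p = top then esssup M g
      else epow (\<integral>\<^sup>+x. epow (g x) (enn2real p) \<partial>M) (1 / enn2real p))"

definition seq_norm :: "'k set \<Rightarrow> ennreal \<Rightarrow> ('k \<Rightarrow> ennreal) \<Rightarrow> ennreal" where
  "seq_norm K q b =
     (if q = top then (SUP k\<in>K. b k)
      else epow (\<Sum>\<^sub>\<infinity>k\<in>K. epow (b k) (enn2real q)) (1 / enn2real q))"

definition mean :: "'a measure \<Rightarrow> 'a set \<Rightarrow> ('a \<Rightarrow> 'b::{banach, second_countable_topology}) \<Rightarrow> 'b" where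
  "mean M S g = (LINT x:S|M. g x) /\<^sub>R measure M S"

definition L2_space :: "'a measure \<Rightarrow> ('a \<Rightarrow> complex) set" where
  "L2_space M = {f \<in> borel_measurable M. Lp_norm M 2 (\<lambda>x. ennreal (cmod (f x))) < top}"

definition integral_op :: "'a measure \<Rightarrow> ('a \<Rightarrow> 'a \<Rightarrow> complex) \<Rightarrow> ('a \<Rightarrow> complex) \<Rightarrow> 'a \<Rightarrow> complex" where
  "integral_op M K f x = (LINT y|M. K x y * f y)"

definition L2_bounded_kernel :: "'a measure \<Rightarrow> ('a \<Rightarrow> 'a \<Rightarrow> complex) \<Rightarrow> bool" where
  "L2_bounded_kernel M K \<longleftrightarrow>
     (\<lambda>(x, y). K x y) \<in> borel_measurable (M \<Otimes>\<^sub>M M) \<and>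
     (\<exists>C::real. \<forall>f\<in>L2_space M.
        (AE x in M. integrable M (\<lambda>y. K x y * f y)) \<and>
        integral_op M K f \<in> L2_space M \<and>
        Lp_norm M 2 (\<lambda>x. ennreal (cmod (integral_op M K f x)))
          \<le> ennreal C * Lp_norm M 2 (\<lambda>x. ennreal (cmod (f x))))"

definition quasi_metric :: "('a \<Rightarrow> 'a \<Rightarrow> real) \<Rightarrow> real \<Rightarrow> bool" where
  "quasi_metric d A\<^sub>0 \<longleftrightarrow>
     1 \<le> A\<^sub>0 \<and>
     (\<forall>x y. 0 \<le> d x y) \<and>
     (\<forall>x y. d x y = 0 \<longleftrightarrow> x = y) \<and>
     (\<forall>x y. d x y = d y x) \<and>
     (\<forall>x y z. d x z \<le> A\<^sub>0 * (d x y + d y z))"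

definition qball :: "('a \<Rightarrow> 'a \<Rightarrow> real) \<Rightarrow> 'a \<Rightarrow> real \<Rightarrow> 'a set" where
  "qball d x r = {y. d x y < r}"

text \<open>The underlying set is the whole type \<^typ>\<open>'a\<close>; \<open>C\<^sub>\<mu>\<close> is the doubling constant.\<close>

definition homogeneous_type ::
    "('a \<Rightarrow> 'a \<Rightarrow> real) \<Rightarrow> real \<Rightarrow> 'a measure \<Rightarrow> real \<Rightarrow> bool" where
  "homogeneous_type d A\<^sub>0 M C\<^sub>\<mu> \<longleftrightarrow>
     quasi_metric d A\<^sub>0 \<and> space M = UNIV \<and>
     (\<forall>x. \<forall>r>0. qball d x r \<in> sets M \<and>
        0 < emeasure M (qball d x r) \<and> emeasure M (qball d x r) < top \<and>
        emeasure M (qball d x (2 * r)) \<le> ennreal C\<^sub>\<mu> * emeasure M (qball d x r))"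

definition upper_dim :: "real \<Rightarrow> real" where
  "upper_dim C\<^sub>\<mu> = log 2 C\<^sub>\<mu>"

definition vol :: "('a \<Rightarrow> 'a \<Rightarrow> real) \<Rightarrow> 'a measure \<Rightarrow> real \<Rightarrow> 'a \<Rightarrow> real" where
  "vol d M r x = measure M (qball d x r)"

definition vol2 :: "('a \<Rightarrow> 'a \<Rightarrow> real) \<Rightarrow> 'a measure \<Rightarrow> 'a \<Rightarrow> 'a \<Rightarrow> real" where
  "vol2 d M x y = measure M (qball d x (d x y))"

text \<open>Measurability of the cubes is part of the notion of a dyadic system.  The
  minimum over \<open>\<A>\<^sub>k\<close> in the covering property is expressed by an existential quantifier.\<close>

definition dyadic_system ::
    "('a \<Rightarrow> 'a \<Rightarrow> real) \<Rightarrow> real \<Rightarrow> 'a measure \<Rightarrow> real \<Rightarrow> real \<Rightarrow> real \<Rightarrow>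
     (int \<Rightarrow> 'i set) \<Rightarrow> (int \<Rightarrow> 'i \<Rightarrow> 'a) \<Rightarrow> (int \<Rightarrow> 'i \<Rightarrow> 'a set) \<Rightarrow> bool" where
  "dyadic_system d A\<^sub>0 M c\<^sub>0 C\<^sub>0 \<delta> \<A> z cube \<longleftrightarrow>
     0 < c\<^sub>0 \<and> c\<^sub>0 \<le> C\<^sub>0 \<and> 0 < \<delta> \<and> \<delta> < 1 \<and> 12 * A\<^sub>0 ^ 3 * C\<^sub>0 * \<delta> \<le> c\<^sub>0 \<and>
     (\<forall>k. \<A> k \<subseteq> \<A> (k + 1) \<and> (\<forall>\<alpha>\<in>\<A> k. z (k + 1) \<alpha> = z k \<alpha>)) \<and>
     (\<forall>k. \<forall>\<alpha>\<in>\<A> k. \<forall>\<beta>\<in>\<A> k. \<alpha> \<noteq> \<beta> \<longrightarrow> c\<^sub>0 * \<delta> powi k \<le> d (z k \<alpha>) (z k \<beta>)) \<and>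
     (\<forall>k x. \<exists>\<alpha>\<in>\<A> k. d x (z k \<alpha>) < C\<^sub>0 * \<delta> powi k) \<and>
     (\<forall>k. \<forall>\<alpha>\<in>\<A> k. cube k \<alpha> \<in> sets M) \<and>
     (\<forall>k. disjoint_family_on (cube k) (\<A> k) \<and> (\<Union>\<alpha>\<in>\<A> k. cube k \<alpha>) = UNIV) \<and>
     (\<forall>k l. k \<le> l \<longrightarrow> (\<forall>\<alpha>\<in>\<A> k. \<forall>\<beta>\<in>\<A> l.
        cube l \<beta> \<subseteq> cube k \<alpha> \<or> cube l \<beta> \<inter> cube k \<alpha> = {})) \<and>
     (\<forall>k. \<forall>\<alpha>\<in>\<A> k.
        qball d (z k \<alpha>) (c\<^sub>0 * \<delta> powi k / (3 * A\<^sub>0\<^sup>2)) \<subseteq> cube k \<alpha> \<and>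
        cube k \<alpha> \<subseteq> qball d (z k \<alpha>) (2 * A\<^sub>0 * C\<^sub>0 * \<delta> powi k))"

text \<open>\<open>sub k \<alpha> 1, \<dots>, sub k \<alpha> (n k \<alpha>)\<close> enumerates the cubes of level k + j0 inside \<open>cube k \<alpha>\<close>.\<close>

definition subcube_enumeration ::
    "real \<Rightarrow> real \<Rightarrow> real \<Rightarrow> (int \<Rightarrow> 'i set) \<Rightarrow> (int \<Rightarrow> 'i \<Rightarrow> 'a set) \<Rightarrow>
     nat \<Rightarrow> (int \<Rightarrow> 'i \<Rightarrow> nat) \<Rightarrow> (int \<Rightarrow> 'i \<Rightarrow> nat \<Rightarrow> 'a set) \<Rightarrow> bool" where
  "subcube_enumeration A\<^sub>0 C\<^sub>0 \<delta> \<A> cube j\<^sub>0 n sub \<longleftrightarrow>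
     1 \<le> j\<^sub>0 \<and> \<delta> ^ j\<^sub>0 \<le> C\<^sub>0 / (2 * A\<^sub>0) ^ 3 \<and>
     (\<forall>k. \<forall>\<alpha>\<in>\<A> k. bij_betw (sub k \<alpha>) {1..n k \<alpha>}
        {S. S \<subseteq> cube k \<alpha> \<and> (\<exists>\<tau>\<in>\<A> (k + int j\<^sub>0). S = cube (k + int j\<^sub>0) \<tau>)})"

definition new_points :: "(int \<Rightarrow> 'i set) \<Rightarrow> (int \<Rightarrow> 'i \<Rightarrow> 'a) \<Rightarrow> int \<Rightarrow> 'a set" where
  "new_points \<A> z k = z (k + 1) ` (\<A> (k + 1) - \<A> k)"

text \<open>Extended-valued, so that the distance to the empty set is \<open>\<infinity>\<close>: the set of new points
  may be empty, e.g. at fine scales if the space is discrete.\<close>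

definition set_dist :: "('a \<Rightarrow> 'a \<Rightarrow> real) \<Rightarrow> 'a \<Rightarrow> 'a set \<Rightarrow> ennreal" where
  "set_dist d x Y = (INF y\<in>Y. ennreal (d x y))"

text \<open>exp (-nu t^a), with value 0 at \<open>t = \<infinity>\<close>\<close>

definition exp_decay :: "real \<Rightarrow> real \<Rightarrow> ennreal \<Rightarrow> real" where
  "exp_decay \<nu> a t = (if t = top then 0 else exp (- \<nu> * enn2real t powr a))"

definition E_near ::
    "('a \<Rightarrow> 'a \<Rightarrow> real) \<Rightarrow> 'a measure \<Rightarrow> real \<Rightarrow> real \<Rightarrow> real \<Rightarrow> nat \<Rightarrow> 'a \<Rightarrow> 'a \<Rightarrow> real" where
  "E_near d M \<delta> \<nu> a k x y =
     1 / sqrt (vol d M (\<delta> ^ k) x * vol d M (\<delta> ^ k) y) * exp (- \<nu> * (d x y / \<delta> ^ k) powr a)"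

definition E_full ::
    "('a \<Rightarrow> 'a \<Rightarrow> real) \<Rightarrow> 'a measure \<Rightarrow> real \<Rightarrow> (int \<Rightarrow> 'i set) \<Rightarrow> (int \<Rightarrow> 'i \<Rightarrow> 'a) \<Rightarrow>
     real \<Rightarrow> real \<Rightarrow> nat \<Rightarrow> 'a \<Rightarrow> 'a \<Rightarrow> real" where
  "E_full d M \<delta> \<A> z \<nu> a k x y =
     E_near d M \<delta> \<nu> a k x y *
     exp_decay \<nu> a
       (max (set_dist d x (new_points \<A> z (int k))) (set_dist d y (new_points \<A> z (int k)))
          / ennreal (\<delta> ^ k))"

definition kernel_estimates ::
    "('a \<Rightarrow> 'a \<Rightarrow> real) \<Rightarrow> real \<Rightarrow> real \<Rightarrow> ('a \<Rightarrow> 'a \<Rightarrow> real) \<Rightarrow> real \<Rightarrow>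
     ('a \<Rightarrow> 'a \<Rightarrow> complex) \<Rightarrow> bool" where
  "kernel_estimates d \<eta> C E r K \<longleftrightarrow>
     (\<forall>x y. cmod (K x y) \<le> C * E x y) \<and>
     (\<forall>x x' y. d x x' \<le> r \<longrightarrow>
        cmod (K x y - K x' y) + cmod (K y x - K y x') \<le> C * (d x x' / r) powr \<eta> * E x y) \<and>
     (\<forall>x x' y y'. d x x' \<le> r \<and> d y y' \<le> r \<longrightarrow>
        cmod ((K x y - K x' y) - (K x y' - K x' y'))
          \<le> C * (d x x' / r) powr \<eta> * (d y y' / r) powr \<eta> * E x y)"

definition kernel_integral :: "'a measure \<Rightarrow> ('a \<Rightarrow> 'a \<Rightarrow> complex) \<Rightarrow> complex \<Rightarrow> bool" where
  "kernel_integral M K c \<longleftrightarrow> (\<forall>x. (LINT y|M. K x y) = c \<and> (LINT y|M. K y x) = c)"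

definition exp_IATI ::
    "('a \<Rightarrow> 'a \<Rightarrow> real) \<Rightarrow> 'a measure \<Rightarrow> real \<Rightarrow> (int \<Rightarrow> 'i set) \<Rightarrow> (int \<Rightarrow> 'i \<Rightarrow> 'a) \<Rightarrow>
     real \<Rightarrow> (nat \<Rightarrow> 'a \<Rightarrow> 'a \<Rightarrow> complex) \<Rightarrow> bool" where
  "exp_IATI d M \<delta> \<A> z \<eta> Q \<longleftrightarrow>
     (\<forall>k. L2_bounded_kernel M (Q k)) \<and>
     (\<forall>f\<in>L2_space M.
        (\<lambda>n. Lp_norm M 2 (\<lambda>x. ennreal (cmod (f x - (\<Sum>k<n. integral_op M (Q k) f x)))))
          \<longlonglongrightarrow> 0) \<and>
     (\<exists>C \<nu> a. 0 < C \<and> 0 < \<nu> \<and> 0 < a \<and> a \<le> 1 \<and>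
        (\<forall>k\<ge>1. kernel_estimates d \<eta> C (E_full d M \<delta> \<A> z \<nu> a k) (\<delta> ^ k) (Q k)) \<and>
        kernel_estimates d \<eta> C (E_near d M \<delta> \<nu> a 0) 1 (Q 0)) \<and>
     (\<forall>k\<ge>1. kernel_integral M (Q k) 0) \<and>
     kernel_integral M (Q 0) 1"

definition D_weight ::
    "('a \<Rightarrow> 'a \<Rightarrow> real) \<Rightarrow> 'a measure \<Rightarrow> 'a \<Rightarrow> real \<Rightarrow> 'a \<Rightarrow> real" where
  "D_weight d M x\<^sub>0 \<gamma> x =
     1 / (vol d M 1 x\<^sub>0 + vol2 d M x\<^sub>0 x) * (1 + d x\<^sub>0 x) powr (- \<gamma>)"

definition test_bound ::
    "('a \<Rightarrow> 'a \<Rightarrow> real) \<Rightarrow> real \<Rightarrow> 'a measure \<Rightarrow> 'a \<Rightarrow> real \<Rightarrow> real \<Rightarrow> ('a \<Rightarrow> complex) \<Rightarrow> real \<Rightarrow> bool" where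
  "test_bound d A\<^sub>0 M x\<^sub>0 \<beta> \<gamma> f C \<longleftrightarrow>
     0 < C \<and>
     (\<forall>x. cmod (f x) \<le> C * D_weight d M x\<^sub>0 \<gamma> x) \<and>
     (\<forall>x y. d x y \<le> (1 + d x\<^sub>0 x) / (2 * A\<^sub>0) \<longrightarrow>
        cmod (f x - f y) \<le> C * (d x y / (1 + d x\<^sub>0 x)) powr \<beta> * D_weight d M x\<^sub>0 \<gamma> x)"

definition test_space ::
    "('a \<Rightarrow> 'a \<Rightarrow> real) \<Rightarrow> real \<Rightarrow> 'a measure \<Rightarrow> 'a \<Rightarrow> real \<Rightarrow> real \<Rightarrow> ('a \<Rightarrow> complex) set" where
  "test_space d A\<^sub>0 M x\<^sub>0 \<beta> \<gamma> = {f. \<exists>C. test_bound d A\<^sub>0 M x\<^sub>0 \<beta> \<gamma> f C}"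

definition test_norm ::
    "('a \<Rightarrow> 'a \<Rightarrow> real) \<Rightarrow> real \<Rightarrow> 'a measure \<Rightarrow> 'a \<Rightarrow> real \<Rightarrow> real \<Rightarrow> ('a \<Rightarrow> complex) \<Rightarrow> real" where
  "test_norm d A\<^sub>0 M x\<^sub>0 \<beta> \<gamma> f = Inf {C. test_bound d A\<^sub>0 M x\<^sub>0 \<beta> \<gamma> f C}"

text \<open>As \<open>\<G>(\<beta>,\<gamma>)\<close> is a Banach space, the completion of \<open>\<G>(\<eta>,\<eta>)\<close> in it is the closure.\<close>

definition test_space0 ::
    "('a \<Rightarrow> 'a \<Rightarrow> real) \<Rightarrow> real \<Rightarrow> 'a measure \<Rightarrow> 'a \<Rightarrow> real \<Rightarrow> real \<Rightarrow> real \<Rightarrow> ('a \<Rightarrow> complex) set" where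
  "test_space0 d A\<^sub>0 M x\<^sub>0 \<eta> \<beta> \<gamma> =
     {f \<in> test_space d A\<^sub>0 M x\<^sub>0 \<beta> \<gamma>.
        \<forall>\<epsilon>>0. \<exists>g\<in>test_space d A\<^sub>0 M x\<^sub>0 \<eta> \<eta>. test_norm d A\<^sub>0 M x\<^sub>0 \<beta> \<gamma> (\<lambda>x. f x - g x) < \<epsilon>}"

text \<open>A functional is represented by any function on all of \<open>'a \<Rightarrow> complex\<close>; only its values on
  \<^const>\<open>test_space0\<close> matter.\<close>

definition distributions ::
    "('a \<Rightarrow> 'a \<Rightarrow> real) \<Rightarrow> real \<Rightarrow> 'a measure \<Rightarrow> 'a \<Rightarrow> real \<Rightarrow> real \<Rightarrow> real \<Rightarrow>
     (('a \<Rightarrow> complex) \<Rightarrow> complex) set" where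
  "distributions d A\<^sub>0 M x\<^sub>0 \<eta> \<beta> \<gamma> =
     {f. (\<forall>g\<in>test_space0 d A\<^sub>0 M x\<^sub>0 \<eta> \<beta> \<gamma>. \<forall>h\<in>test_space0 d A\<^sub>0 M x\<^sub>0 \<eta> \<beta> \<gamma>.
            f (\<lambda>x. g x + h x) = f g + f h) \<and>
         (\<forall>g\<in>test_space0 d A\<^sub>0 M x\<^sub>0 \<eta> \<beta> \<gamma>. \<forall>c. f (\<lambda>x. c * g x) = c * f g) \<and>
         (\<exists>C. \<forall>g\<in>test_space0 d A\<^sub>0 M x\<^sub>0 \<eta> \<beta> \<gamma>.
            cmod (f g) \<le> C * test_norm d A\<^sub>0 M x\<^sub>0 \<beta> \<gamma> g)}"

definition dual_norm ::
    "('a \<Rightarrow> 'a \<Rightarrow> real) \<Rightarrow> real \<Rightarrow> 'a measure \<Rightarrow> 'a \<Rightarrow> real \<Rightarrow> real \<Rightarrow> real \<Rightarrow>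
     (('a \<Rightarrow> complex) \<Rightarrow> complex) \<Rightarrow> ennreal" where
  "dual_norm d A\<^sub>0 M x\<^sub>0 \<eta> \<beta> \<gamma> f =
     (SUP g\<in>{g \<in> test_space0 d A\<^sub>0 M x\<^sub>0 \<eta> \<beta> \<gamma>. test_norm d A\<^sub>0 M x\<^sub>0 \<beta> \<gamma> g \<le> 1}.
        ennreal (cmod (f g)))"

text \<open>\<open>Q\<^sub>k f(x) = \<langle>f, Q\<^sub>k(x,\<cdot>)\<rangle>\<close>, a bilinear pairing (no conjugation).\<close>

definition apply_kernel ::
    "('a \<Rightarrow> 'a \<Rightarrow> complex) \<Rightarrow> (('a \<Rightarrow> complex) \<Rightarrow> complex) \<Rightarrow> 'a \<Rightarrow> complex" where
  "apply_kernel K f x = f (K x)"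

definition R_kernel ::
    "('a \<Rightarrow> 'a \<Rightarrow> real) \<Rightarrow> 'a measure \<Rightarrow> real \<Rightarrow> real \<Rightarrow> nat \<Rightarrow> 'a \<Rightarrow> 'a \<Rightarrow> real" where
  "R_kernel d M \<delta> \<gamma> k x y =
     1 / (vol d M (\<delta> ^ k) x + vol2 d M x y) * (\<delta> ^ k / (\<delta> ^ k + d x y)) powr \<gamma>"

definition reproducing_kernels ::
    "('a \<Rightarrow> 'a \<Rightarrow> real) \<Rightarrow> real \<Rightarrow> 'a measure \<Rightarrow> real \<Rightarrow> nat \<Rightarrow> real \<Rightarrow> real \<Rightarrow> real \<Rightarrow>
     (nat \<Rightarrow> 'a \<Rightarrow> 'a \<Rightarrow> complex) \<Rightarrow> bool" where
  "reproducing_kernels d A\<^sub>0 M \<delta> N \<beta> \<gamma> C Qt \<longleftrightarrow>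
     (\<forall>k. L2_bounded_kernel M (Qt k) \<and>
        (\<forall>x y. cmod (Qt k x y) \<le> C * R_kernel d M \<delta> \<gamma> k x y) \<and>
        (\<forall>x x' y. d x x' \<le> (\<delta> ^ k + d x y) / (2 * A\<^sub>0) \<longrightarrow>
           cmod (Qt k x y - Qt k x' y)
             \<le> C * (d x x' / (\<delta> ^ k + d x y)) powr \<beta> * R_kernel d M \<delta> \<gamma> k x y) \<and>
        kernel_integral M (Qt k) (if k \<le> N then 1 else 0))"

text \<open>The summand of level k indexed by \<open>(\<alpha>,m)\<close>, tested against g; \<open>S = sub k \<alpha> m\<close> is the
  subcube and w the point chosen in it.\<close>

definition reproducing_term ::
    "'a measure \<Rightarrow> nat \<Rightarrow> (nat \<Rightarrow> 'a \<Rightarrow> 'a \<Rightarrow> complex) \<Rightarrow> (nat \<Rightarrow> 'a \<Rightarrow> 'a \<Rightarrow> complex) \<Rightarrow>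
     (('a \<Rightarrow> complex) \<Rightarrow> complex) \<Rightarrow> ('a \<Rightarrow> complex) \<Rightarrow> nat \<Rightarrow> 'a set \<Rightarrow> 'a \<Rightarrow> complex" where
  "reproducing_term M N Q Qt f g k S w =
     (if k = 0 then (LINT x|M. (LINT y:S|M. Qt 0 x y) * g x) * mean M S (apply_kernel (Q 0) f)
      else of_real (measure M S) * (LINT x|M. Qt k x w * g x) *
           (if k \<le> N then mean M S (apply_kernel (Q k) f) else apply_kernel (Q k) f w))"

text \<open>Convergence in the dual space is weak-*: for each test function the sum over
  \<open>\<alpha> \<in> \<A>\<^sub>k\<close> converges unconditionally, and the series over k converges.\<close>

definition reproducing_formula ::
    "('a \<Rightarrow> 'a \<Rightarrow> real) \<Rightarrow> real \<Rightarrow> 'a measure \<Rightarrow> 'a \<Rightarrow> real \<Rightarrow> real \<Rightarrow>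
     (int \<Rightarrow> 'i set) \<Rightarrow> (int \<Rightarrow> 'i \<Rightarrow> nat) \<Rightarrow> (int \<Rightarrow> 'i \<Rightarrow> nat \<Rightarrow> 'a set) \<Rightarrow>
     (nat \<Rightarrow> 'a \<Rightarrow> 'a \<Rightarrow> complex) \<Rightarrow> nat \<Rightarrow> bool" where
  "reproducing_formula d A\<^sub>0 M x\<^sub>0 \<eta> \<delta> \<A> n sub Q N \<longleftrightarrow>
     (\<forall>\<beta> \<gamma>. 0 < \<beta> \<and> \<beta> < \<eta> \<and> 0 < \<gamma> \<and> \<gamma> < \<eta> \<longrightarrow>
       (\<exists>C>0. \<forall>w :: nat \<Rightarrow> 'i \<Rightarrow> nat \<Rightarrow> 'a.
         (\<forall>k. \<forall>\<alpha>\<in>\<A> (int k). \<forall>m\<in>{1..n (int k) \<alpha>}. w k \<alpha> m \<in> sub (int k) \<alpha> m) \<longrightarrow>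
         (\<exists>Qt. reproducing_kernels d A\<^sub>0 M \<delta> N \<beta> \<gamma> C Qt \<and>
           (\<forall>f\<in>distributions d A\<^sub>0 M x\<^sub>0 \<eta> \<beta> \<gamma>. \<forall>g\<in>test_space0 d A\<^sub>0 M x\<^sub>0 \<eta> \<beta> \<gamma>.
             \<exists>s. (\<forall>k. ((\<lambda>\<alpha>. \<Sum>m=1..n (int k) \<alpha>.
                          reproducing_term M N Q Qt f g k (sub (int k) \<alpha> m) (w k \<alpha> m))
                        has_sum s k) (\<A> (int k))) \<and>
                 s sums f g))))"

definition p_index :: "real \<Rightarrow> real \<Rightarrow> real \<Rightarrow> real" where
  "p_index \<omega> s t = max (\<omega> / (\<omega> + t)) (\<omega> / (\<omega> + t + s))"

definition Sigma_p ::
    "'a measure \<Rightarrow> (int \<Rightarrow> 'i set) \<Rightarrow> (int \<Rightarrow> 'i \<Rightarrow> nat) \<Rightarrow> (int \<Rightarrow> 'i \<Rightarrow> nat \<Rightarrow> 'a set) \<Rightarrow>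
     (nat \<Rightarrow> 'a \<Rightarrow> 'a \<Rightarrow> complex) \<Rightarrow> nat \<Rightarrow> ennreal \<Rightarrow> (('a \<Rightarrow> complex) \<Rightarrow> complex) \<Rightarrow> ennreal" where
  "Sigma_p M \<A> n sub Q N p f =
     (if p = top then
        (SUP k\<in>{0..N}. SUP \<alpha>\<in>\<A> (int k). SUP m\<in>{1..n (int k) \<alpha>}.
           ennreal (mean M (sub (int k) \<alpha> m) (\<lambda>x. cmod (apply_kernel (Q k) f x))))
      else
        epow (\<Sum>k=0..N. \<Sum>\<^sub>\<infinity>\<alpha>\<in>\<A> (int k). \<Sum>m=1..n (int k) \<alpha>.
           emeasure M (sub (int k) \<alpha> m) *
           epow (ennreal (mean M (sub (int k) \<alpha> m) (\<lambda>x. cmod (apply_kernel (Q k) f x)))) (enn2real p))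
          (1 / enn2real p))"

definition besov_norm ::
    "'a measure \<Rightarrow> real \<Rightarrow> (int \<Rightarrow> 'i set) \<Rightarrow> (int \<Rightarrow> 'i \<Rightarrow> nat) \<Rightarrow> (int \<Rightarrow> 'i \<Rightarrow> nat \<Rightarrow> 'a set) \<Rightarrow>
     (nat \<Rightarrow> 'a \<Rightarrow> 'a \<Rightarrow> complex) \<Rightarrow> nat \<Rightarrow> real \<Rightarrow> ennreal \<Rightarrow> ennreal \<Rightarrow>
     (('a \<Rightarrow> complex) \<Rightarrow> complex) \<Rightarrow> ennreal" where
  "besov_norm M \<delta> \<A> n sub Q N s p q f =
     Sigma_p M \<A> n sub Q N p f +
     seq_norm {N+1..} q (\<lambda>k. ennreal (\<delta> powr (- (real k * s))) *
       Lp_norm M p (\<lambda>x. ennreal (cmod (apply_kernel (Q k) f x))))"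

definition triebel_lizorkin_norm ::
    "'a measure \<Rightarrow> real \<Rightarrow> (int \<Rightarrow> 'i set) \<Rightarrow> (int \<Rightarrow> 'i \<Rightarrow> nat) \<Rightarrow> (int \<Rightarrow> 'i \<Rightarrow> nat \<Rightarrow> 'a set) \<Rightarrow>
     (nat \<Rightarrow> 'a \<Rightarrow> 'a \<Rightarrow> complex) \<Rightarrow> nat \<Rightarrow> real \<Rightarrow> ennreal \<Rightarrow> ennreal \<Rightarrow>
     (('a \<Rightarrow> complex) \<Rightarrow> complex) \<Rightarrow> ennreal" where
  "triebel_lizorkin_norm M \<delta> \<A> n sub Q N s p q f =
     Sigma_p M \<A> n sub Q N p f +
     Lp_norm M p (\<lambda>x. seq_norm {N+1..} q (\<lambda>k. ennreal (\<delta> powr (- (real k * s))) *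
       ennreal (cmod (apply_kernel (Q k) f x))))"

definition besov_space ::
    "('a \<Rightarrow> 'a \<Rightarrow> real) \<Rightarrow> real \<Rightarrow> 'a measure \<Rightarrow> 'a \<Rightarrow> real \<Rightarrow> real \<Rightarrow>
     (int \<Rightarrow> 'i set) \<Rightarrow> (int \<Rightarrow> 'i \<Rightarrow> nat) \<Rightarrow> (int \<Rightarrow> 'i \<Rightarrow> nat \<Rightarrow> 'a set) \<Rightarrow>
     (nat \<Rightarrow> 'a \<Rightarrow> 'a \<Rightarrow> complex) \<Rightarrow> nat \<Rightarrow> real \<Rightarrow> real \<Rightarrow> real \<Rightarrow> ennreal \<Rightarrow> ennreal \<Rightarrow>
     (('a \<Rightarrow> complex) \<Rightarrow> complex) set" where
  "besov_space d A\<^sub>0 M x\<^sub>0 \<eta> \<delta> \<A> n sub Q N \<beta> \<gamma> s p q =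
     {f \<in> distributions d A\<^sub>0 M x\<^sub>0 \<eta> \<beta> \<gamma>. besov_norm M \<delta> \<A> n sub Q N s p q f < top}"

definition triebel_lizorkin_space ::
    "('a \<Rightarrow> 'a \<Rightarrow> real) \<Rightarrow> real \<Rightarrow> 'a measure \<Rightarrow> 'a \<Rightarrow> real \<Rightarrow> real \<Rightarrow>
     (int \<Rightarrow> 'i set) \<Rightarrow> (int \<Rightarrow> 'i \<Rightarrow> nat) \<Rightarrow> (int \<Rightarrow> 'i \<Rightarrow> nat \<Rightarrow> 'a set) \<Rightarrow>
     (nat \<Rightarrow> 'a \<Rightarrow> 'a \<Rightarrow> complex) \<Rightarrow> nat \<Rightarrow> real \<Rightarrow> real \<Rightarrow> real \<Rightarrow> ennreal \<Rightarrow> ennreal \<Rightarrow>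
     (('a \<Rightarrow> complex) \<Rightarrow> complex) set" where
  "triebel_lizorkin_space d A\<^sub>0 M x\<^sub>0 \<eta> \<delta> \<A> n sub Q N \<beta> \<gamma> s p q =
     {f \<in> distributions d A\<^sub>0 M x\<^sub>0 \<eta> \<beta> \<gamma>. triebel_lizorkin_norm M \<delta> \<A> n sub Q N s p q f < top}"

text \<open>The standing restriction on the exponents of the test functions; \<open>1 / \<infinity> = 0\<close> in
  \<^typ>\<open>ennreal\<close>.\<close>

definition admissible ::
    "real \<Rightarrow> real \<Rightarrow> real \<Rightarrow> ennreal \<Rightarrow> real \<Rightarrow> real \<Rightarrow> bool" where
  "admissible \<omega> \<eta> s p \<beta> \<gamma> \<longleftrightarrow>
     max 0 (- s + \<omega> * max 0 (enn2real (1 / p) - 1)) < \<beta> \<and> \<beta> < \<eta> \<and>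
     \<omega> * max 0 (enn2real (1 / p) - 1) < \<gamma> \<and> \<gamma> < \<eta>"

text \<open>A distribution f belongs to the dual space with exponents \<open>\<beta>\<close>, \<open>\<gamma>\<close> if its restriction to
  \<open>\<G>(\<eta>,\<eta>)\<close> has an extension F in that space; on \<^const>\<open>test_space0\<close>, F is unique by density.\<close>

definition extends_test ::
    "('a \<Rightarrow> 'a \<Rightarrow> real) \<Rightarrow> real \<Rightarrow> 'a measure \<Rightarrow> 'a \<Rightarrow> real \<Rightarrow> real \<Rightarrow> real \<Rightarrow>
     (('a \<Rightarrow> complex) \<Rightarrow> complex) \<Rightarrow> (('a \<Rightarrow> complex) \<Rightarrow> complex) \<Rightarrow> bool" where
  "extends_test d A\<^sub>0 M x\<^sub>0 \<eta> \<beta> \<gamma> f F \<longleftrightarrow>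
     F \<in> distributions d A\<^sub>0 M x\<^sub>0 \<eta> \<beta> \<gamma> \<and> (\<forall>g\<in>test_space d A\<^sub>0 M x\<^sub>0 \<eta> \<eta>. F g = f g)"

end

theory Submission
  imports Defs
begin

text \<open>
  For \<open>g \<in> \<G>(\<eta>,\<eta>)\<close> expand \<open>\<langle>f,g\<rangle>\<close> by the reproducing formula with exponents close to \<open>\<eta>\<close>; as the
  dual spaces increase with the exponents, f is admissible there. For the new exponents \<open>\<beta>\<close>, \<open>\<gamma>\<close>, only the
  size of the kernels of the formula and their cancellation for \<open>k > N\<close> are needed, and give
  \<open>|\<integral> Q\<^sub>k(x,w) g(x) d\<mu>(x)| \<le> C \<parallel>g\<parallel> \<delta> powr (k * \<beta>) * D\<^sub>\<gamma>(w)\<close>. The sampling points may depend on f, since the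
  constants of the formula do not depend on them; choosing w almost minimal for \<open>|Q\<^sub>k f|\<close> on its cube turns
  the sum over the cubes into \<open>\<parallel>Q\<^sub>k f\<parallel>\<^sub>p\<close> at the cost of a factor \<open>\<delta> powr (- k * \<omega> * max 0 (1/p - 1))\<close>, where
  \<open>\<gamma> > \<omega> * max 0 (1/p - 1)\<close> compensates the growth of the volume. The series over k is then geometric because
  \<open>\<beta> > - s + \<omega> * max 0 (1/p - 1)\<close>. Both function-space norms dominate
  \<open>\<Sigma>\<^sub>p(f) + sup\<^sub>k \<delta> powr (- k * s) * \<parallel>Q\<^sub>k f\<parallel>\<^sub>p\<close> up to a constant, so the Besov and the Triebel-Lizorkin case are treated
  together, and the bound extends from \<open>\<G>(\<eta>,\<eta>)\<close> to its closure by density.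
\<close>

subsection \<open>Volumes and kernels on a space of homogeneous type\<close>

text \<open>The norms control \<open>Q\<^sub>k f\<close> only in an \<open>L\<^sup>p\<close>
  average, while the formula samples it at points. An almost minimal sample lies, up to \<epsilon>,
  below every value on its cube, so integration over the cube turns it into a part of the norm. The
  infimum need not be attained. The error \<epsilon> can still be removed at the end: the weights
  \<open>measure M S * D_\<gamma>(w)\<close> have a bounded sum over the cubes of a level, and
  \<open>\<delta> powr (k * \<beta>)\<close> is summable over the levels. Measurability shapes the
  estimates: balls are measurable, but the axioms say nothing about how their volume depends on the
  centre. Kernel bounds are therefore recentred at a point that stays fixed during integration, so
  that the variable enters only through a distance. The gain \<open>r powr \<beta>\<close> at scale
  r is paid for with decay of the kernel. From decay exponent c there remains
  \<open>c - \<beta>\<close>, which has to be positive for an integral bound uniform in r. This is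
  why the formula is used with a second exponent above \<beta>.\<close>

locale homogeneous_space =
  fixes d :: "'a \<Rightarrow> 'a \<Rightarrow> real" and A\<^sub>0 :: real and M :: "'a measure" and C\<^sub>\<mu> :: real
  assumes homogeneous: "homogeneous_type d A\<^sub>0 M C\<^sub>\<mu>"
begin

abbreviation \<omega> :: real where "\<omega> \<equiv> upper_dim C\<^sub>\<mu>"
abbreviation V :: "real \<Rightarrow> 'a \<Rightarrow> real" where "V \<equiv> vol d M"

lemma A\<^sub>0_ge_1: "1 \<le> A\<^sub>0"
  and d_nonneg [simp]: "0 \<le> d x y"
  and d_self [simp]: "d x x = 0"
  and space_UNIV [simp]: "space M = UNIV"
  using homogeneous by (simp_all add: homogeneous_type_def quasi_metric_def)

lemma d_commute: "d x y = d y x"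
  and d_triangle: "d x u \<le> A\<^sub>0 * (d x y + d y u)"
proof -
  have "(\<forall>x y. d x y = d y x) \<and> (\<forall>x y u. d x u \<le> A\<^sub>0 * (d x y + d y u))"
    using homogeneous unfolding homogeneous_type_def quasi_metric_def by (elim conjE) (intro conjI)
  then show "d x y = d y x" "d x u \<le> A\<^sub>0 * (d x y + d y u)" by blast+
qed

lemma qball_empty: "r \<le> 0 \<Longrightarrow> qball d x r = {}"
proof -
  assume r: "r \<le> 0"
  have "\<not> d x y < r" for y
    using d_nonneg[of x y] r by linarith
  then show ?thesis by (simp add: qball_def)
qed

lemma
  assumes "0 < r"
  shows qball_sets: "qball d x r \<in> sets M"
    and vol_pos: "0 < V r x"
    and emeasure_qball: "emeasure M (qball d x r) = ennreal (V r x)"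
    and vol_doubling: "V (2 * r) x \<le> C\<^sub>\<mu> * V r x"
proof -
  have h: "qball d x r \<in> sets M \<and>
        0 < emeasure M (qball d x r) \<and> emeasure M (qball d x r) < top \<and>
        emeasure M (qball d x (2 * r)) \<le> ennreal C\<^sub>\<mu> * emeasure M (qball d x r)" 
    and f2: "emeasure M (qball d x (2*r)) < top"
    using homogeneous assms by (simp_all add: homogeneous_type_def)
  show "qball d x r \<in> sets M" using h by simp
  show e: "emeasure M (qball d x r) = ennreal (V r x)"
    using h by (simp add: vol_def emeasure_eq_ennreal_measure less_top)
  then show p: "0 < V r x" using h by simp
  have e2: "emeasure M (qball d x (2*r)) = ennreal (V (2*r) x)"
    using f2 by (simp add: vol_def emeasure_eq_ennreal_measure less_top)
  have "0 \<le> V (2*r) x" by (simp add: vol_def)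
  have le: "ennreal (V (2*r) x) \<le> ennreal C\<^sub>\<mu> * ennreal (V r x)"
    using h e e2 by simp
  show "V (2 * r) x \<le> C\<^sub>\<mu> * V r x"
  proof (cases "0 \<le> C\<^sub>\<mu>")
    case True
    then show ?thesis using le p by (simp add: ennreal_mult[symmetric] ennreal_le_iff)
  next
    case False
    \<comment> \<open>\<open>ennreal\<close> sends a negative constant to 0, so the doubling
      inequality would make a ball null.\<close>
    then have "emeasure M (qball d x (2 * r)) \<le> 0"
      using h by (simp add: ennreal_neg)
    moreover have "0 < emeasure M (qball d x (2 * r))"
      using homogeneous assms by (simp add: homogeneous_type_def)
    ultimately show ?thesis by simp
  qed
qed

section \<open>Volume comparison between balls\<close>

lemma vol_mono_set:
  assumes "qball d x r \<subseteq> qball d y t" "0 < t"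
  shows "V r x \<le> V t y"
proof (cases "0 < r")
  case True
  have "emeasure M (qball d x r) \<le> emeasure M (qball d y t)"
    by (rule emeasure_mono[OF assms(1) qball_sets[OF assms(2)]])
  then show ?thesis
    using True assms(2) vol_pos[OF assms(2), of y] by (simp add: emeasure_qball ennreal_le_iff)
next
  case False
  then have "qball d x r = {}" by (simp add: qball_empty)
  then show ?thesis by (simp add: vol_def)
qed

lemma vol_mono: "r \<le> t \<Longrightarrow> 0 < t \<Longrightarrow> V r x \<le> V t x"
  by (rule vol_mono_set) (auto simp: qball_def)

lemma doubling_constant_ge_1: "1 \<le> C\<^sub>\<mu>"
proof -
  have "V 1 x \<le> C\<^sub>\<mu> * V 1 x" for x
    using vol_mono[of 1 2 x] vol_doubling[of 1 x] by simp
  then show ?thesis using vol_pos[of 1] by (metis mult_le_cancel_right1 less_le_not_le zero_less_one)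
qed

lemma upper_dim_nonneg: "0 \<le> \<omega>"
  using doubling_constant_ge_1 by (simp add: upper_dim_def)

text \<open>Doubling is iterated \<open>m\<close> times with \<open>2 ^ m \<ge> l\<close>. Rounding
  \<open>log 2 l\<close> up costs the extra factor \<open>C\<^sub>\<mu>\<close>, and
  \<open>C\<^sub>\<mu> powr (log 2 l)\<close> is \<open>l powr \<omega>\<close>.\<close>

lemma vol_scale:
  assumes "0 < r" "1 \<le> l"
  shows "V (l * r) x \<le> C\<^sub>\<mu> * l powr \<omega> * V r x"
proof -
  define m where "m = nat \<lceil>log 2 l\<rceil>"
  have l0: "0 \<le> log 2 l" using assms by simp
  have m: "log 2 l \<le> real m" "real m \<le> 1 + log 2 l"
    using l0 unfolding m_def by linarith+
  have pow: "V (2 ^ j * r) x \<le> C\<^sub>\<mu> ^ j * V r x" for j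
  proof (induction j)
    case (Suc j)
    have "V (2 * (2 ^ j * r)) x \<le> C\<^sub>\<mu> * V (2 ^ j * r) x"
      by (rule vol_doubling) (use assms in simp)
    also have "\<dots> \<le> C\<^sub>\<mu> * (C\<^sub>\<mu> ^ j * V r x)"
      using Suc doubling_constant_ge_1 by (intro mult_left_mono) auto
    finally show ?case by (simp add: mult.assoc)
  qed simp
  have "l = 2 powr (log 2 l)" using assms by simp
  also have "\<dots> \<le> 2 powr (real m)" using m by (intro powr_mono) auto
  finally have "l \<le> 2 ^ m" by (simp add: powr_realpow)
  then have "V (l * r) x \<le> V (2 ^ m * r) x"
    using assms by (intro vol_mono) auto
  also have "\<dots> \<le> C\<^sub>\<mu> ^ m * V r x" by (rule pow)
  also have "C\<^sub>\<mu> ^ m = C\<^sub>\<mu> powr (real m)"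
    using doubling_constant_ge_1 by (simp add: powr_realpow)
  also have "\<dots> \<le> C\<^sub>\<mu> powr (1 + log 2 l)"
    using m doubling_constant_ge_1 by (intro powr_mono) auto
  also have "\<dots> = C\<^sub>\<mu> * C\<^sub>\<mu> powr (log 2 l)"
    using doubling_constant_ge_1 by (simp add: powr_add)
  also have "C\<^sub>\<mu> powr (log 2 l) = l powr \<omega>"
    using assms doubling_constant_ge_1
    by (simp add: upper_dim_def log_def powr_def field_simps)
  finally show ?thesis using vol_pos[OF assms(1), of x] by (simp add: mult_right_mono)
qed

text \<open>The quasi-triangle inequality puts the ball of radius \<open>t\<close> about
  \<open>w\<close> inside the ball of radius \<open>l * t'\<close> about \<open>y\<close>, so centre
  and radius change together at the price of one dilation.\<close>

lemma vol_change:
  assumes "0 < t'" "1 \<le> l" "A\<^sub>0 * (d y w + t) \<le> l * t'"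
  shows "V t w \<le> C\<^sub>\<mu> * l powr \<omega> * V t' y"
proof -
  have "qball d w t \<subseteq> qball d y (l * t')"
  proof
    fix u assume "u \<in> qball d w t"
    then have "d w u < t" by (simp add: qball_def)
    then have "A\<^sub>0 * (d y w + d w u) < A\<^sub>0 * (d y w + t)"
      using A\<^sub>0_ge_1 by simp
    then show "u \<in> qball d y (l * t')"
      using d_triangle[of y u w] assms(3) by (simp add: qball_def)
  qed
  then have "V t w \<le> V (l * t') y"
    using assms by (intro vol_mono_set) auto
  also have "\<dots> \<le> C\<^sub>\<mu> * l powr \<omega> * V t' y"
    using assms by (intro vol_scale) auto
  finally show ?thesis .
qed

text \<open>Up to constants, \<open>hom_kernel r c y (r + d y x)\<close> is \<open>R\<^sub>k(x,y)\<close> for \<open>r = \<delta>\<^sup>k\<close>, and it is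
  \<open>D\<^sub>c(x)\<close> for \<open>r = 1\<close>, \<open>y = x\<^sub>0\<close>.\<close>

definition hom_kernel :: "real \<Rightarrow> real \<Rightarrow> 'a \<Rightarrow> real \<Rightarrow> real" where
  "hom_kernel r c y t = (r / t) powr c / V t y"

lemma hom_kernel_nonneg [simp]: "0 \<le> hom_kernel r c y t"
  by (simp add: hom_kernel_def vol_def)

text \<open>The decay contributes \<open>l powr c\<close> (as \<open>A\<^sub>0 \<ge> 1\<close>, the
  last hypothesis contains \<open>t \<le> l * t'\<close>), the volume
  \<open>l powr \<omega>\<close>. Every later change of the centre of a kernel is an instance of
  this.\<close>

lemma hom_kernel_change:
  assumes "0 < r" "0 \<le> c" "0 < t'" "0 < t" "1 \<le> l" "A\<^sub>0 * (d y w + t) \<le> l * t'"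
  shows "hom_kernel r c y t' \<le> C\<^sub>\<mu> * l powr (c + \<omega>) * hom_kernel r c w t"
proof -
  have "t \<le> A\<^sub>0 * (d y w + t)"
    using mult_mono[OF A\<^sub>0_ge_1, of t "d y w + t"] assms(4) A\<^sub>0_ge_1 by simp
  then have "r / t' \<le> l * (r / t)"
  proof -
    have "t \<le> l * t'" using \<open>t \<le> A\<^sub>0 * (d y w + t)\<close> assms(6) by linarith
    then have "r * t \<le> r * (l * t')" using assms(1) by (intro mult_left_mono) auto
    then show ?thesis using assms by (simp add: field_simps)
  qed
  then have 1: "(r / t') powr c \<le> l powr c * (r / t) powr c"
    using assms by (simp flip: powr_mult add: powr_mono2)
  have 2: "1 / V t' y \<le> C\<^sub>\<mu> * l powr \<omega> / V t w"
    using vol_change[OF assms(3,5,6)] vol_pos[OF assms(3), of y] vol_pos[OF assms(4), of w]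
    by (simp add: field_simps)
  have "(r / t') powr c * (1 / V t' y) \<le> (l powr c * (r / t) powr c) * (C\<^sub>\<mu> * l powr \<omega> / V t w)"
    by (rule mult_mono[OF 1 2]) (auto simp: vol_def)
  then show ?thesis by (simp add: hom_kernel_def powr_add field_simps)
qed

section \<open>Measurability and uniform integrability of the homogeneous kernel\<close>

lemma d_measurable: "d y \<in> borel_measurable M"
proof (rule borel_measurableI_less)
  fix a :: real
  have "{x \<in> space M. d y x < a} = qball d y a" by (simp add: qball_def)
  moreover have "qball d y a \<in> sets M"
  proof (cases "0 < a")
    case False
    then have "qball d y a = {}" by (simp add: qball_empty)
    then show ?thesis by simp
  qed (rule qball_sets)
  ultimately show "{x \<in> space M. d y x < a} \<in> sets M" by simp
qed

lemma vol_borel: "(\<lambda>t. V t y) \<in> borel_measurable borel"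
proof (rule borel_measurable_mono, rule monoI)
  fix r t :: real assume "r \<le> t"
  show "V r y \<le> V t y"
  proof (cases "0 < t")
    case False
    then have "qball d y r = {}" using \<open>r \<le> t\<close> by (simp add: qball_empty)
    then show ?thesis by (simp add: vol_def)
  qed (use \<open>r \<le> t\<close> in \<open>rule vol_mono\<close>)
qed

text \<open>The centre is fixed, and the volume is monotone in the radius, hence Borel;
  \<open>x\<close> enters only through \<open>d y x\<close>.\<close>

lemma hom_kernel_measurable: "(\<lambda>x. hom_kernel r c y (r + d y x)) \<in> borel_measurable M"
proof -
  note [measurable] = d_measurable[of y]
  have [measurable]: "(\<lambda>x. V (r + d y x) y) \<in> borel_measurable M"
    by (rule measurable_compose[OF _ vol_borel]) measurable
  show ?thesis unfolding hom_kernel_def by measurable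
qed

text \<open>The sum of the geometric series with ratio \<open>2 powr (- c)\<close> that bounds the
  integral over dyadic shells.\<close>

definition hom_const :: "real \<Rightarrow> real" where
  "hom_const c = C\<^sub>\<mu> / (1 - 2 powr (- c))"

lemma hom_const_pos: "0 < c \<Longrightarrow> 0 < hom_const c"
  using doubling_constant_ge_1 by (simp add: hom_const_def powr_less_one)

text \<open>On the shell \<open>2 ^ j * r \<le> r + d y x < 2 ^ Suc j * r\<close> the kernel is at
  most \<open>q ^ j / V (2 ^ j * r) y\<close>, and the shell lies in the ball of twice the radius
  occurring there. Doubling bounds its contribution by \<open>C\<^sub>\<mu> * q ^ j\<close>.
  Independence of \<open>r\<close> and \<open>y\<close> lets one constant serve all levels and all
  sampling points.\<close>

lemma nn_integral_hom_kernel: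
  assumes "0 < r" "0 < c"
  shows "(\<integral>\<^sup>+x. ennreal (hom_kernel r c y (r + d y x)) \<partial>M) \<le> ennreal (hom_const c)"
proof -
  define q where "q = (2::real) powr (- c)"
  have q: "0 < q" "q < 1" using assms by (auto simp: q_def powr_less_one)
  define B where "B j = qball d y (2 ^ Suc j * r)" for j :: nat
  define a where "a j = q ^ j / V (2 ^ j * r) y" for j :: nat
  have a0: "0 \<le> a j" for j using q by (simp add: a_def vol_def)
  have Bs [measurable]: "B j \<in> sets M" for j
    using assms unfolding B_def by (intro qball_sets) auto
  have pw: "ennreal (hom_kernel r c y (r + d y x)) \<le> (\<Sum>j. ennreal (a j) * indicator (B j) x)" for x
  proof -
    define t where "t = r + d y x"
    have t: "r \<le> t" "0 < t" using assms by (auto simp: t_def add_pos_nonneg)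
    define j where "j = nat \<lfloor>log 2 (t / r)\<rfloor>"
    have l0: "0 \<le> log 2 (t / r)" using t assms by simp
    have j: "real j \<le> log 2 (t / r)" "log 2 (t / r) < real (Suc j)"
      using l0 unfolding j_def by linarith+
    have "2 ^ j \<le> t / r"
      using j(1) t assms by (simp add: le_log_iff powr_realpow)
    then have j1: "2 ^ j * r \<le> t" using assms by (simp add: field_simps)
    have "t / r < 2 powr real (Suc j)"
      using j(2) t assms by (simp add: log_less_iff)
    then have "t / r < 2 ^ Suc j" by (subst (asm) powr_realpow) auto
    then have j2: "t < 2 ^ Suc j * r" using assms by (simp add: field_simps)
    have xB: "x \<in> B j" using j2 assms by (simp add: B_def qball_def t_def)
    have "(r / t) powr c \<le> (1 / 2 ^ j) powr c"
      using j1 t assms by (intro powr_mono2) (auto simp: field_simps)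
    also have "(1 / 2 ^ j) powr c = q ^ j"
    proof -
      have "(1 / 2 ^ j :: real) = 2 powr (- real j)" by (simp add: powr_minus powr_realpow divide_inverse)
      then have "(1 / 2 ^ j :: real) powr c = 2 powr (- c * real j)" by (simp add: powr_powr mult.commute)
      also have "\<dots> = q powr real j" by (simp add: q_def powr_powr)
      finally show ?thesis using q by (simp add: powr_realpow)
    qed
    finally have "(r / t) powr c \<le> q ^ j" .
    moreover have "V (2 ^ j * r) y \<le> V t y" using j1 t by (rule_tac vol_mono) auto
    moreover have "0 < V (2 ^ j * r) y" using assms by (intro vol_pos) auto
    ultimately have "hom_kernel r c y t \<le> a j"
      unfolding hom_kernel_def a_def using q by (intro frac_le) auto
    then have "ennreal (hom_kernel r c y t) \<le> ennreal (a j) * indicator (B j) x"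
      using xB by (simp add: ennreal_leI)
    also have "\<dots> \<le> (\<Sum>j. ennreal (a j) * indicator (B j) x)"
      using sum_le_suminf[of "\<lambda>j. ennreal (a j) * indicator (B j) x" "{j}"] by (simp del: sum_mult_indicator)
    finally show ?thesis by (simp add: t_def)
  qed
  have "(\<integral>\<^sup>+x. ennreal (hom_kernel r c y (r + d y x)) \<partial>M) \<le>
        (\<integral>\<^sup>+x. (\<Sum>j. ennreal (a j) * indicator (B j) x) \<partial>M)"
    by (rule nn_integral_mono) (rule pw)
  also have "\<dots> = (\<Sum>j. \<integral>\<^sup>+x. ennreal (a j) * indicator (B j) x \<partial>M)"
    by (rule nn_integral_suminf) measurable
  also have "\<dots> = (\<Sum>j. ennreal (a j) * emeasure M (B j))"
    by (simp add: nn_integral_cmult_indicator)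
  also have "\<dots> \<le> (\<Sum>j. ennreal (C\<^sub>\<mu> * q ^ j))"
  proof (intro suminf_le allI)
    fix j
    have p: "0 < 2 ^ j * r" using assms by simp
    have "V (2 * (2 ^ j * r)) y \<le> C\<^sub>\<mu> * V (2 ^ j * r) y" by (rule vol_doubling[OF p])
    moreover have "0 < V (2 ^ j * r) y" by (rule vol_pos[OF p])
    ultimately have "q ^ j * V (2 * (2 ^ j * r)) y / V (2 ^ j * r) y \<le> C\<^sub>\<mu> * q ^ j"
      using q by (simp add: field_simps)
    moreover have "emeasure M (B j) = ennreal (V (2 * (2 ^ j * r)) y)"
      using p by (simp add: B_def emeasure_qball mult.assoc)
    ultimately show "ennreal (a j) * emeasure M (B j) \<le> ennreal (C\<^sub>\<mu> * q ^ j)"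
      using a0 by (simp add: a_def ennreal_leI vol_def flip: ennreal_mult)
  qed auto
  also have "\<dots> = ennreal (\<Sum>j. C\<^sub>\<mu> * q ^ j)"
    using q doubling_constant_ge_1
    by (intro suminf_ennreal2) (auto intro!: summable_mult summable_geometric)
  also have "(\<Sum>j. C\<^sub>\<mu> * q ^ j) = hom_const c"
    using q by (simp add: suminf_mult summable_geometric suminf_geometric hom_const_def q_def)
  finally show ?thesis .
qed

text \<open>The denominator is at least the volume of radius \<open>max 1 (d x\<^sub>0 x)\<close>,
  and \<open>1 + d x\<^sub>0 x\<close> is at most twice this radius, so one doubling
  suffices.\<close>

lemma D_weight_le:
  "D_weight d M x\<^sub>0 g x \<le> C\<^sub>\<mu> * hom_kernel 1 g x\<^sub>0 (1 + d x\<^sub>0 x)"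
proof -
  let ?t = "1 + d x\<^sub>0 x"
  have t: "0 < ?t" by (simp add: add_pos_nonneg)
  have "V ?t x\<^sub>0 \<le> V (2 * max 1 (d x\<^sub>0 x)) x\<^sub>0" by (intro vol_mono) auto
  also have "\<dots> \<le> C\<^sub>\<mu> * V (max 1 (d x\<^sub>0 x)) x\<^sub>0" by (intro vol_doubling) auto
  also have "\<dots> \<le> C\<^sub>\<mu> * (V 1 x\<^sub>0 + vol2 d M x\<^sub>0 x)"
    using doubling_constant_ge_1 by (intro mult_left_mono) (auto simp: max_def vol_def vol2_def)
  finally have "V ?t x\<^sub>0 \<le> C\<^sub>\<mu> * (V 1 x\<^sub>0 + vol2 d M x\<^sub>0 x)" .
  moreover have "0 < V ?t x\<^sub>0" by (rule vol_pos[OF t])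
  moreover have "0 < V 1 x\<^sub>0 + vol2 d M x\<^sub>0 x"
    using vol_pos[of 1 x\<^sub>0] by (simp add: vol2_def add_pos_nonneg)
  ultimately have "1 / (V 1 x\<^sub>0 + vol2 d M x\<^sub>0 x) \<le> C\<^sub>\<mu> / V ?t x\<^sub>0"
    by (simp add: field_simps)
  then have "1 / (V 1 x\<^sub>0 + vol2 d M x\<^sub>0 x) * ?t powr (-g) \<le> C\<^sub>\<mu> / V ?t x\<^sub>0 * ?t powr (-g)"
    by (rule mult_right_mono) simp
  then show ?thesis
    using t by (simp add: D_weight_def hom_kernel_def powr_minus powr_divide field_simps)
qed

text \<open>One doubling as for \<open>D_weight\<close>, then a change of centre from
  \<open>x\<close> to \<open>y\<close>: the kernels of the formula are integrated in their first
  variable, so the centre must be the second.\<close>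

lemma R_kernel_le:
  assumes "0 < \<delta>" "0 \<le> c"
  shows "R_kernel d M \<delta> c k x y \<le>
    C\<^sub>\<mu>\<^sup>2 * (2 * A\<^sub>0) powr (c + \<omega>) * hom_kernel (\<delta> ^ k) c y (\<delta> ^ k + d y x)"
proof -
  define r where "r = \<delta> ^ k"
  have r: "0 < r" using assms by (simp add: r_def)
  let ?t = "r + d x y"
  have t: "0 < ?t" using r by (simp add: add_pos_nonneg)
  have "V ?t x \<le> V (2 * max r (d x y)) x" using r by (intro vol_mono) auto
  also have "\<dots> \<le> C\<^sub>\<mu> * V (max r (d x y)) x" using r by (intro vol_doubling) auto
  also have "\<dots> \<le> C\<^sub>\<mu> * (V r x + vol2 d M x y)"
    using doubling_constant_ge_1 by (intro mult_left_mono) (auto simp: max_def vol_def vol2_def)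
  finally have "V ?t x \<le> C\<^sub>\<mu> * (V r x + vol2 d M x y)" .
  moreover have "0 < V ?t x" by (rule vol_pos[OF t])
  moreover have "0 < V r x + vol2 d M x y"
    using vol_pos[OF r, of x] by (simp add: vol2_def add_pos_nonneg)
  ultimately have "1 / (V r x + vol2 d M x y) \<le> C\<^sub>\<mu> / V ?t x"
    by (simp add: field_simps)
  then have "1 / (V r x + vol2 d M x y) * (r / ?t) powr c \<le> C\<^sub>\<mu> / V ?t x * (r / ?t) powr c"
    by (rule mult_right_mono) simp
  then have 1: "R_kernel d M \<delta> c k x y \<le> C\<^sub>\<mu> * hom_kernel r c x ?t"
    by (simp add: R_kernel_def hom_kernel_def r_def)
  have "A\<^sub>0 * (d x y + ?t) \<le> 2 * A\<^sub>0 * ?t"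
    using A\<^sub>0_ge_1 r by (simp add: algebra_simps)
  then have "hom_kernel r c x ?t \<le> C\<^sub>\<mu> * (2 * A\<^sub>0) powr (c + \<omega>) * hom_kernel r c y ?t"
    using A\<^sub>0_ge_1 r assms t by (intro hom_kernel_change) auto
  then have "C\<^sub>\<mu> * hom_kernel r c x ?t \<le> C\<^sub>\<mu> * (C\<^sub>\<mu> * (2 * A\<^sub>0) powr (c + \<omega>) * hom_kernel r c y ?t)"
    using doubling_constant_ge_1 by (intro mult_left_mono) auto
  with 1 show ?thesis by (simp add: r_def power2_eq_square mult.assoc d_commute)
qed

end

subsection \<open>Pairing kernels with test functions\<close>

locale test_setting = homogeneous_space d A\<^sub>0 M C\<^sub>\<mu>
  for d :: "'a \<Rightarrow> 'a \<Rightarrow> real" and A\<^sub>0 :: real and M :: "'a measure" and C\<^sub>\<mu> :: real +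
  fixes x\<^sub>0 :: 'a and \<beta> \<gamma> :: real
  assumes \<beta>_pos: "0 < \<beta>" and \<gamma>_pos: "0 < \<gamma>"
begin

abbreviation T :: "'a \<Rightarrow> real" where "T x \<equiv> 1 + d x\<^sub>0 x"

abbreviation G :: "'a \<Rightarrow> real" where "G x \<equiv> hom_kernel 1 \<gamma> x\<^sub>0 (T x)"

lemma T_ge_1: "1 \<le> T x" by simp

lemma T_pos: "0 < T x" using T_ge_1[of x] by linarith

lemma G_pos: "0 < G x"
  using T_pos[of x] vol_pos[OF T_pos[of x], of x\<^sub>0] by (simp add: hom_kernel_def)

lemma weight_change:
  assumes "1 \<le> l" "T w \<le> l * T x"
  shows "G x \<le> C\<^sub>\<mu> * (A\<^sub>0 * l) powr (\<gamma> + \<omega>) * G w"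
proof (rule hom_kernel_change)
  show "1 \<le> A\<^sub>0 * l" using mult_mono[of 1 A\<^sub>0 1 l] A\<^sub>0_ge_1 assms by simp
  show "A\<^sub>0 * (d x\<^sub>0 x\<^sub>0 + T w) \<le> A\<^sub>0 * l * T x"
    using mult_left_mono[OF assms(2), of A\<^sub>0] A\<^sub>0_ge_1 by simp
qed (use T_pos \<gamma>_pos in auto)

text \<open>The hypothesis is the range in which the regularity condition of a test function at
  \<open>w\<close> applies. There \<open>A\<^sub>0 * d w x\<close> is at most \<open>T w / 2\<close>
  and can be absorbed into the left-hand side.\<close>

lemma weight_near:
  assumes "2 * A\<^sub>0 * d w x \<le> T w"
  shows "G x \<le> C\<^sub>\<mu> * (2 * A\<^sub>0\<^sup>2) powr (\<gamma> + \<omega>) * G w"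
proof -
  have "T w \<le> 1 + A\<^sub>0 * (d x\<^sub>0 x + d w x)"
    using d_triangle[of x\<^sub>0 w x] by (simp add: d_commute)
  also have "\<dots> \<le> A\<^sub>0 * T x + A\<^sub>0 * d w x"
    using A\<^sub>0_ge_1 by (simp add: distrib_left)
  also have "A\<^sub>0 * d w x \<le> T w / 2"
    using assms by (simp add: mult.assoc)
  finally have "T w \<le> A\<^sub>0 * T x + T w / 2" by simp
  moreover have "a \<le> 2 * b" if "a \<le> b + a / 2" for a b :: real using that by simp
  ultimately have "T w \<le> 2 * A\<^sub>0 * T x" unfolding mult.assoc by blast
  then show ?thesis
    using weight_change[of "2 * A\<^sub>0" w x] A\<^sub>0_ge_1 by (simp add: power2_eq_square mult.assoc mult.left_commute)
qed

text \<open>Here \<open>d w x\<close> dominates \<open>T w\<close>, so the kernel at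
  \<open>w\<close> can be recentred at \<open>x\<^sub>0\<close> with radius \<open>T w\<close>. It
  then no longer depends on \<open>x\<close>: of its decay, \<open>r powr c\<close> is split off as
  gain, and \<open>\<gamma> \<le> c\<close> leaves \<open>G w\<close>.\<close>

lemma hom_kernel_far:
  assumes "T w < 2 * A\<^sub>0 * d w x" "0 < r" "r \<le> 1" "\<gamma> \<le> c"
  shows "hom_kernel r c w (r + d w x) \<le> C\<^sub>\<mu> * (4 * A\<^sub>0\<^sup>2) powr (c + \<omega>) * r powr c * G w"
proof -
  let ?t = "r + d w x"
  have t: "T w \<le> 2 * A\<^sub>0 * ?t"
  proof -
    have "0 \<le> A\<^sub>0 * r" using A\<^sub>0_ge_1 assms by simp
    then show ?thesis using assms(1) by (simp add: algebra_simps)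
  qed
  have "d w x\<^sub>0 + T w \<le> 2 * T w" by (simp add: d_commute)
  then have "A\<^sub>0 * (d w x\<^sub>0 + T w) \<le> A\<^sub>0 * (2 * (2 * A\<^sub>0 * ?t))"
    using A\<^sub>0_ge_1 t by (intro mult_left_mono) auto
  then have 1: "A\<^sub>0 * (d w x\<^sub>0 + T w) \<le> 4 * A\<^sub>0\<^sup>2 * ?t"
    by (simp add: power2_eq_square algebra_simps)
  have A: "1 \<le> 4 * A\<^sub>0\<^sup>2" using one_le_power[OF A\<^sub>0_ge_1, of 2] by simp
  have "hom_kernel r c w ?t \<le> C\<^sub>\<mu> * (4 * A\<^sub>0\<^sup>2) powr (c + \<omega>) * hom_kernel r c x\<^sub>0 (T w)"
    using assms A 1 T_pos[of w] \<gamma>_pos by (intro hom_kernel_change) (auto simp: add_pos_nonneg)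
  also have "hom_kernel r c x\<^sub>0 (T w) \<le> r powr c * G w"
  proof -
    have "(r / T w) powr c = r powr c * (1 / T w) powr c"
      using assms T_pos[of w] by (simp add: powr_divide)
    also have "\<dots> \<le> r powr c * (1 / T w) powr \<gamma>"
      using assms T_ge_1[of w] T_pos[of w] by (intro mult_left_mono powr_mono') (auto simp: divide_le_eq)
    finally have "(r / T w) powr c / V (T w) x\<^sub>0 \<le> r powr c * (1 / T w) powr \<gamma> / V (T w) x\<^sub>0"
      by (rule divide_right_mono) (simp add: vol_def)
    then show ?thesis by (simp add: hom_kernel_def)
  qed
  finally show ?thesis using doubling_constant_ge_1 by (simp add: mult_left_mono mult.assoc)
qed

text \<open>Trades decay for smallness: a factor \<open>u powr b\<close> with \<open>u\<close> at
  most of the size of \<open>t\<close> becomes the gain \<open>r powr b\<close>, and the decay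
  exponent drops by \<open>b\<close>.\<close>

lemma hom_kernel_power:
  assumes "0 < r" "0 < t" "0 \<le> u" "u \<le> l * t" "0 < b" "1 \<le> l"
  shows "hom_kernel r c w t * u powr b \<le> l powr b * r powr b * hom_kernel r (c - b) w t"
proof -
  have "u powr b \<le> (l * t) powr b" using assms by (intro powr_mono2) auto
  also have "\<dots> = l powr b * t powr b" using assms by (simp add: powr_mult)
  finally have "(r / t) powr c * u powr b \<le> (r / t) powr c * (l powr b * t powr b)"
    by (intro mult_left_mono) auto
  also have "\<dots> = l powr b * r powr b * (r / t) powr (c - b)"
    using assms by (simp add: powr_divide powr_diff field_simps)
  finally have "(r / t) powr c * u powr b / V t w \<le> l powr b * r powr b * (r / t) powr (c - b) / V t w"
    by (intro divide_right_mono) (auto simp: vol_def)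
  then show ?thesis by (simp add: hom_kernel_def)
qed

section \<open>Pointwise bounds for kernels times test functions and their increments\<close>

context
  fixes c :: real
  assumes c: "\<beta> < c" "\<gamma> \<le> c"
begin

text \<open>A common upper bound for the constants of the near and the far case;
  \<open>pointwise_const_ge\<close> lists the four that occur.\<close>

definition pointwise_const :: real where
  "pointwise_const = C\<^sub>\<mu> * (C\<^sub>\<mu> * (4 * A\<^sub>0\<^sup>2) powr (c + \<omega>)) * (1 + (2 * A\<^sub>0) powr \<beta>)"

lemma pointwise_const_pos: "0 < pointwise_const"
  unfolding pointwise_const_def
  using doubling_constant_ge_1 A\<^sub>0_ge_1 by (intro mult_pos_pos) (auto simp: add_pos_nonneg)

lemma pointwise_const_ge:
  "C\<^sub>\<mu> * (C\<^sub>\<mu> * (4 * A\<^sub>0\<^sup>2) powr (c + \<omega>)) \<le> pointwise_const"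
  "C\<^sub>\<mu> * (C\<^sub>\<mu> * (2 * A\<^sub>0\<^sup>2) powr (\<gamma> + \<omega>)) \<le> pointwise_const"
  "C\<^sub>\<mu> * (2 * A\<^sub>0) powr \<beta> \<le> pointwise_const"
  "C\<^sub>\<mu> \<le> pointwise_const"
proof -
  let ?X = "(4 * A\<^sub>0\<^sup>2) powr (c + \<omega>)" and ?Y = "(2 * A\<^sub>0) powr \<beta>"
  have A: "1 \<le> A\<^sub>0\<^sup>2" using one_le_power[OF A\<^sub>0_ge_1, of 2] by simp
  have X: "1 \<le> ?X" using A c \<gamma>_pos upper_dim_nonneg by (intro ge_one_powr_ge_zero) auto
  have CX: "1 \<le> C\<^sub>\<mu> * ?X" using mult_mono[OF doubling_constant_ge_1 X] doubling_constant_ge_1 by simp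
  have C: "0 \<le> C\<^sub>\<mu>" using doubling_constant_ge_1 by simp
  show 1: "C\<^sub>\<mu> * (C\<^sub>\<mu> * ?X) \<le> pointwise_const"
    unfolding pointwise_const_def using C CX by (simp add: distrib_left)
  have "(2 * A\<^sub>0\<^sup>2) powr (\<gamma> + \<omega>) \<le> ?X"
    using A c \<gamma>_pos upper_dim_nonneg by (intro powr_mono_both) auto
  then have "C\<^sub>\<mu> * (C\<^sub>\<mu> * (2 * A\<^sub>0\<^sup>2) powr (\<gamma> + \<omega>)) \<le> C\<^sub>\<mu> * (C\<^sub>\<mu> * ?X)"
    using C by (intro mult_left_mono) auto
  with 1 show "C\<^sub>\<mu> * (C\<^sub>\<mu> * (2 * A\<^sub>0\<^sup>2) powr (\<gamma> + \<omega>)) \<le> pointwise_const" by linarith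
  have "C\<^sub>\<mu> * 1 * ?Y \<le> C\<^sub>\<mu> * (C\<^sub>\<mu> * ?X) * ?Y"
    using C CX by (intro mult_right_mono mult_left_mono) auto
  also have "\<dots> \<le> pointwise_const"
    unfolding pointwise_const_def using C CX by (simp add: distrib_left)
  finally show "C\<^sub>\<mu> * ?Y \<le> pointwise_const" by simp
  have "C\<^sub>\<mu> * 1 \<le> C\<^sub>\<mu> * (C\<^sub>\<mu> * ?X)" using C CX by (intro mult_left_mono) auto
  with 1 show "C\<^sub>\<mu> \<le> pointwise_const" by linarith
qed

text \<open>Two integrable bumps: the kernel at \<open>w\<close> after giving up decay \<beta>, and
  the weight of the test function itself, which takes over far from \<open>w\<close>, where the
  kernel no longer helps.\<close>

abbreviation majorant :: "real \<Rightarrow> 'a \<Rightarrow> 'a \<Rightarrow> real" where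
  "majorant r w x \<equiv> hom_kernel r (c - \<beta>) w (r + d w x) + G x"

lemma test_bound_size:
  assumes "test_bound d A\<^sub>0 M x\<^sub>0 \<beta> \<gamma> g B"
  shows "cmod (g x) \<le> B * C\<^sub>\<mu> * G x"
proof -
  have "0 < B" "cmod (g x) \<le> B * D_weight d M x\<^sub>0 \<gamma> x"
    using assms by (auto simp: test_bound_def)
  moreover have "B * D_weight d M x\<^sub>0 \<gamma> x \<le> B * (C\<^sub>\<mu> * G x)"
    using \<open>0 < B\<close> by (intro mult_left_mono D_weight_le) auto
  ultimately show ?thesis unfolding mult.assoc using order_trans by blast
qed

lemma test_bound_diff:
  assumes "test_bound d A\<^sub>0 M x\<^sub>0 \<beta> \<gamma> g B" "2 * A\<^sub>0 * d w x \<le> T w"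
  shows "cmod (g w - g x) \<le> B * C\<^sub>\<mu> * d w x powr \<beta> * G w"
proof -
  have B: "0 < B" using assms by (auto simp: test_bound_def)
  have "d w x \<le> T w / (2 * A\<^sub>0)" using assms(2) A\<^sub>0_ge_1 by (simp add: field_simps)
  then have "cmod (g w - g x) \<le> B * (d w x / T w) powr \<beta> * D_weight d M x\<^sub>0 \<gamma> w"
    using assms(1) by (auto simp: test_bound_def)
  also have "\<dots> \<le> B * d w x powr \<beta> * (C\<^sub>\<mu> * G w)"
  proof (intro mult_mono D_weight_le)
    have "d w x * 1 \<le> d w x * T w" by (intro mult_left_mono T_ge_1) simp
    then have "d w x / T w \<le> d w x" using T_pos[of w] by (simp add: pos_divide_le_eq)
    then show "(d w x / T w) powr \<beta> \<le> d w x powr \<beta>"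
      using T_pos[of w] \<beta>_pos by (intro powr_mono2) auto
  qed (use B in \<open>auto simp: D_weight_def vol_def vol2_def\<close>)
  finally show ?thesis by (simp add: mult_ac)
qed

text \<open>The kernel supplies \<open>r powr c * G w\<close>, the test function supplies
  \<open>G x\<close>, which is integrable; \<open>r powr c \<le> r powr \<beta>\<close> because
  \<open>r \<le> 1\<close>.\<close>

lemma far_product:
  assumes "test_bound d A\<^sub>0 M x\<^sub>0 \<beta> \<gamma> g B" "0 < r" "r \<le> 1" "T w < 2 * A\<^sub>0 * d w x"
  shows "hom_kernel r c w (r + d w x) * cmod (g x) \<le> B * pointwise_const * r powr \<beta> * G w * G x"
proof -
  have B: "0 < B" using assms by (auto simp: test_bound_def)
  let ?X = "(4 * A\<^sub>0\<^sup>2) powr (c + \<omega>)"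
  have C: "0 \<le> C\<^sub>\<mu>" using doubling_constant_ge_1 by simp
  have "hom_kernel r c w (r + d w x) * cmod (g x) \<le>
     (C\<^sub>\<mu> * ?X * r powr c * G w) * (B * C\<^sub>\<mu> * G x)"
    using assms c C B by (intro mult_mono hom_kernel_far test_bound_size) auto
  also have "\<dots> \<le> (C\<^sub>\<mu> * ?X * r powr \<beta> * G w) * (B * C\<^sub>\<mu> * G x)"
    using assms c C B by (intro mult_right_mono mult_left_mono powr_mono') auto
  also have "\<dots> = C\<^sub>\<mu> * (C\<^sub>\<mu> * ?X) * (B * r powr \<beta> * G w * G x)" by (simp add: mult_ac)
  also have "\<dots> \<le> pointwise_const * (B * r powr \<beta> * G w * G x)"
    using B by (intro mult_right_mono pointwise_const_ge) auto
  finally show ?thesis by (simp add: mult_ac)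
qed

lemma pointwise_size:
  assumes "test_bound d A\<^sub>0 M x\<^sub>0 \<beta> \<gamma> g B" "0 < r" "r \<le> 1"
  shows "hom_kernel r c w (r + d w x) * cmod (g x) \<le> B * pointwise_const * G w * majorant r w x"
proof (cases "2 * A\<^sub>0 * d w x \<le> T w")
  case True
  have B: "0 < B" using assms by (auto simp: test_bound_def)
  have C: "0 \<le> C\<^sub>\<mu>" using doubling_constant_ge_1 by simp
  have t: "0 < r + d w x" using assms by (simp add: add_pos_nonneg)
  have "hom_kernel r c w (r + d w x) \<le> hom_kernel r (c - \<beta>) w (r + d w x)"
    unfolding hom_kernel_def using assms t \<beta>_pos
    by (intro divide_right_mono powr_mono') (auto simp: vol_def)
  then have h: "hom_kernel r c w (r + d w x) \<le> majorant r w x" using G_pos[of x] by linarith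
  have "cmod (g x) \<le> B * C\<^sub>\<mu> * (C\<^sub>\<mu> * (2 * A\<^sub>0\<^sup>2) powr (\<gamma> + \<omega>) * G w)"
    using test_bound_size[OF assms(1), of x] weight_near[OF True] B C
    by (smt (verit, best) mult_left_mono mult_nonneg_nonneg)
  also have "\<dots> = (C\<^sub>\<mu> * (C\<^sub>\<mu> * (2 * A\<^sub>0\<^sup>2) powr (\<gamma> + \<omega>))) * (B * G w)" by (simp add: mult_ac)
  also have "\<dots> \<le> pointwise_const * (B * G w)"
    using B by (intro mult_right_mono pointwise_const_ge) auto
  finally have "hom_kernel r c w (r + d w x) * cmod (g x) \<le> majorant r w x * (pointwise_const * (B * G w))"
    using h by (intro mult_mono) auto
  then show ?thesis by (simp add: mult_ac)
next
  case False
  have B: "0 < B" using assms by (auto simp: test_bound_def)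
  have "hom_kernel r c w (r + d w x) * cmod (g x) \<le> B * pointwise_const * r powr \<beta> * G w * G x"
    using assms False by (intro far_product) auto
  also have "\<dots> \<le> B * pointwise_const * 1 * G w * majorant r w x"
    using B pointwise_const_pos assms \<beta>_pos powr_mono2[of \<beta> r 1]
    by (intro mult_mono) auto
  finally show ?thesis by simp
qed

text \<open>Near \<open>w\<close> the regularity of \<open>g\<close> gives
  \<open>d w x powr \<beta>\<close>, which is traded for \<open>r powr \<beta>\<close>. Far from
  \<open>w\<close> both values are bounded separately; only the one at \<open>x\<close> decays by
  itself.\<close>

lemma pointwise_diff:
  assumes "test_bound d A\<^sub>0 M x\<^sub>0 \<beta> \<gamma> g B" "0 < r" "r \<le> 1"
  shows "hom_kernel r c w (r + d w x) * cmod (g x - g w) \<le>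
    B * pointwise_const * r powr \<beta> * G w * majorant r w x"
proof -
  have B: "0 < B" using assms by (auto simp: test_bound_def)
  have C: "0 \<le> C\<^sub>\<mu>" using doubling_constant_ge_1 by simp
  let ?h = "hom_kernel r c w (r + d w x)" and ?h' = "hom_kernel r (c - \<beta>) w (r + d w x)"
  have t: "0 < r + d w x" using assms by (simp add: add_pos_nonneg)
  show ?thesis
  proof (cases "2 * A\<^sub>0 * d w x \<le> T w")
    case True
    have "?h * d w x powr \<beta> \<le> 1 powr \<beta> * r powr \<beta> * ?h'"
      using assms t \<beta>_pos by (intro hom_kernel_power) auto
    then have h: "?h * d w x powr \<beta> \<le> r powr \<beta> * ?h'" by simp
    have "?h * cmod (g x - g w) \<le> ?h * (B * C\<^sub>\<mu> * d w x powr \<beta> * G w)"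
      using test_bound_diff[OF assms(1) True] by (intro mult_left_mono) (auto simp: norm_minus_commute)
    also have "\<dots> = B * C\<^sub>\<mu> * G w * (?h * d w x powr \<beta>)" by (simp add: mult_ac)
    also have "\<dots> \<le> B * pointwise_const * G w * (r powr \<beta> * ?h')"
      using B C pointwise_const_ge(4) pointwise_const_pos
      by (intro mult_mono[OF _ h] mult_right_mono mult_left_mono) auto
    also have "\<dots> \<le> B * pointwise_const * G w * (r powr \<beta> * majorant r w x)"
      using B pointwise_const_pos by (intro mult_left_mono) auto
    finally show ?thesis by (simp add: mult_ac)
  next
    case False
    have 1: "?h * cmod (g x) \<le> B * pointwise_const * r powr \<beta> * G w * G x"
      using assms False by (intro far_product) auto
    \<comment> \<open>The constant \<open>g w\<close> has no decay in \<open>x\<close>, so the gain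
      must come from the kernel: being far means \<open>1 \<le> 2 * A\<^sub>0 * (r + d w x)\<close>,
      and \<open>hom_kernel_power\<close> applies with \<open>u = 1\<close>.\<close>
    have "1 \<le> 2 * A\<^sub>0 * d w x" using False T_ge_1[of w] by linarith
    also have "\<dots> \<le> 2 * A\<^sub>0 * (r + d w x)" using A\<^sub>0_ge_1 assms by simp
    finally have "?h * 1 powr \<beta> \<le> (2 * A\<^sub>0) powr \<beta> * r powr \<beta> * ?h'"
      using assms t \<beta>_pos A\<^sub>0_ge_1 by (intro hom_kernel_power) auto
    then have h: "?h \<le> (2 * A\<^sub>0) powr \<beta> * r powr \<beta> * ?h'" by simp
    have "?h * cmod (g w) \<le> ((2 * A\<^sub>0) powr \<beta> * r powr \<beta> * ?h') * (B * C\<^sub>\<mu> * G w)"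
      using h test_bound_size[OF assms(1), of w] by (intro mult_mono) auto
    also have "\<dots> = (C\<^sub>\<mu> * (2 * A\<^sub>0) powr \<beta>) * (B * r powr \<beta> * G w * ?h')" by (simp add: mult_ac)
    also have "\<dots> \<le> pointwise_const * (B * r powr \<beta> * G w * ?h')"
      using B by (intro mult_right_mono pointwise_const_ge) auto
    finally have 2: "?h * cmod (g w) \<le> B * pointwise_const * r powr \<beta> * G w * ?h'" by (simp add: mult_ac)
    have "?h * cmod (g x - g w) \<le> ?h * (cmod (g x) + cmod (g w))"
      by (intro mult_left_mono norm_triangle_ineq4) auto
    with 1 2 show ?thesis by (simp add: distrib_left)
  qed
qed

section \<open>Integrals of kernels against test functions\<close>

definition integral_const :: real where
  "integral_const = pointwise_const * (hom_const (c - \<beta>) + hom_const \<gamma>)"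

lemma integral_const_pos: "0 < integral_const"
  unfolding integral_const_def
  using pointwise_const_pos hom_const_pos[of "c - \<beta>"] hom_const_pos[of \<gamma>] c \<gamma>_pos by simp

lemma nn_integral_majorant:
  assumes "0 < r" "0 \<le> a"
  shows "(\<integral>\<^sup>+x. ennreal (a * majorant r w x) \<partial>M)
    \<le> ennreal (a * (hom_const (c - \<beta>) + hom_const \<gamma>))"
proof -
  note [measurable] = hom_kernel_measurable[of r "c - \<beta>" w] hom_kernel_measurable[of 1 \<gamma> x\<^sub>0]
  have "(\<integral>\<^sup>+x. ennreal (a * majorant r w x) \<partial>M) =
    ennreal a * ((\<integral>\<^sup>+x. ennreal (hom_kernel r (c - \<beta>) w (r + d w x)) \<partial>M) + (\<integral>\<^sup>+x. ennreal (G x) \<partial>M))"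
    using assms by (simp add: ennreal_mult nn_integral_cmult nn_integral_add)
  also have "\<dots> \<le> ennreal a * (ennreal (hom_const (c - \<beta>)) + ennreal (hom_const \<gamma>))"
    using assms c \<gamma>_pos by (intro mult_left_mono add_mono nn_integral_hom_kernel) auto
  also have "\<dots> = ennreal (a * (hom_const (c - \<beta>) + hom_const \<gamma>))"
    using assms hom_const_pos[of "c - \<beta>"] hom_const_pos[of \<gamma>] c \<gamma>_pos
    by (simp flip: ennreal_mult ennreal_plus)
  finally show ?thesis .
qed

text \<open>For a non-integrable \<open>u\<close> the integral is 0 by convention, so the pointwise
  bound alone suffices.\<close>

lemma LINT_majorant_bound:
  fixes u :: "'a \<Rightarrow> complex"
  assumes "\<And>x. cmod (u x) \<le> a * majorant r w x" "0 < r" "0 \<le> a"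
  shows "cmod (LINT x|M. u x) \<le> a * (hom_const (c - \<beta>) + hom_const \<gamma>)"
proof -
  have nn: "0 \<le> a * (hom_const (c - \<beta>) + hom_const \<gamma>)"
    using assms hom_const_pos[of "c - \<beta>"] hom_const_pos[of \<gamma>] c \<gamma>_pos by simp
  show ?thesis
  proof (cases "integrable M u")
    case True
    have "ennreal (cmod (LINT x|M. u x)) \<le> (\<integral>\<^sup>+x. ennreal (cmod (u x)) \<partial>M)"
      by (rule integral_norm_bound_ennreal[OF True])
    also have "\<dots> \<le> (\<integral>\<^sup>+x. ennreal (a * majorant r w x) \<partial>M)"
      using assms(1) by (intro nn_integral_mono ennreal_leI) auto
    also have "\<dots> \<le> ennreal (a * (hom_const (c - \<beta>) + hom_const \<gamma>))"
      using assms by (intro nn_integral_majorant)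
    finally show ?thesis using nn by (simp add: ennreal_le_iff)
  qed (use nn in \<open>simp add: not_integrable_integral_eq\<close>)
qed

text \<open>Without cancellation there is no power of \<open>r\<close>. This serves the levels
  \<open>k \<le> N\<close>, including the kernels of level 0 averaged over a subcube.\<close>

lemma kernel_pairing:
  assumes g: "test_bound d A\<^sub>0 M x\<^sub>0 \<beta> \<gamma> g B" and r: "0 < r" "r \<le> 1" and D: "0 \<le> D"
    and K: "\<And>x. cmod (K x) \<le> D * hom_kernel r c w (r + d w x)"
  shows "cmod (LINT x|M. K x * g x) \<le> D * B * integral_const * G w"
proof -
  have B: "0 < B" using g by (auto simp: test_bound_def)
  have "cmod (LINT x|M. K x * g x) \<le>
    (D * B * pointwise_const * G w) * (hom_const (c - \<beta>) + hom_const \<gamma>)"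
  proof (rule LINT_majorant_bound)
    fix x
    have "cmod (K x * g x) \<le> D * (hom_kernel r c w (r + d w x) * cmod (g x))"
      using K[of x] by (simp add: norm_mult mult_right_mono flip: mult.assoc)
    also have "\<dots> \<le> D * (B * pointwise_const * G w * majorant r w x)"
      using D pointwise_size[OF g r] by (intro mult_left_mono)
    finally show "cmod (K x * g x) \<le> D * B * pointwise_const * G w * majorant r w x"
      by (simp add: mult_ac)
  qed (use B D r pointwise_const_pos in auto)
  then show ?thesis by (simp add: integral_const_def mult_ac)
qed

text \<open>Vanishing mean allows \<open>g x\<close> to be replaced by \<open>g x - g w\<close>, and
  \<open>pointwise_diff\<close> then yields \<open>r powr \<beta>\<close>. The size bound makes
  \<open>K\<close> integrable, as the subtraction requires.\<close>

lemma kernel_pairing_cancel: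
  assumes g: "test_bound d A\<^sub>0 M x\<^sub>0 \<beta> \<gamma> g B" and r: "0 < r" "r \<le> 1" and D: "0 \<le> D"
    and K: "\<And>x. cmod (K x) \<le> D * hom_kernel r c w (r + d w x)"
    and Km: "K \<in> borel_measurable M" and K0: "(LINT x|M. K x) = 0"
  shows "cmod (LINT x|M. K x * g x) \<le> D * B * integral_const * r powr \<beta> * G w"
proof -
  have B: "0 < B" using g by (auto simp: test_bound_def)
  have Ki: "integrable M K"
  proof (rule integrableI_bounded[OF Km])
    have "(\<integral>\<^sup>+x. ennreal (norm (K x)) \<partial>M) \<le> (\<integral>\<^sup>+x. ennreal D * ennreal (hom_kernel r c w (r + d w x)) \<partial>M)"
      using K D by (intro nn_integral_mono) (simp add: ennreal_leI flip: ennreal_mult)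
    also have "\<dots> = ennreal D * (\<integral>\<^sup>+x. ennreal (hom_kernel r c w (r + d w x)) \<partial>M)"
      using hom_kernel_measurable by (intro nn_integral_cmult) auto
    also have "\<dots> \<le> ennreal D * ennreal (hom_const c)"
      using r c \<gamma>_pos by (intro mult_left_mono nn_integral_hom_kernel) auto
    also have "\<dots> < \<infinity>" by (simp add: ennreal_mult_less_top)
    finally show "(\<integral>\<^sup>+x. ennreal (norm (K x)) \<partial>M) < \<infinity>" .
  qed
  show ?thesis
  proof (cases "integrable M (\<lambda>x. K x * g x)")
    case True
    have "(LINT x|M. K x * (g x - g w)) = (LINT x|M. K x * g x) - (LINT x|M. K x * g w)"
      using True Ki by (simp add: right_diff_distrib)
    then have eq: "(LINT x|M. K x * g x) = (LINT x|M. K x * (g x - g w))" using K0 by simp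
    have "cmod (LINT x|M. K x * (g x - g w)) \<le>
      (D * B * pointwise_const * r powr \<beta> * G w) * (hom_const (c - \<beta>) + hom_const \<gamma>)"
    proof (rule LINT_majorant_bound)
      fix x
      have "cmod (K x * (g x - g w)) \<le> D * (hom_kernel r c w (r + d w x) * cmod (g x - g w))"
        using K[of x] by (simp add: norm_mult mult_right_mono flip: mult.assoc)
      also have "\<dots> \<le> D * (B * pointwise_const * r powr \<beta> * G w * majorant r w x)"
        using D pointwise_diff[OF g r] by (intro mult_left_mono)
      finally show "cmod (K x * (g x - g w)) \<le> D * B * pointwise_const * r powr \<beta> * G w * majorant r w x"
        by (simp add: mult_ac)
    qed (use B D r pointwise_const_pos in auto)
    then show ?thesis by (simp add: eq integral_const_def mult_ac)
  next
    case False
    then show ?thesis using B D integral_const_pos by (simp add: not_integrable_integral_eq)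
  qed
qed

end

end

subsection \<open>Weighted sums and sums over cells\<close>

text \<open>A bound by \<open>A\<close> on the weighted discrete p-norm. For finite p both sides are
  raised to the power p, which keeps everything real and free of roots.\<close>

definition powsum_le :: "ennreal \<Rightarrow> 'j set \<Rightarrow> ('j \<Rightarrow> real) \<Rightarrow> ('j \<Rightarrow> real) \<Rightarrow> real \<Rightarrow> bool" where
  "powsum_le p I m b A \<longleftrightarrow>
     (if p = top then \<forall>i\<in>I. b i \<le> A
      else (\<Sum>i\<in>I. m i * b i powr enn2real p) \<le> A powr enn2real p)"

lemma powsum_le_mono:
  assumes "powsum_le p I m b A" "A \<le> A'" "0 \<le> A"
  shows "powsum_le p I m b A'"
proof -
  have "A powr enn2real p \<le> A' powr enn2real p"
    using assms by (intro powr_mono2) auto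
  with assms show ?thesis unfolding powsum_le_def by (auto split: if_splits)
qed

lemma enn2real_pos: "0 < p \<Longrightarrow> p \<noteq> top \<Longrightarrow> 0 < enn2real p"
  by (simp add: enn2real_positive_iff less_top)

definition excess :: "ennreal \<Rightarrow> real" where
  "excess p = max 0 (enn2real (1 / p) - 1)"

lemma excess_nonneg: "0 \<le> excess p"
  by (simp add: excess_def)

lemma enn2real_inverse: "p \<noteq> top \<Longrightarrow> 0 < p \<Longrightarrow> enn2real (1 / p) = 1 / enn2real p"
  by (cases p) (auto simp: divide_ennreal simp flip: ennreal_1)

text \<open>If \<open>a > A\<close>, then \<open>(a / A) powr (r - 1) \<ge> 1\<close>, and
  multiplying \<open>a\<close> by it gives the second summand.\<close>

lemma powr_le_linear:
  fixes a A r :: real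
  assumes "0 \<le> a" "0 < A" "1 \<le> r"
  shows "a \<le> A + a powr r * A powr (1 - r)"
proof (cases "a \<le> A")
  case False
  then have a: "0 < a" using assms by linarith
  have "a * 1 \<le> a * (a / A) powr (r - 1)"
    using False assms by (intro mult_left_mono ge_one_powr_ge_zero) auto
  also have "\<dots> = a powr r * A powr (1 - r)"
    using a assms by (simp add: powr_divide powr_diff field_simps)
  finally show ?thesis using assms by simp
qed (use assms in \<open>simp add: add_increasing2\<close>)

text \<open>This replaces both Hoelder's inequality (for \<open>p \<ge> 1\<close>) and the embedding of \<open>l\<^sup>p\<close> into \<open>l\<^sup>1\<close>
  (for \<open>p < 1\<close>). In the application \<open>K2\<close> carries the factor \<open>\<delta> powr (- k * \<omega> * excess p)\<close>.\<close>

lemma weighted_sum_le: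
  fixes m W b :: "'j \<Rightarrow> real"
  assumes I: "finite I" and p: "0 < p" and A: "0 \<le> A"
    and m: "\<And>i. i \<in> I \<Longrightarrow> 0 < m i" and b: "\<And>i. i \<in> I \<Longrightarrow> 0 \<le> b i"
    and W: "\<And>i. i \<in> I \<Longrightarrow> 0 \<le> W i"
    and small: "\<And>i. i \<in> I \<Longrightarrow> W i \<le> K2 * m i powr excess p"
    and total: "(\<Sum>i\<in>I. m i * W i) \<le> K1" and K: "0 \<le> K1" "0 \<le> K2"
    and ps: "powsum_le p I m b A"
  shows "(\<Sum>i\<in>I. m i * W i * b i) \<le> (K1 + K2) * A"
proof (cases "p = top")
  case True
  have "(\<Sum>i\<in>I. m i * W i * b i) \<le> (\<Sum>i\<in>I. m i * W i * A)"
    using ps True m W by (intro sum_mono mult_left_mono) (auto simp: powsum_le_def less_imp_le)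
  also have "\<dots> = (\<Sum>i\<in>I. m i * W i) * A" by (simp add: sum_distrib_right)
  also have "\<dots> \<le> (K1 + K2) * A" using total K A by (intro mult_right_mono) auto
  finally show ?thesis .
next
  case False
  define r where "r = enn2real p"
  have r: "0 < r" using enn2real_pos[OF p False] by (simp add: r_def)
  have ex: "excess p = max 0 (1 / r - 1)"
    using enn2real_inverse[OF False p] by (simp add: excess_def r_def)
  have s: "(\<Sum>i\<in>I. m i * b i powr r) \<le> A powr r"
    using ps False by (simp add: powsum_le_def r_def)
  have each: "m i * b i powr r \<le> A powr r" if "i \<in> I" for i
  proof -
    have "m i * b i powr r \<le> (\<Sum>i\<in>I. m i * b i powr r)"
      using that I m by (intro member_le_sum) (auto simp: less_imp_le)
    with s show ?thesis by linarith
  qed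
  show ?thesis
  \<comment> \<open>Separate because the argument below rests on
    \<open>A powr r * A powr (1 - r) = A\<close>, and \<open>0 powr x\<close> is 0; here all
    \<open>b i\<close> vanish.\<close>
  proof (cases "A = 0")
    case True
    have "b i = 0" if "i \<in> I" for i
    proof -
      have "m i * b i powr r \<le> 0" using each[OF that] True r by simp
      then have "b i powr r \<le> 0" using m[OF that] by (simp add: mult_le_0_iff)
      then show ?thesis by (metis powr_ge_zero order_antisym powr_eq_0_iff)
    qed
    then show ?thesis using True by simp
  next
    case nz: False
    then have A0: "0 < A" using A by simp
    \<comment> \<open>Shared by both ranges of r: for \<open>r \<ge> 1\<close> it handles the terms
      with \<open>b i > A\<close>, for \<open>r < 1\<close> the whole sum.\<close>
    have half: "(\<Sum>i\<in>I. m i * b i powr r * (K2 * A powr (1 - r))) \<le> K2 * A"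
    proof -
      have "(\<Sum>i\<in>I. m i * b i powr r * (K2 * A powr (1 - r))) =
        (\<Sum>i\<in>I. m i * b i powr r) * (K2 * A powr (1 - r))" by (simp add: sum_distrib_right)
      also have "\<dots> \<le> A powr r * (K2 * A powr (1 - r))"
        using s K by (intro mult_right_mono) auto
      also have "\<dots> = K2 * A" using A0 by (simp add: powr_diff)
      finally show ?thesis .
    qed
    show ?thesis
    proof (cases "1 \<le> r")
      case True
      then have ex0: "excess p = 0" by (simp add: ex)
      have "(\<Sum>i\<in>I. m i * W i * b i) \<le>
        (\<Sum>i\<in>I. m i * W i * A + m i * b i powr r * (K2 * A powr (1 - r)))"
      proof (rule sum_mono)
        fix i assume i: "i \<in> I"
        have "m i * W i * b i \<le> m i * W i * (A + b i powr r * A powr (1 - r))"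
          using i m[OF i] W[OF i] b[OF i] A0 True by (intro mult_left_mono powr_le_linear) auto
        also have "\<dots> = m i * W i * A + m i * b i powr r * (W i * A powr (1 - r))"
          by (simp add: algebra_simps)
        also have "\<dots> \<le> m i * W i * A + m i * b i powr r * (K2 * A powr (1 - r))"
          using small[OF i] m[OF i] ex0 by (intro add_left_mono mult_left_mono mult_right_mono) auto
        finally show "m i * W i * b i \<le> m i * W i * A + m i * b i powr r * (K2 * A powr (1 - r))" .
      qed
      also have "\<dots> = (\<Sum>i\<in>I. m i * W i) * A + (\<Sum>i\<in>I. m i * b i powr r * (K2 * A powr (1 - r)))"
        by (simp add: sum.distrib sum_distrib_right)
      also have "\<dots> \<le> K1 * A + K2 * A"
        using total A0 by (intro add_mono half mult_right_mono) auto
      finally show ?thesis by (simp add: distrib_right)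
    next
      case False
      then have ex1: "excess p = 1 / r - 1" using r by (simp add: ex)
      have "(\<Sum>i\<in>I. m i * W i * b i) \<le> (\<Sum>i\<in>I. m i * b i powr r * (K2 * A powr (1 - r)))"
      proof (rule sum_mono)
        fix i assume i: "i \<in> I"
        have mi: "0 < m i" by (rule m[OF i])
        have "(m i powr (1 / r) * b i) powr r \<le> A powr r"
          using each[OF i] mi b[OF i] r by (simp add: powr_mult powr_powr)
        then have mb: "m i powr (1 / r) * b i \<le> A"
          using A0 r powr_less_mono2[of r A "m i powr (1 / r) * b i"] by (meson less_imp_le not_less)
        \<comment> \<open>Only the part \<open>b i powr r\<close> is to be summed. The weight
          \<open>m i powr (1 / r - 1)\<close> is exactly what completes the remaining
          \<open>b i powr (1 - r)\<close> to a power of the single-term norm, which is at most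
          \<open>A\<close> by \<open>mb\<close>.\<close>
        have eq: "m i powr (1 / r - 1) * b i = b i powr r * (m i powr (1 / r) * b i) powr (1 - r)"
        proof (cases "b i = 0")
          case False
          then have bi: "0 < b i" using b[OF i] by simp
          have "(m i powr (1 / r) * b i) powr (1 - r) = m i powr (1 / r * (1 - r)) * b i powr (1 - r)"
            using mi bi by (simp add: powr_mult powr_powr)
          also have "1 / r * (1 - r) = 1 / r - 1" using r by (simp add: field_simps)
          finally have e: "(m i powr (1 / r) * b i) powr (1 - r) = m i powr (1 / r - 1) * b i powr (1 - r)" .
          have "b i powr r * b i powr (1 - r) = b i" using bi by (simp flip: powr_add)
          then show ?thesis unfolding e by (simp add: mult.left_commute)
        qed (use r in simp)
        show "m i * W i * b i \<le> m i * b i powr r * (K2 * A powr (1 - r))"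
        proof -
          have "W i * b i \<le> K2 * m i powr (1 / r - 1) * b i"
            using small[OF i] b[OF i] ex1 by (intro mult_right_mono) auto
          also have "\<dots> = K2 * (b i powr r * (m i powr (1 / r) * b i) powr (1 - r))"
            by (simp add: eq mult.assoc)
          also have "\<dots> \<le> K2 * (b i powr r * A powr (1 - r))"
            using mb b[OF i] K False by (intro mult_left_mono powr_mono2) auto
          finally have "m i * (W i * b i) \<le> m i * (K2 * (b i powr r * A powr (1 - r)))"
            using mi by (intro mult_left_mono) auto
          then show ?thesis by (simp add: mult_ac)
        qed
      qed
      also have "\<dots> \<le> K2 * A" by (rule half)
      also have "\<dots> \<le> (K1 + K2) * A" using K A by (intro mult_right_mono) auto
      finally show ?thesis .
    qed
  qed
qed

section \<open>The weight on cells of bounded diameter\<close>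

context test_setting
begin

lemma same_cell_dist:
  assumes "x \<in> qball d z R" "w \<in> qball d z R"
  shows "d w x \<le> 2 * A\<^sub>0 * R"
proof -
  have "d w x \<le> A\<^sub>0 * (d w z + d z x)" by (rule d_triangle)
  also have "\<dots> \<le> A\<^sub>0 * (R + R)"
    using assms A\<^sub>0_ge_1 by (intro mult_left_mono add_mono) (auto simp: qball_def d_commute less_imp_le)
  finally show ?thesis by simp
qed

definition cell_const :: "real \<Rightarrow> real" where
  "cell_const R = C\<^sub>\<mu> * (A\<^sub>0 * (A\<^sub>0 * (1 + 2 * A\<^sub>0 * R))) powr (\<gamma> + \<omega>)"

text \<open>A cell has bounded diameter and \<open>T\<close> is at least 1, so the additive
  displacement becomes a bounded factor in \<open>T\<close>. The size of the cell enters only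
  through \<open>R\<close>.\<close>

lemma weight_same_cell:
  assumes "x \<in> qball d z R" "w \<in> qball d z R"
  shows "G w \<le> cell_const R * G x"
proof -
  have R: "0 \<le> R" using assms(1) qball_empty[of R z] by force
  have c: "0 \<le> A\<^sub>0 * R" using A\<^sub>0_ge_1 R by simp
  have "T x \<le> 1 + A\<^sub>0 * (d x\<^sub>0 w + d w x)" using d_triangle by simp
  also have "\<dots> \<le> A\<^sub>0 * (T w + d w x)"
    using A\<^sub>0_ge_1 by (simp add: distrib_left)
  also have "\<dots> \<le> A\<^sub>0 * (T w * (1 + 2 * A\<^sub>0 * R))"
  proof (intro mult_left_mono)
    have "1 * (2 * A\<^sub>0 * R) \<le> T w * (2 * A\<^sub>0 * R)" by (intro mult_right_mono T_ge_1) (use c in simp)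
    then show "T w + d w x \<le> T w * (1 + 2 * A\<^sub>0 * R)"
      using same_cell_dist[OF assms] by (simp add: distrib_left)
  qed (use A\<^sub>0_ge_1 in simp)
  finally have "T x \<le> A\<^sub>0 * (1 + 2 * A\<^sub>0 * R) * T w" by (simp only: mult_ac)
  moreover have "1 \<le> A\<^sub>0 * (1 + 2 * A\<^sub>0 * R)"
    using mult_mono[of 1 A\<^sub>0 1 "1 + 2 * A\<^sub>0 * R"] A\<^sub>0_ge_1 c by simp
  ultimately show ?thesis unfolding cell_const_def by (intro weight_change)
qed

lemma cell_const_nonneg: "0 \<le> cell_const R"
  using doubling_constant_ge_1 by (simp add: cell_const_def)

lemma cell_finite:
  assumes "S \<subseteq> qball d z R" "S \<in> sets M" "0 < R"
  shows "emeasure M S = ennreal (measure M S)"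
proof -
  have "emeasure M S \<le> emeasure M (qball d z R)"
    using assms by (intro emeasure_mono qball_sets) auto
  then have "emeasure M S < top" using emeasure_qball[OF assms(3)] by (simp add: order_le_less_trans)
  then show ?thesis by (simp add: emeasure_eq_ennreal_measure less_top)
qed

text \<open>A Riemann sum compared with its integral: on \<open>S i\<close> the value
  \<open>G (w i)\<close> is at most \<open>cell_const R * G x\<close>, and by disjointness each
  \<open>x\<close> is counted at most once.\<close>

lemma weight_sum_le:
  assumes I: "finite I" and dis: "disjoint_family_on S I"
    and S: "\<And>i. i \<in> I \<Longrightarrow> S i \<in> sets M" "\<And>i. i \<in> I \<Longrightarrow> \<exists>z. S i \<subseteq> qball d z R"
    and R: "0 < R" and w: "\<And>i. i \<in> I \<Longrightarrow> w i \<in> S i"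
  shows "(\<Sum>i\<in>I. measure M (S i) * G (w i)) \<le> cell_const R * hom_const \<gamma>"
proof -
  have [measurable]: "S i \<in> sets M" if "i \<in> I" for i by (rule S(1)[OF that])
  note [measurable] = hom_kernel_measurable[of 1 \<gamma> x\<^sub>0]
  have "ennreal (\<Sum>i\<in>I. measure M (S i) * G (w i)) =
     (\<Sum>i\<in>I. ennreal (G (w i)) * emeasure M (S i))"
  proof -
    have "ennreal (measure M (S i) * G (w i)) = ennreal (G (w i)) * emeasure M (S i)" if i: "i \<in> I" for i
      using S(2)[OF i] cell_finite[OF _ S(1)[OF i] R] by (auto simp: mult.commute simp flip: ennreal_mult)
    then show ?thesis by (subst sum_ennreal[symmetric]) (auto intro!: sum.cong)
  qed
  also have "\<dots> = (\<Sum>i\<in>I. \<integral>\<^sup>+x. ennreal (G (w i)) * indicator (S i) x \<partial>M)"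
    by (intro sum.cong refl) (simp add: nn_integral_cmult_indicator)
  also have "\<dots> = (\<integral>\<^sup>+x. (\<Sum>i\<in>I. ennreal (G (w i)) * indicator (S i) x) \<partial>M)"
    by (rule nn_integral_sum[symmetric]) measurable
  also have "\<dots> \<le> (\<integral>\<^sup>+x. ennreal (cell_const R) * ennreal (G x) \<partial>M)"
  proof (rule nn_integral_mono)
    fix x
    show "(\<Sum>i\<in>I. ennreal (G (w i)) * indicator (S i) x) \<le> ennreal (cell_const R) * ennreal (G x)"
    proof (cases "\<exists>i\<in>I. x \<in> S i")
      case True
      then obtain i where i: "i \<in> I" "x \<in> S i" by auto
      have out: "x \<notin> S j" if "j \<in> I" "j \<noteq> i" for j
        using disjoint_family_onD[OF dis that(1) i(1) that(2)] i(2) by blast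
      have "(\<Sum>j\<in>I. ennreal (G (w j)) * indicator (S j) x) = (\<Sum>j\<in>I. if j = i then ennreal (G (w i)) else 0)"
      proof (rule sum.cong)
        fix j assume j: "j \<in> I"
        show "ennreal (G (w j)) * indicator (S j) x = (if j = i then ennreal (G (w i)) else 0)"
        proof (cases "j = i")
          case True
          then show ?thesis using i(2) by simp
        next
          case False
          then show ?thesis using out[OF j False] by simp
        qed
      qed simp
      also have "\<dots> = ennreal (G (w i))" using I i by simp
      also have "\<dots> \<le> ennreal (cell_const R * G x)"
        using S(2)[OF i(1)] w[OF i(1)] i(2) by (intro ennreal_leI) (blast intro: weight_same_cell)
      finally show ?thesis using cell_const_nonneg by (simp add: ennreal_mult)
    next
      case False
      then have "(\<Sum>i\<in>I. ennreal (G (w i)) * indicator (S i) x) = 0"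
        by (intro sum.neutral) auto
      then show ?thesis by simp
    qed
  qed
  also have "\<dots> = ennreal (cell_const R) * (\<integral>\<^sup>+x. ennreal (G x) \<partial>M)"
    by (rule nn_integral_cmult) measurable
  also have "\<dots> \<le> ennreal (cell_const R) * ennreal (hom_const \<gamma>)"
    using \<gamma>_pos by (intro mult_left_mono nn_integral_hom_kernel) auto
  also have "\<dots> = ennreal (cell_const R * hom_const \<gamma>)"
    using cell_const_nonneg hom_const_pos[OF \<gamma>_pos] by (simp flip: ennreal_mult)
  finally show ?thesis
    using cell_const_nonneg hom_const_pos[OF \<gamma>_pos] by (simp add: ennreal_le_iff)
qed

definition lower_const :: "real \<Rightarrow> real \<Rightarrow> real \<Rightarrow> real" where
  "lower_const R \<rho> \<theta> = (C\<^sub>\<mu> * (max 1 (2 * A\<^sub>0\<^sup>2 * (R + 1) / \<rho>)) powr \<omega>) powr \<theta> / V 1 x\<^sub>0 powr (1 + \<theta>)"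

lemma lower_const_nonneg: "0 \<le> lower_const R \<rho> \<theta>"
  by (simp add: lower_const_def)

text \<open>Provides the smallness hypothesis of \<open>weighted_sum_le\<close>, with
  \<open>\<theta>\<close> the excess of p. The ball of radius \<open>T w\<close> about
  \<open>x\<^sub>0\<close> lies in the inner ball of \<open>S\<close> dilated by
  \<open>L * T w / r\<close>, so its volume is at most a constant times
  \<open>(T w / r) powr \<omega> * measure M S\<close>. After raising this to the power \<theta>,
  the decay \<open>T w powr (- \<gamma>)\<close> absorbs
  \<open>T w powr (\<omega> * \<theta>)\<close>, and \<open>r powr (- (\<omega> * \<theta>))\<close>
  remains as the cost.\<close>

lemma weight_le_measure:
  assumes S: "qball d z (\<rho> * r) \<subseteq> S" "S \<subseteq> qball d z R" "S \<in> sets M" "w \<in> S"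
    and r: "0 < r" "r \<le> 1" and \<rho>: "0 < \<rho>" and R: "0 < R" and \<theta>: "0 \<le> \<theta>" "\<omega> * \<theta> \<le> \<gamma>"
  shows "G w \<le> lower_const R \<rho> \<theta> * r powr (- (\<omega> * \<theta>)) * measure M S powr \<theta>"
proof -
  \<comment> \<open>Chosen so that \<open>L * \<rho> * T w\<close> dominates
    \<open>A\<^sub>0 * (d z x\<^sub>0 + T w)\<close>, the radius about \<open>z\<close> that catches
    the large ball; \<open>max 1\<close> makes the dilation factor admissible.\<close>
  define L where "L = max 1 (2 * A\<^sub>0\<^sup>2 * (R + 1) / \<rho>)"
  define m where "m = measure M S"
  let ?v = "V (T w) x\<^sub>0"
  have L: "1 \<le> L" "2 * A\<^sub>0\<^sup>2 * (R + 1) \<le> L * \<rho>"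
    using \<rho> by (auto simp: L_def field_simps max_def)
  have Tw: "1 \<le> T w" "0 < T w" by (rule T_ge_1 T_pos)+
  have C: "0 < C\<^sub>\<mu>" using doubling_constant_ge_1 by simp
  have "r \<le> L * T w" using mult_mono[of 1 L 1 "T w"] L Tw r by simp
  then have l: "1 \<le> L * T w / r" using r by simp
  have v1: "0 < V 1 x\<^sub>0" by (rule vol_pos) simp
  have v: "V 1 x\<^sub>0 \<le> ?v" by (rule vol_mono) (use Tw in auto)
  have "d z w < R" using S by (auto simp: qball_def)
  then have "d z x\<^sub>0 \<le> A\<^sub>0 * (R + T w)"
    using d_triangle[of z x\<^sub>0 w] A\<^sub>0_ge_1 d_commute[of w x\<^sub>0]
    by (smt (verit, ccfv_SIG) mult_left_mono)
  also have "\<dots> \<le> A\<^sub>0 * ((R + 1) * T w)"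
    using A\<^sub>0_ge_1 R mult_left_mono[OF Tw(1), of R] by (intro mult_left_mono) (auto simp: distrib_right)
  finally have 1: "d z x\<^sub>0 \<le> A\<^sub>0 * ((R + 1) * T w)" .
  have "1 * T w \<le> A\<^sub>0 * ((R + 1) * T w)"
    unfolding mult.assoc[symmetric] using Tw R A\<^sub>0_ge_1 mult_mono[of 1 A\<^sub>0 1 "R + 1"]
    by (intro mult_right_mono) auto
  with 1 have "A\<^sub>0 * (d z x\<^sub>0 + T w) \<le> A\<^sub>0 * (2 * (A\<^sub>0 * ((R + 1) * T w)))"
    using A\<^sub>0_ge_1 by (intro mult_left_mono) auto
  also have "\<dots> = 2 * A\<^sub>0\<^sup>2 * (R + 1) * T w" by (simp only: power2_eq_square mult_ac)
  also have "\<dots> \<le> L * \<rho> * T w" using L Tw by (intro mult_right_mono) auto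
  also have "\<dots> = L * T w / r * (\<rho> * r)" using r by simp
  finally have "?v \<le> C\<^sub>\<mu> * (L * T w / r) powr \<omega> * V (\<rho> * r) z"
    using \<rho> r l by (intro vol_change) auto
  also have "V (\<rho> * r) z \<le> m"
  proof -
    have "emeasure M (qball d z (\<rho> * r)) \<le> emeasure M S" by (rule emeasure_mono[OF S(1,3)])
    then show ?thesis
      using cell_finite[OF S(2,3) R] \<rho> r by (simp add: m_def emeasure_qball ennreal_le_iff)
  qed
  finally have vm: "?v \<le> C\<^sub>\<mu> * (L * T w / r) powr \<omega> * m"
    using C by (simp add: mult_left_mono)
  have m0: "0 \<le> m" by (simp add: m_def)
  have "?v powr \<theta> \<le> (C\<^sub>\<mu> * (L * T w / r) powr \<omega> * m) powr \<theta>"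
    using vm v v1 \<theta> by (intro powr_mono2) auto
  also have "\<dots> = (C\<^sub>\<mu> * L powr \<omega>) powr \<theta> * T w powr (\<omega> * \<theta>) * r powr (- (\<omega> * \<theta>)) * m powr \<theta>"
  proof -
    have "(C\<^sub>\<mu> * (L * t / r) powr \<omega> * m) powr \<theta> =
      (C\<^sub>\<mu> * L powr \<omega>) powr \<theta> * t powr (\<omega> * \<theta>) * r powr (- (\<omega> * \<theta>)) * m powr \<theta>" if "0 < t" for t
      using C L that r m0 by (simp add: powr_mult powr_divide powr_powr powr_minus_divide)
    then show ?thesis using Tw by blast
  qed
  finally have 2: "?v powr \<theta> \<le> (C\<^sub>\<mu> * L powr \<omega>) powr \<theta> * T w powr (\<omega> * \<theta>) * r powr (- (\<omega> * \<theta>)) * m powr \<theta>" .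
  \<comment> \<open>Expanding by \<open>?v powr \<theta>\<close> makes it possible to bound the
    numerator through \<open>measure M S\<close> and the denominator through
    \<open>V 1 x\<^sub>0\<close>, the smallest volume that occurs.\<close>
  have "G w = T w powr (- \<gamma>) * ?v powr \<theta> / ?v powr (1 + \<theta>)"
  proof -
    have "0 < ?v" using v v1 by linarith
    moreover have "(1 / t) powr \<gamma> = t powr (- \<gamma>)" if "0 < t" for t :: real
      using that by (simp add: powr_divide powr_minus_divide)
    ultimately show ?thesis using Tw by (simp add: hom_kernel_def powr_add)
  qed
  also have "\<dots> \<le> T w powr (- \<gamma>) * ((C\<^sub>\<mu> * L powr \<omega>) powr \<theta> * T w powr (\<omega> * \<theta>) * r powr (- (\<omega> * \<theta>)) * m powr \<theta>) / V 1 x\<^sub>0 powr (1 + \<theta>)"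
    using v v1 \<theta> by (intro frac_le mult_left_mono 2 powr_mono2) (auto intro!: mult_nonneg_nonneg)
  also have "\<dots> = T w powr (\<omega> * \<theta> - \<gamma>) * (lower_const R \<rho> \<theta> * r powr (- (\<omega> * \<theta>)) * m powr \<theta>)"
    by (simp add: lower_const_def L_def powr_diff powr_minus divide_inverse)
  also have "\<dots> \<le> 1 * (lower_const R \<rho> \<theta> * r powr (- (\<omega> * \<theta>)) * m powr \<theta>)"
    using \<theta> Tw powr_mono[of "\<omega> * \<theta> - \<gamma>" 0 "T w"] lower_const_nonneg[of R \<rho> \<theta>]
    by (intro mult_right_mono) auto
  finally show ?thesis by (simp add: m_def)
qed

end

subsection \<open>Consequences of finite Besov and Triebel-Lizorkin norms\<close>

lemma epow_mono: "x \<le> y \<Longrightarrow> 0 < r \<Longrightarrow> epow x r \<le> epow y r"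
  by (auto simp: epow_def top_unique less_top intro!: ennreal_leI powr_mono2 enn2real_mono)

lemma epow_ennreal: "0 \<le> x \<Longrightarrow> epow (ennreal x) r = ennreal (x powr r)"
  by (simp add: epow_def)

lemma epow_epow: "0 < r \<Longrightarrow> epow (epow x r) (1 / r) = x"
  by (auto simp: epow_def powr_powr less_top)

lemma epow_root_leD:
  assumes "epow x (1 / r) \<le> ennreal A" "0 < r" "0 \<le> A"
  shows "x \<le> ennreal (A powr r)"
proof -
  have "epow (epow x (1 / r)) (1 / (1 / r)) = x"
    by (rule epow_epow) (use assms in simp)
  moreover have "epow (epow x (1 / r)) r \<le> epow (ennreal A) r"
    using assms by (intro epow_mono) auto
  ultimately show ?thesis using assms by (simp add: epow_ennreal)
qed

lemma finite_sum_le_infsum_ennreal: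
  fixes b :: "'k \<Rightarrow> ennreal"
  assumes "finite F" "F \<subseteq> K"
  shows "(\<Sum>k\<in>F. b k) \<le> (\<Sum>\<^sub>\<infinity>k\<in>K. b k)"
  using assms by (subst nonneg_infsum_complete) (auto intro: SUP_upper)

lemma le_seq_norm:
  assumes "k \<in> K" "0 < q"
  shows "b k \<le> seq_norm K q b"
proof (cases "q = top")
  case True
  then show ?thesis using assms by (simp add: seq_norm_def SUP_upper)
next
  case False
  define r where "r = enn2real q"
  have r: "0 < r" using enn2real_pos[OF assms(2) False] by (simp add: r_def)
  have "epow (b k) r = (\<Sum>j\<in>{k}. epow (b j) r)" by simp
  also have "\<dots> \<le> (\<Sum>\<^sub>\<infinity>j\<in>K. epow (b j) r)"
    using assms by (intro finite_sum_le_infsum_ennreal) auto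
  finally have "epow (epow (b k) r) (1 / r) \<le> epow (\<Sum>\<^sub>\<infinity>j\<in>K. epow (b j) r) (1 / r)"
    using r by (intro epow_mono) auto
  then show ?thesis using False r by (simp add: seq_norm_def r_def epow_epow)
qed

text \<open>Restricted to \<open>p < top\<close> since \<open>esssup\<close> of a non-measurable
  function is \<open>top\<close>, so a pointwise inequality need not carry over to it.\<close>

lemma Lp_norm_mono:
  assumes "\<And>x. u x \<le> v x" "0 < p" "p < top"
  shows "Lp_norm M p u \<le> Lp_norm M p v"
  using assms enn2real_pos[of p]
  by (auto simp: Lp_norm_def intro!: epow_mono nn_integral_mono)

text \<open>The step function with value \<open>b i\<close> on \<open>S i\<close> lies below
  \<open>h\<close>, and the p-th power of its norm is the weighted sum. For finite p only
  monotonicity of the integral is applied to \<open>h\<close>; for \<open>p = top\<close> a cell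
  with \<open>b i > A\<close> would have to be null.\<close>

lemma powsum_le_Lp_norm:
  assumes I: "finite I" and p: "0 < p" and A: "0 \<le> A"
    and Lp: "Lp_norm M p (\<lambda>x. ennreal (h x)) \<le> ennreal A"
    and dis: "disjoint_family_on S I"
    and S: "\<And>i. i \<in> I \<Longrightarrow> S i \<in> sets M" "\<And>i. i \<in> I \<Longrightarrow> emeasure M (S i) = ennreal (m i)"
      "\<And>i. i \<in> I \<Longrightarrow> 0 < m i"
    and b: "\<And>i. i \<in> I \<Longrightarrow> 0 \<le> b i" "\<And>i x. i \<in> I \<Longrightarrow> x \<in> S i \<Longrightarrow> b i \<le> h x"
  shows "powsum_le p I m b A"
proof (cases "p = top")
  case True
  then have ess: "esssup M (\<lambda>x. ennreal (h x)) \<le> ennreal A" using Lp by (simp add: Lp_norm_def)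
  have ae: "AE x in M. ennreal (h x) \<le> ennreal A"
    using esssup_AE[of "\<lambda>x. ennreal (h x)" M] by (rule AE_mp) (use ess in \<open>auto intro: order_trans\<close>)
  have "b i \<le> A" if i: "i \<in> I" for i
  proof (rule ccontr)
    assume "\<not> b i \<le> A"
    then have "x \<notin> S i" if "ennreal (h x) \<le> ennreal A" for x
      using b(2)[OF i, of x] that A by (auto simp: ennreal_le_iff)
    with ae have "AE x in M. x \<notin> S i" by (auto elim: eventually_mono)
    then have "emeasure M (S i) = 0"
      using S(1)[OF i] sets.sets_into_space[OF S(1)[OF i]] by (subst (asm) AE_iff_measurable[of "S i"]) auto
    with S(2,3)[OF i] show False by simp
  qed
  then show ?thesis using True by (simp add: powsum_le_def)
next
  case False
  define r where "r = enn2real p"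
  have r: "0 < r" using enn2real_pos[OF p False] by (simp add: r_def)
  have [measurable]: "S i \<in> sets M" if "i \<in> I" for i by (rule S(1)[OF that])
  have m0: "0 \<le> m i" if "i \<in> I" for i using S(3)[OF that] by simp
  have "ennreal (\<Sum>i\<in>I. m i * b i powr r) = (\<Sum>i\<in>I. ennreal (b i powr r) * emeasure M (S i))"
    using m0 S(2) by (subst sum_ennreal[symmetric]) (auto intro!: sum.cong simp: ennreal_mult mult.commute)
  also have "\<dots> = (\<Sum>i\<in>I. \<integral>\<^sup>+x. ennreal (b i powr r) * indicator (S i) x \<partial>M)"
    by (intro sum.cong refl) (simp add: nn_integral_cmult_indicator)
  also have "\<dots> = (\<integral>\<^sup>+x. (\<Sum>i\<in>I. ennreal (b i powr r) * indicator (S i) x) \<partial>M)"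
    by (rule nn_integral_sum[symmetric]) measurable
  also have "\<dots> \<le> (\<integral>\<^sup>+x. epow (ennreal (h x)) r \<partial>M)"
  proof (rule nn_integral_mono)
    fix x
    show "(\<Sum>i\<in>I. ennreal (b i powr r) * indicator (S i) x) \<le> epow (ennreal (h x)) r"
    proof (cases "\<exists>i\<in>I. x \<in> S i")
      case True
      then obtain i where i: "i \<in> I" "x \<in> S i" by auto
      have out: "x \<notin> S j" if "j \<in> I" "j \<noteq> i" for j
        using disjoint_family_onD[OF dis that(1) i(1) that(2)] i(2) by blast
      have "(\<Sum>j\<in>I. ennreal (b j powr r) * indicator (S j) x) = (\<Sum>j\<in>I. if j = i then ennreal (b i powr r) else 0)"
      proof (rule sum.cong)
        fix j assume j: "j \<in> I"
        show "ennreal (b j powr r) * indicator (S j) x = (if j = i then ennreal (b i powr r) else 0)"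
        proof (cases "j = i")
          case True
          then show ?thesis using i(2) by simp
        next
          case False
          then show ?thesis using out[OF j False] by simp
        qed
      qed simp
      also have "\<dots> = ennreal (b i powr r)" using I i by simp
      also have "\<dots> \<le> ennreal (h x powr r)"
        using b(1)[OF i(1)] b(2)[OF i] r by (intro ennreal_leI powr_mono2) auto
      also have "\<dots> = epow (ennreal (h x)) r"
        using b(1)[OF i(1)] b(2)[OF i] by (simp add: epow_ennreal)
      finally show ?thesis .
    next
      case False
      then have "(\<Sum>i\<in>I. ennreal (b i powr r) * indicator (S i) x) = 0"
        by (intro sum.neutral) auto
      then show ?thesis by simp
    qed
  qed
  also have "\<dots> \<le> ennreal (A powr r)"
    using Lp False A r by (intro epow_root_leD) (simp_all add: Lp_norm_def r_def)
  finally have "(\<Sum>i\<in>I. m i * b i powr r) \<le> A powr r" by (simp add: ennreal_le_iff)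
  then show ?thesis using False by (simp add: powsum_le_def r_def)
qed

lemma powsum_le_scale:
  assumes "powsum_le p I m (\<lambda>i. c * b i) A" "0 < c" "0 \<le> A" "0 < p" "\<And>i. i \<in> I \<Longrightarrow> 0 \<le> b i"
  shows "powsum_le p I m b (A / c)"
proof (cases "p = top")
  case True
  then show ?thesis using assms by (auto simp: powsum_le_def field_simps)
next
  case False
  define r where "r = enn2real p"
  have "(\<Sum>i\<in>I. m i * b i powr r) * c powr r = (\<Sum>i\<in>I. m i * (c * b i) powr r)"
    using assms by (subst sum_distrib_right) (auto intro!: sum.cong simp: powr_mult)
  also have "\<dots> \<le> A powr r" using assms False by (simp add: powsum_le_def r_def)
  finally show ?thesis
    using False assms by (simp add: powsum_le_def r_def powr_divide field_simps)
qed

lemma powsum_le_Sigma_p: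
  assumes Sg: "Sigma_p M \<A> n sub Q N p f \<le> ennreal A" and p: "0 < p" and A: "0 \<le> A"
    and k: "k \<le> N" and F: "finite F" "F \<subseteq> \<A> (int k)"
    and fin: "\<And>\<alpha> m. \<alpha> \<in> F \<Longrightarrow> m \<in> {1..n (int k) \<alpha>} \<Longrightarrow>
      emeasure M (sub (int k) \<alpha> m) = ennreal (measure M (sub (int k) \<alpha> m))"
  shows "powsum_le p (Sigma F (\<lambda>\<alpha>. {1..n (int k) \<alpha>})) (\<lambda>(\<alpha>, m). measure M (sub (int k) \<alpha> m))
    (\<lambda>(\<alpha>, m). mean M (sub (int k) \<alpha> m) (\<lambda>x. cmod (apply_kernel (Q k) f x))) A"
proof -
  let ?b = "\<lambda>\<alpha> m. mean M (sub (int k) \<alpha> m) (\<lambda>x. cmod (apply_kernel (Q k) f x))"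
  have b0: "0 \<le> ?b \<alpha> m" for \<alpha> m
    by (auto simp: mean_def set_lebesgue_integral_def intro!: mult_nonneg_nonneg integral_nonneg_AE)
  show ?thesis
  proof (cases "p = top")
    case True
    have "?b \<alpha> m \<le> A" if "\<alpha> \<in> F" "m \<in> {1..n (int k) \<alpha>}" for \<alpha> m
    proof -
      have "ennreal (?b \<alpha> m) \<le> (SUP m\<in>{1..n (int k) \<alpha>}. ennreal (?b \<alpha> m))"
        using that by (intro SUP_upper)
      also have "\<dots> \<le> (SUP \<alpha>\<in>\<A> (int k). SUP m\<in>{1..n (int k) \<alpha>}. ennreal (?b \<alpha> m))"
        using that F by (intro SUP_upper) auto
      also have "\<dots> \<le> Sigma_p M \<A> n sub Q N p f"
        using k True unfolding Sigma_p_def by (simp only: if_True simp_thms) (rule SUP_upper, simp)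
      finally show ?thesis using Sg A by (meson order_trans ennreal_le_iff)
    qed
    then show ?thesis using True by (auto simp: powsum_le_def)
  next
    case False
    define r where "r = enn2real p"
    have r: "0 < r" using enn2real_pos[OF p False] by (simp add: r_def)
    let ?t = "\<lambda>k \<alpha>. \<Sum>m=1..n (int k) \<alpha>. emeasure M (sub (int k) \<alpha> m) *
           epow (ennreal (mean M (sub (int k) \<alpha> m) (\<lambda>x. cmod (apply_kernel (Q k) f x)))) r"
    have "ennreal (\<Sum>(\<alpha>, m)\<in>Sigma F (\<lambda>\<alpha>. {1..n (int k) \<alpha>}). measure M (sub (int k) \<alpha> m) * ?b \<alpha> m powr r)
      = (\<Sum>\<alpha>\<in>F. \<Sum>m=1..n (int k) \<alpha>. ennreal (measure M (sub (int k) \<alpha> m) * ?b \<alpha> m powr r))"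
      using F by (subst sum.Sigma[symmetric]) (auto simp: sum_ennreal sum_nonneg)
    also have "\<dots> = (\<Sum>\<alpha>\<in>F. ?t k \<alpha>)"
      using fin b0 by (intro sum.cong refl) (simp add: ennreal_mult epow_ennreal)
    also have "\<dots> \<le> (\<Sum>\<^sub>\<infinity>\<alpha>\<in>\<A> (int k). ?t k \<alpha>)"
      using F by (intro finite_sum_le_infsum_ennreal) auto
    also have "\<dots> \<le> (\<Sum>k=0..N. \<Sum>\<^sub>\<infinity>\<alpha>\<in>\<A> (int k). ?t k \<alpha>)"
      using k by (intro member_le_sum) auto
    also have "\<dots> \<le> ennreal (A powr r)"
      using Sg False A r by (intro epow_root_leD) (simp_all add: Sigma_p_def r_def)
    finally have "(\<Sum>(\<alpha>, m)\<in>Sigma F (\<lambda>\<alpha>. {1..n (int k) \<alpha>}). measure M (sub (int k) \<alpha> m) * ?b \<alpha> m powr r) \<le> A powr r"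
      by (simp add: ennreal_le_iff)
    then show ?thesis using False by (simp add: powsum_le_def r_def case_prod_unfold)
  qed
qed

text \<open>The common lower bound of the two function-space norms through which the theorem is proved:
  \<open>\<Sigma>\<^sub>p(f) \<le> X\<close> and \<open>\<parallel>Q\<^sub>k f\<parallel>\<^sub>p \<le> \<delta> powr (k * s) * X\<close> for \<open>k > N\<close>, where the \<open>L\<^sup>p\<close> norms are only tested on step
  functions below \<open>|Q\<^sub>k f|\<close>. This makes the measurability of \<open>Q\<^sub>k f\<close> irrelevant.\<close>

definition level_bounds ::
    "'a measure \<Rightarrow> real \<Rightarrow> (int \<Rightarrow> 'i set) \<Rightarrow> (int \<Rightarrow> 'i \<Rightarrow> nat) \<Rightarrow> (int \<Rightarrow> 'i \<Rightarrow> nat \<Rightarrow> 'a set) \<Rightarrow>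
     (nat \<Rightarrow> 'a \<Rightarrow> 'a \<Rightarrow> complex) \<Rightarrow> nat \<Rightarrow> real \<Rightarrow> ennreal \<Rightarrow>
     (('a \<Rightarrow> complex) \<Rightarrow> complex) \<Rightarrow> real \<Rightarrow> bool" where
  "level_bounds M \<delta> \<A> n sub Q N s p f X \<longleftrightarrow> 0 \<le> X \<and>
     (\<forall>k F. finite F \<and> F \<subseteq> \<A> (int k) \<longrightarrow>
       (k \<le> N \<longrightarrow> powsum_le p (Sigma F (\<lambda>\<alpha>. {1..n (int k) \<alpha>}))
          (\<lambda>(\<alpha>, m). measure M (sub (int k) \<alpha> m))
          (\<lambda>(\<alpha>, m). mean M (sub (int k) \<alpha> m) (\<lambda>x. cmod (apply_kernel (Q k) f x))) X) \<and>
       (N < k \<longrightarrow> (\<forall>b. (\<forall>\<alpha>\<in>F. \<forall>m\<in>{1..n (int k) \<alpha>}. 0 \<le> b (\<alpha>, m) \<and>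
            (\<forall>x\<in>sub (int k) \<alpha> m. b (\<alpha>, m) \<le> cmod (apply_kernel (Q k) f x))) \<longrightarrow>
          powsum_le p (Sigma F (\<lambda>\<alpha>. {1..n (int k) \<alpha>}))
            (\<lambda>(\<alpha>, m). measure M (sub (int k) \<alpha> m)) b (\<delta> powr (real k * s) * X))))"

text \<open>A single level is dominated by the whole sequence norm: outside the
  \<open>L\<^sup>p\<close> norm for Besov spaces, pointwise inside it for Triebel-Lizorkin
  spaces.\<close>

lemma
  assumes fin: "\<And>k \<alpha> m. \<alpha> \<in> \<A> (int k) \<Longrightarrow> m \<in> {1..n (int k) \<alpha>} \<Longrightarrow>
      sub (int k) \<alpha> m \<in> sets M \<and> emeasure M (sub (int k) \<alpha> m) = ennreal (measure M (sub (int k) \<alpha> m))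
        \<and> 0 < measure M (sub (int k) \<alpha> m)"
    and dis: "\<And>k. disjoint_family_on (\<lambda>(\<alpha>, m). sub (int k) \<alpha> m) (Sigma (\<A> (int k)) (\<lambda>\<alpha>. {1..n (int k) \<alpha>}))"
    and p: "0 < p" and q: "0 < q" and \<delta>: "0 < \<delta>"
  shows level_bounds_besov: "besov_norm M \<delta> \<A> n sub Q N s p q f < top \<Longrightarrow>
      level_bounds M \<delta> \<A> n sub Q N s p f (enn2real (besov_norm M \<delta> \<A> n sub Q N s p q f))"
    and level_bounds_triebel_lizorkin: "p < top \<Longrightarrow> triebel_lizorkin_norm M \<delta> \<A> n sub Q N s p q f < top \<Longrightarrow>
      level_bounds M \<delta> \<A> n sub Q N s p f (enn2real (triebel_lizorkin_norm M \<delta> \<A> n sub Q N s p q f))"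
proof -
  have cells: "finite (Sigma F (\<lambda>\<alpha>. {1..n (int k) \<alpha>}))"
    "disjoint_family_on (\<lambda>(\<alpha>, m). sub (int k) \<alpha> m) (Sigma F (\<lambda>\<alpha>. {1..n (int k) \<alpha>}))"
    if "finite F" "F \<subseteq> \<A> (int k)" for F k
  proof -
    show "finite (Sigma F (\<lambda>\<alpha>. {1..n (int k) \<alpha>}))" using that by simp
    show "disjoint_family_on (\<lambda>(\<alpha>, m). sub (int k) \<alpha> m) (Sigma F (\<lambda>\<alpha>. {1..n (int k) \<alpha>}))"
      using that(2) by (intro disjoint_family_on_mono[OF _ dis[of k]] Sigma_mono) auto
  qed
  have conv: "ennreal (\<delta> powr (- (real k * s))) * ennreal u = ennreal (\<delta> powr (- (real k * s)) * u)" for k u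
    by (cases "0 \<le> u") (auto simp: ennreal_mult ennreal_neg mult_nonneg_nonpos)
  \<comment> \<open>The two alternatives in \<open>high\<close> are the forms delivered by the two
    norms. They are kept apart because pulling the scalar out of the integral is a matter of
    measurability; in the first form it is removed after the passage to step functions.\<close>
  have "level_bounds M \<delta> \<A> n sub Q N s p f X"
    if X: "0 \<le> X" "Sigma_p M \<A> n sub Q N p f \<le> ennreal X"
      and high: "\<And>k. N < k \<Longrightarrow>
        Lp_norm M p (\<lambda>x. ennreal (\<delta> powr (- (real k * s)) * cmod (apply_kernel (Q k) f x))) \<le> ennreal X \<or>
        ennreal (\<delta> powr (- (real k * s))) * Lp_norm M p (\<lambda>x. ennreal (cmod (apply_kernel (Q k) f x))) \<le> ennreal X"
    for X
    unfolding level_bounds_def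
  proof (intro conjI allI impI X(1))
    fix k F assume "finite F \<and> F \<subseteq> \<A> (int k)" "k \<le> N"
    then show "powsum_le p (Sigma F (\<lambda>\<alpha>. {1..n (int k) \<alpha>}))
          (\<lambda>(\<alpha>, m). measure M (sub (int k) \<alpha> m))
          (\<lambda>(\<alpha>, m). mean M (sub (int k) \<alpha> m) (\<lambda>x. cmod (apply_kernel (Q k) f x))) X"
      using fin p X by (intro powsum_le_Sigma_p) auto
  next
    fix k F b
    assume F: "finite F \<and> F \<subseteq> \<A> (int k)" and k: "N < k"
      and b: "\<forall>\<alpha>\<in>F. \<forall>m\<in>{1..n (int k) \<alpha>}. 0 \<le> b (\<alpha>, m) \<and>
            (\<forall>x\<in>sub (int k) \<alpha> m. b (\<alpha>, m) \<le> cmod (apply_kernel (Q k) f x))"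
    let ?I = "Sigma F (\<lambda>\<alpha>. {1..n (int k) \<alpha>})" and ?m = "\<lambda>(\<alpha>, m). measure M (sub (int k) \<alpha> m)"
    let ?c = "\<delta> powr (- (real k * s))"
    have c: "0 < ?c" "X / ?c = \<delta> powr (real k * s) * X" using \<delta> by (auto simp: powr_minus field_simps)
    from high[OF k] have "powsum_le p ?I ?m b (X / ?c)"
    proof
      assume "Lp_norm M p (\<lambda>x. ennreal (?c * cmod (apply_kernel (Q k) f x))) \<le> ennreal X"
      then have "powsum_le p ?I ?m (\<lambda>i. ?c * b i) X"
        using F b fin c p X by (intro powsum_le_Lp_norm[where S = "\<lambda>(\<alpha>, m). sub (int k) \<alpha> m"] cells) auto
      then show ?thesis using c X p b by (intro powsum_le_scale) auto
    next
      assume le: "ennreal ?c * Lp_norm M p (\<lambda>x. ennreal (cmod (apply_kernel (Q k) f x))) \<le> ennreal X"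
      have "Lp_norm M p (\<lambda>x. ennreal (cmod (apply_kernel (Q k) f x))) \<le> ennreal (X / ?c)"
      proof (cases "Lp_norm M p (\<lambda>x. ennreal (cmod (apply_kernel (Q k) f x)))")
        case (real y)
        then show ?thesis using le c(1) X by (simp add: ennreal_le_iff field_simps flip: ennreal_mult)
      next
        case top
        then show ?thesis using le c(1) by (simp add: ennreal_mult_top top_unique)
      qed
      then show ?thesis
        using F b fin c p X by (intro powsum_le_Lp_norm[where S = "\<lambda>(\<alpha>, m). sub (int k) \<alpha> m"] cells) auto
    qed
    then show "powsum_le p ?I ?m b (\<delta> powr (real k * s) * X)" by (simp only: c(2))
  qed
  note main = this
  {
    assume fin: "besov_norm M \<delta> \<A> n sub Q N s p q f < top"
    have le: "besov_norm M \<delta> \<A> n sub Q N s p q f = ennreal (enn2real (besov_norm M \<delta> \<A> n sub Q N s p q f))"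
      using fin by simp
    show "level_bounds M \<delta> \<A> n sub Q N s p f (enn2real (besov_norm M \<delta> \<A> n sub Q N s p q f))"
    proof (rule main, goal_cases)
      case 2
      show ?case unfolding le[symmetric] by (simp add: besov_norm_def)
    next
      case (3 k)
      have "ennreal (\<delta> powr (- (real k * s))) * Lp_norm M p (\<lambda>x. ennreal (cmod (apply_kernel (Q k) f x)))
        \<le> seq_norm {N+1..} q (\<lambda>k. ennreal (\<delta> powr (- (real k * s))) *
            Lp_norm M p (\<lambda>x. ennreal (cmod (apply_kernel (Q k) f x))))"
        using 3 q by (intro le_seq_norm) auto
      also have "\<dots> \<le> besov_norm M \<delta> \<A> n sub Q N s p q f" by (simp add: besov_norm_def)
      finally show ?case unfolding le[symmetric] by blast
    qed simp
  next
    assume pt: "p < top" and fin: "triebel_lizorkin_norm M \<delta> \<A> n sub Q N s p q f < top"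
    have le: "triebel_lizorkin_norm M \<delta> \<A> n sub Q N s p q f =
        ennreal (enn2real (triebel_lizorkin_norm M \<delta> \<A> n sub Q N s p q f))"
      using fin by simp
    show "level_bounds M \<delta> \<A> n sub Q N s p f (enn2real (triebel_lizorkin_norm M \<delta> \<A> n sub Q N s p q f))"
    proof (rule main, goal_cases)
      case 2
      show ?case unfolding le[symmetric] by (simp add: triebel_lizorkin_norm_def)
    next
      case (3 k)
      have "Lp_norm M p (\<lambda>x. ennreal (\<delta> powr (- (real k * s))) * ennreal (cmod (apply_kernel (Q k) f x)))
        \<le> Lp_norm M p (\<lambda>x. seq_norm {N+1..} q (\<lambda>k. ennreal (\<delta> powr (- (real k * s))) *
            ennreal (cmod (apply_kernel (Q k) f x))))"
      proof (rule Lp_norm_mono[OF _ p pt])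
        fix x
        show "ennreal (\<delta> powr (- (real k * s))) * ennreal (cmod (apply_kernel (Q k) f x)) \<le>
          seq_norm {N+1..} q (\<lambda>k. ennreal (\<delta> powr (- (real k * s))) * ennreal (cmod (apply_kernel (Q k) f x)))"
          using 3 q by (intro le_seq_norm[of k "{N+1..}" q "\<lambda>k. ennreal (\<delta> powr (- (real k * s))) * ennreal (cmod (apply_kernel (Q k) f x))"]) auto
      qed
      also have "\<dots> \<le> triebel_lizorkin_norm M \<delta> \<A> n sub Q N s p q f" by (simp add: triebel_lizorkin_norm_def)
      finally show ?case unfolding le[symmetric] conv by blast
    qed simp
  }
qed

subsection \<open>The reproducing formula tested on a test function\<close>

lemma norm_has_sum_le:
  fixes f :: "'b \<Rightarrow> 'c::real_normed_vector"
  assumes "(f has_sum s) A" "\<And>F. finite F \<Longrightarrow> F \<subseteq> A \<Longrightarrow> norm (sum f F) \<le> B"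
  shows "norm s \<le> B"
proof (rule tendsto_upperbound)
  show "((\<lambda>F. norm (sum f F)) \<longlongrightarrow> norm s) (finite_subsets_at_top A)"
    using assms(1) unfolding has_sum_def by (rule tendsto_norm)
  show "\<forall>\<^sub>F F in finite_subsets_at_top A. norm (sum f F) \<le> B"
    by (rule eventually_finite_subsets_at_top_weakI) (use assms(2) in auto)
qed simp

lemma norm_mean_le: "cmod (mean M S h) \<le> mean M S (\<lambda>x. cmod (h x))"
proof -
  have "cmod (LINT x:S|M. h x) \<le> (LINT x:S|M. cmod (h x))"
  proof (cases "set_integrable M S h")
    case True
    then show ?thesis by (rule set_integral_norm_bound)
  next
    case False
    then show ?thesis
      by (auto simp: set_lebesgue_integral_def set_integrable_def not_integrable_integral_eq
          intro!: integral_nonneg_AE)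
  qed
  then show ?thesis by (simp add: mean_def mult_left_mono divide_right_mono)
qed

lemma mean_nonneg: "(\<And>x. 0 \<le> h x) \<Longrightarrow> 0 \<le> mean M S (h :: _ \<Rightarrow> real)"
  by (auto simp: mean_def set_lebesgue_integral_def intro!: mult_nonneg_nonneg integral_nonneg_AE)

lemma norm_set_integral_le:
  fixes u :: "'a \<Rightarrow> complex"
  assumes "S \<in> sets M" "emeasure M S = ennreal m" "0 \<le> m" "0 \<le> b" "\<And>y. y \<in> S \<Longrightarrow> cmod (u y) \<le> b"
  shows "cmod (LINT y:S|M. u y) \<le> m * b"
proof (cases "set_integrable M S u")
  case True
  then have "ennreal (cmod (LINT y:S|M. u y)) \<le> (\<integral>\<^sup>+y. ennreal (cmod (indicator S y *\<^sub>R u y)) \<partial>M)"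
    unfolding set_lebesgue_integral_def set_integrable_def by (rule integral_norm_bound_ennreal)
  also have "\<dots> \<le> (\<integral>\<^sup>+y. ennreal b * indicator S y \<partial>M)"
    using assms(5) by (intro nn_integral_mono) (auto split: split_indicator intro: ennreal_leI)
  also have "\<dots> = ennreal b * ennreal m"
    using assms(1,2) by (simp add: nn_integral_cmult_indicator)
  also have "\<dots> = ennreal (m * b)" using assms by (simp add: ennreal_mult mult.commute)
  finally show ?thesis using assms by (simp add: ennreal_le_iff)
next
  case False
  then show ?thesis
    using assms by (simp add: set_lebesgue_integral_def set_integrable_def not_integrable_integral_eq)
qed

section \<open>Subcubes as cells, and weighted sums over one level\<close>

locale dyadic_setting = test_setting d A\<^sub>0 M C\<^sub>\<mu> x\<^sub>0 \<beta> \<gamma>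
  for d :: "'a \<Rightarrow> 'a \<Rightarrow> real" and A\<^sub>0 :: real and M :: "'a measure" and C\<^sub>\<mu> :: real
    and x\<^sub>0 :: 'a and \<beta> \<gamma> :: real +
  fixes c\<^sub>0 C\<^sub>0 \<delta> :: real and \<A> :: "int \<Rightarrow> 'i set" and z :: "int \<Rightarrow> 'i \<Rightarrow> 'a"
    and cube :: "int \<Rightarrow> 'i \<Rightarrow> 'a set" and j\<^sub>0 :: nat and n :: "int \<Rightarrow> 'i \<Rightarrow> nat"
    and sub :: "int \<Rightarrow> 'i \<Rightarrow> nat \<Rightarrow> 'a set"
  assumes dyadic: "dyadic_system d A\<^sub>0 M c\<^sub>0 C\<^sub>0 \<delta> \<A> z cube"
    and subcubes: "subcube_enumeration A\<^sub>0 C\<^sub>0 \<delta> \<A> cube j\<^sub>0 n sub"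
begin

lemma \<delta>_pos: "0 < \<delta>" and \<delta>_less_1: "\<delta> < 1" and c\<^sub>0_pos: "0 < c\<^sub>0" and C\<^sub>0_pos: "0 < C\<^sub>0"
  using dyadic by (auto simp: dyadic_system_def)

lemma \<delta>_power: "0 < \<delta> ^ k" "\<delta> ^ k \<le> 1"
  using \<delta>_pos \<delta>_less_1 by (auto simp: power_le_one)

text \<open>The inner radius is measured in units of \<open>\<delta> ^ k\<close> and carries
  \<open>\<delta> ^ j\<^sub>0\<close> since subcubes live \<open>j\<^sub>0\<close> levels deeper.
  The outer radius is a single bound for all levels \<open>k \<ge> 0\<close>, where
  \<open>\<delta> ^ k \<le> 1\<close>.\<close>

definition inner_const :: real where "inner_const = c\<^sub>0 * \<delta> ^ j\<^sub>0 / (3 * A\<^sub>0\<^sup>2)"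
definition outer_const :: real where "outer_const = 2 * A\<^sub>0 * C\<^sub>0"

lemma inner_const_pos: "0 < inner_const" and outer_const_pos: "0 < outer_const"
  using c\<^sub>0_pos C\<^sub>0_pos \<delta>_pos A\<^sub>0_ge_1 by (auto simp: inner_const_def outer_const_def)

lemma powi_level: "\<delta> powi (int k + int j\<^sub>0) = \<delta> ^ j\<^sub>0 * \<delta> ^ k"
  by (metis mult.commute of_nat_add power_add power_int_of_nat)

lemma subcube:
  assumes "\<alpha> \<in> \<A> (int k)" "m \<in> {1..n (int k) \<alpha>}"
  obtains \<tau> where "\<tau> \<in> \<A> (int k + int j\<^sub>0)" "sub (int k) \<alpha> m = cube (int k + int j\<^sub>0) \<tau>"
    "sub (int k) \<alpha> m \<subseteq> cube (int k) \<alpha>"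
proof -
  have "bij_betw (sub (int k) \<alpha>) {1..n (int k) \<alpha>}
        {S. S \<subseteq> cube (int k) \<alpha> \<and> (\<exists>\<tau>\<in>\<A> (int k + int j\<^sub>0). S = cube (int k + int j\<^sub>0) \<tau>)}"
    using subcubes assms unfolding subcube_enumeration_def by blast
  from bij_betwE[OF this] assms(2) that show ?thesis by blast
qed

lemma subcube_balls:
  assumes "\<alpha> \<in> \<A> (int k)" "m \<in> {1..n (int k) \<alpha>}"
  shows "sub (int k) \<alpha> m \<in> sets M"
    and "\<exists>u. qball d u (inner_const * \<delta> ^ k) \<subseteq> sub (int k) \<alpha> m \<and> sub (int k) \<alpha> m \<subseteq> qball d u outer_const"
proof -
  obtain \<tau> where t: "\<tau> \<in> \<A> (int k + int j\<^sub>0)" "sub (int k) \<alpha> m = cube (int k + int j\<^sub>0) \<tau>"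
    using subcube[OF assms] by metis
  let ?l = "int k + int j\<^sub>0"
  have meas: "\<forall>k. \<forall>\<alpha>\<in>\<A> k. cube k \<alpha> \<in> sets M"
    using dyadic unfolding dyadic_system_def by (elim conjE)
  have balls: "\<forall>k. \<forall>\<alpha>\<in>\<A> k.
        qball d (z k \<alpha>) (c\<^sub>0 * \<delta> powi k / (3 * A\<^sub>0\<^sup>2)) \<subseteq> cube k \<alpha> \<and>
        cube k \<alpha> \<subseteq> qball d (z k \<alpha>) (2 * A\<^sub>0 * C\<^sub>0 * \<delta> powi k)"
    using dyadic unfolding dyadic_system_def by (elim conjE)
  show "sub (int k) \<alpha> m \<in> sets M" using meas t by simp
  have "\<delta> powi ?l \<le> 1"
    using mult_mono[OF \<delta>_power(2)[of j\<^sub>0] \<delta>_power(2)[of k]] \<delta>_power(1)[of k] by (simp add: powi_level)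
  then have "2 * A\<^sub>0 * C\<^sub>0 * \<delta> powi ?l \<le> outer_const"
    using A\<^sub>0_ge_1 C\<^sub>0_pos by (simp add: outer_const_def mult_le_cancel_left1 mult_left_le)
  then have "qball d (z ?l \<tau>) (2 * A\<^sub>0 * C\<^sub>0 * \<delta> powi ?l) \<subseteq> qball d (z ?l \<tau>) outer_const"
    by (auto simp: qball_def)
  moreover have "c\<^sub>0 * \<delta> powi ?l / (3 * A\<^sub>0\<^sup>2) = inner_const * \<delta> ^ k"
    by (simp add: powi_level inner_const_def)
  ultimately show "\<exists>u. qball d u (inner_const * \<delta> ^ k) \<subseteq> sub (int k) \<alpha> m \<and> sub (int k) \<alpha> m \<subseteq> qball d u outer_const"
    using balls t by (intro exI[of _ "z ?l \<tau>"]) (metis order_trans)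
qed

lemma subcube_measure:
  assumes "\<alpha> \<in> \<A> (int k)" "m \<in> {1..n (int k) \<alpha>}"
  shows "emeasure M (sub (int k) \<alpha> m) = ennreal (measure M (sub (int k) \<alpha> m))"
    and "0 < measure M (sub (int k) \<alpha> m)"
    and "sub (int k) \<alpha> m \<noteq> {}"
proof -
  obtain u where u: "qball d u (inner_const * \<delta> ^ k) \<subseteq> sub (int k) \<alpha> m" "sub (int k) \<alpha> m \<subseteq> qball d u outer_const"
    using subcube_balls(2)[OF assms] by blast
  have meas: "sub (int k) \<alpha> m \<in> sets M" by (rule subcube_balls(1)[OF assms])
  show e: "emeasure M (sub (int k) \<alpha> m) = ennreal (measure M (sub (int k) \<alpha> m))"
    by (rule cell_finite[OF u(2) meas outer_const_pos])
  have p: "0 < inner_const * \<delta> ^ k" using inner_const_pos \<delta>_power by simp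
  have "0 < ennreal (V (inner_const * \<delta> ^ k) u)" using vol_pos[OF p] by simp
  also have "\<dots> = emeasure M (qball d u (inner_const * \<delta> ^ k))" by (rule emeasure_qball[OF p, symmetric])
  also have "\<dots> \<le> emeasure M (sub (int k) \<alpha> m)" by (rule emeasure_mono[OF u(1) meas])
  finally show "0 < measure M (sub (int k) \<alpha> m)" unfolding e by simp
  then show "sub (int k) \<alpha> m \<noteq> {}" by auto
qed

text \<open>Under different parents the parents are disjoint. Under one parent the enumeration is
  injective, so the two sets come from different cubes of level
  \<open>k + j\<^sub>0\<close>.\<close>

lemma subcubes_disjoint:
  "disjoint_family_on (\<lambda>(\<alpha>, m). sub (int k) \<alpha> m) (Sigma (\<A> (int k)) (\<lambda>\<alpha>. {1..n (int k) \<alpha>}))"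
proof -
  have cd: "\<And>k. disjoint_family_on (cube k) (\<A> k)"
    using dyadic unfolding dyadic_system_def by blast
  have "sub (int k) \<alpha> m \<inter> sub (int k) \<alpha>' m' = {}"
    if a: "\<alpha> \<in> \<A> (int k)" "m \<in> {1..n (int k) \<alpha>}" "\<alpha>' \<in> \<A> (int k)" "m' \<in> {1..n (int k) \<alpha>'}"
      and ne: "(\<alpha>, m) \<noteq> (\<alpha>', m')" for \<alpha> m \<alpha>' m'
  proof (cases "\<alpha> = \<alpha>'")
    case False
    obtain \<tau> \<tau>' where "sub (int k) \<alpha> m \<subseteq> cube (int k) \<alpha>" "sub (int k) \<alpha>' m' \<subseteq> cube (int k) \<alpha>'"
      using subcube[OF a(1,2)] subcube[OF a(3,4)] by metis
    moreover have "cube (int k) \<alpha> \<inter> cube (int k) \<alpha>' = {}"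
      using disjoint_family_onD[OF cd a(1,3) False] .
    ultimately show ?thesis by blast
  next
    case True
    then have mm: "m \<noteq> m'" using ne by simp
    have "inj_on (sub (int k) \<alpha>) {1..n (int k) \<alpha>}"
      using subcubes a(1) unfolding subcube_enumeration_def bij_betw_def by blast
    then have ns: "sub (int k) \<alpha> m \<noteq> sub (int k) \<alpha>' m'"
      using a True mm by (auto dest: inj_onD)
    obtain \<tau> where t: "\<tau> \<in> \<A> (int k + int j\<^sub>0)" "sub (int k) \<alpha> m = cube (int k + int j\<^sub>0) \<tau>"
      using subcube[OF a(1,2)] by metis
    obtain \<tau>' where t': "\<tau>' \<in> \<A> (int k + int j\<^sub>0)" "sub (int k) \<alpha>' m' = cube (int k + int j\<^sub>0) \<tau>'"
      using subcube[OF a(3,4)] by metis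
    have "\<tau> \<noteq> \<tau>'" using ns t t' by auto
    then show ?thesis using disjoint_family_onD[OF cd t(1) t'(1)] t t' by simp
  qed
  then show ?thesis unfolding disjoint_family_on_def by fastforce
qed

abbreviation idx :: "nat \<Rightarrow> 'i set \<Rightarrow> ('i \<times> nat) set" where
  "idx k F \<equiv> Sigma F (\<lambda>\<alpha>. {1..n (int k) \<alpha>})"

definition weight_const :: real where
  "weight_const = cell_const outer_const * hom_const \<gamma>"

definition level_const :: "ennreal \<Rightarrow> real" where
  "level_const p = weight_const + lower_const outer_const inner_const (excess p)"

lemma weight_const_nonneg: "0 \<le> weight_const"
  using cell_const_nonneg hom_const_pos[OF \<gamma>_pos] by (simp add: weight_const_def)

lemma level_const_nonneg: "0 \<le> level_const p"
  using weight_const_nonneg lower_const_nonneg by (simp add: level_const_def)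

context
  fixes k :: nat and F :: "'i set" and w :: "'i \<Rightarrow> nat \<Rightarrow> 'a"
  assumes F: "finite F" "F \<subseteq> \<A> (int k)"
    and w: "\<And>\<alpha> m. \<alpha> \<in> \<A> (int k) \<Longrightarrow> m \<in> {1..n (int k) \<alpha>} \<Longrightarrow> w \<alpha> m \<in> sub (int k) \<alpha> m"
begin

lemma level_weight_sum:
  "(\<Sum>(\<alpha>, m)\<in>idx k F. measure M (sub (int k) \<alpha> m) * G (w \<alpha> m)) \<le> weight_const"
proof -
  have "(\<Sum>i\<in>idx k F. measure M ((\<lambda>(\<alpha>, m). sub (int k) \<alpha> m) i) * G ((\<lambda>(\<alpha>, m). w \<alpha> m) i)) \<le> weight_const"
    unfolding weight_const_def
  proof (rule weight_sum_le)
    show "finite (idx k F)" using F by simp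
    show "disjoint_family_on (\<lambda>(\<alpha>, m). sub (int k) \<alpha> m) (idx k F)"
      using F by (intro disjoint_family_on_mono[OF _ subcubes_disjoint[of k]] Sigma_mono) auto
    fix i assume "i \<in> idx k F"
    then obtain \<alpha> m where am: "i = (\<alpha>, m)" "\<alpha> \<in> \<A> (int k)" "m \<in> {1..n (int k) \<alpha>}" using F by auto
    show "(\<lambda>(\<alpha>, m). sub (int k) \<alpha> m) i \<in> sets M"
      using subcube_balls(1)[OF am(2,3)] am(1) by simp
    show "\<exists>u. (\<lambda>(\<alpha>, m). sub (int k) \<alpha> m) i \<subseteq> qball d u outer_const"
      using subcube_balls(2)[OF am(2,3)] am(1) by auto
    show "(\<lambda>(\<alpha>, m). w \<alpha> m) i \<in> (\<lambda>(\<alpha>, m). sub (int k) \<alpha> m) i"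
      using w[OF am(2,3)] am(1) by simp
  qed (rule outer_const_pos)
  then show ?thesis by (simp add: case_prod_unfold)
qed

text \<open>\<open>weighted_sum_le\<close> with \<open>W = G (w \<alpha> m)\<close>: the total is a
  Riemann sum of \<open>G\<close>, the smallness is \<open>weight_le_measure\<close> at scale
  \<open>\<delta> ^ k\<close>.\<close>

lemma level_weighted_sum:
  assumes p: "0 < p" "\<omega> * excess p \<le> \<gamma>" and A: "0 \<le> A"
    and b: "\<And>i. i \<in> idx k F \<Longrightarrow> 0 \<le> b i"
    and ps: "powsum_le p (idx k F) (\<lambda>(\<alpha>, m). measure M (sub (int k) \<alpha> m)) b A"
  shows "(\<Sum>(\<alpha>, m)\<in>idx k F. measure M (sub (int k) \<alpha> m) * G (w \<alpha> m) * b (\<alpha>, m)) \<le>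
    level_const p * (\<delta> ^ k) powr (- (\<omega> * excess p)) * A"
proof -
  let ?q = "(\<delta> ^ k) powr (- (\<omega> * excess p))" and ?L = "lower_const outer_const inner_const (excess p)"
  \<comment> \<open>As \<open>?q \<ge> 1\<close>, it can also be attached to the total, which leaves
    a single level-dependent factor.\<close>
  have "(\<delta> ^ k) powr 0 \<le> ?q"
    using \<delta>_power[of k] upper_dim_nonneg excess_nonneg[of p] by (intro powr_mono') auto
  then have q: "1 \<le> ?q" using \<delta>_pos by simp
  have "(\<Sum>i\<in>idx k F. (\<lambda>(\<alpha>, m). measure M (sub (int k) \<alpha> m)) i * (\<lambda>(\<alpha>, m). G (w \<alpha> m)) i * b i) \<le>
    (weight_const + ?L * ?q) * A"
  proof (rule weighted_sum_le[OF _ p(1) A _ b _ _ _ weight_const_nonneg _ ps])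
    show "finite (idx k F)" using F by simp
    show "(\<Sum>i\<in>idx k F. (\<lambda>(\<alpha>, m). measure M (sub (int k) \<alpha> m)) i * (\<lambda>(\<alpha>, m). G (w \<alpha> m)) i) \<le> weight_const"
      using level_weight_sum by (simp add: case_prod_unfold)
    show "0 \<le> ?L * ?q" using lower_const_nonneg by simp
    fix i assume i: "i \<in> idx k F"
    then obtain \<alpha> m where am: "i = (\<alpha>, m)" "\<alpha> \<in> \<A> (int k)" "m \<in> {1..n (int k) \<alpha>}" using F by auto
    show "0 < (\<lambda>(\<alpha>, m). measure M (sub (int k) \<alpha> m)) i" using subcube_measure(2)[OF am(2,3)] am(1) by simp
    show "0 \<le> (\<lambda>(\<alpha>, m). G (w \<alpha> m)) i" using am(1) by simp
    obtain u where u: "qball d u (inner_const * \<delta> ^ k) \<subseteq> sub (int k) \<alpha> m" "sub (int k) \<alpha> m \<subseteq> qball d u outer_const"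
      using subcube_balls(2)[OF am(2,3)] by blast
    show "(\<lambda>(\<alpha>, m). G (w \<alpha> m)) i \<le> ?L * ?q * (\<lambda>(\<alpha>, m). measure M (sub (int k) \<alpha> m)) i powr excess p"
      using weight_le_measure[OF u subcube_balls(1)[OF am(2,3)] w[OF am(2,3)] \<delta>_power inner_const_pos
          outer_const_pos excess_nonneg p(2)] am(1) by simp
  qed
  also have "\<dots> \<le> (weight_const * ?q + ?L * ?q) * A"
    using q A weight_const_nonneg by (intro mult_right_mono add_right_mono) (auto simp: mult_le_cancel_left1)
  finally show ?thesis by (simp add: level_const_def case_prod_unfold distrib_right)
qed

end

end

section \<open>Bounds for one term, one level and the whole reproducing series\<close>

context dyadic_setting
begin

context
  fixes c :: real
  assumes c: "\<beta> < c" "\<gamma> \<le> c"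
begin

definition rep_const :: real where
  "rep_const = C\<^sub>\<mu>\<^sup>2 * (2 * A\<^sub>0) powr (c + \<omega>)"

definition shift_const :: real where
  "shift_const = C\<^sub>\<mu> * (A\<^sub>0 * (2 * A\<^sub>0 * outer_const + 1 + A\<^sub>0 * (2 * A\<^sub>0 * outer_const) + A\<^sub>0)) powr (c + \<omega>)"

text \<open>\<open>shift_const\<close> pays for the averaged kernels of level 0, and
  \<open>\<delta> powr (- (real N * \<beta>))\<close> for the missing cancellation on the finitely
  many levels up to \<open>N\<close>.\<close>

definition term_const :: "nat \<Rightarrow> real" where
  "term_const N = rep_const * integral_const c * (shift_const + \<delta> powr (- (real N * \<beta>)))"

lemma rep_const_nonneg: "0 \<le> rep_const" and shift_const_nonneg: "0 \<le> shift_const"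
  using doubling_constant_ge_1 by (simp_all add: rep_const_def shift_const_def)

lemma term_const_nonneg: "0 \<le> term_const N"
  using rep_const_nonneg shift_const_nonneg integral_const_pos[OF c]
  by (simp add: term_const_def less_imp_le)

lemma kernel_section_measurable:
  assumes "(\<lambda>(x, y). K x y) \<in> borel_measurable (M \<Otimes>\<^sub>M M)"
  shows "(\<lambda>x. K x w) \<in> borel_measurable M"
  using measurable_compose[OF measurable_Pair2'[of w M M] assms] by simp

text \<open>On level 0 the kernel is integrated in \<open>y\<close> over a subcube. At scale 1
  moving the centre inside a cell costs only a constant, so the average is controlled by the kernel
  at the chosen point \<open>w\<close>.\<close>

lemma hom_kernel_shift:
  assumes "y \<in> qball d u outer_const" "w \<in> qball d u outer_const"
  shows "hom_kernel 1 c y (1 + d y x) \<le> shift_const * hom_kernel 1 c w (1 + d w x)"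
  unfolding shift_const_def
proof (rule hom_kernel_change)
  define e where "e = 2 * A\<^sub>0 * outer_const"
  have e: "0 \<le> e" using A\<^sub>0_ge_1 outer_const_pos by (simp add: e_def)
  have yw: "d y w \<le> e" using same_cell_dist[of w u outer_const y] assms by (simp add: e_def)
  have "d w x \<le> A\<^sub>0 * (d y w + d y x)" using d_triangle[of w x y] by (simp add: d_commute)
  also have "\<dots> \<le> A\<^sub>0 * (e + d y x)" using yw A\<^sub>0_ge_1 by (intro mult_left_mono) auto
  finally have "d y w + (1 + d w x) \<le> e + 1 + A\<^sub>0 * e + A\<^sub>0 * d y x" using yw by (simp add: distrib_left)
  also have "\<dots> \<le> (e + 1 + A\<^sub>0 * e + A\<^sub>0) * (1 + d y x)"
    using e A\<^sub>0_ge_1 by (simp add: algebra_simps)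
  finally have "A\<^sub>0 * (d y w + (1 + d w x)) \<le> A\<^sub>0 * ((e + 1 + A\<^sub>0 * e + A\<^sub>0) * (1 + d y x))"
    using A\<^sub>0_ge_1 by (intro mult_left_mono) auto
  then show "A\<^sub>0 * (d y w + (1 + d w x)) \<le>
    A\<^sub>0 * (2 * A\<^sub>0 * outer_const + 1 + A\<^sub>0 * (2 * A\<^sub>0 * outer_const) + A\<^sub>0) * (1 + d y x)"
    by (simp add: e_def mult.assoc)
  have "1 \<le> e + 1 + A\<^sub>0 * e + A\<^sub>0" using e A\<^sub>0_ge_1 by simp
  then show "1 \<le> A\<^sub>0 * (2 * A\<^sub>0 * outer_const + 1 + A\<^sub>0 * (2 * A\<^sub>0 * outer_const) + A\<^sub>0)"
    using mult_mono[OF A\<^sub>0_ge_1, of 1 "e + 1 + A\<^sub>0 * e + A\<^sub>0"] A\<^sub>0_ge_1 by (simp add: e_def)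
qed (use c \<gamma>_pos in \<open>auto simp: add_pos_nonneg\<close>)

text \<open>The three shapes of a term: an averaged kernel without cancellation, a kernel at a point
  without cancellation, and a kernel with cancellation. The number \<open>a\<close> bounds the
  coefficient, a mean of \<open>Q k\<close> applied to \<open>f\<close> on low levels and a sample
  on high ones.\<close>

lemma reproducing_term_bound:
  assumes Qt: "reproducing_kernels d A\<^sub>0 M \<delta> N b c D Qt" and D: "0 < D"
    and g: "test_bound d A\<^sub>0 M x\<^sub>0 \<beta> \<gamma> g B"
    and am: "\<alpha> \<in> \<A> (int k)" "m \<in> {1..n (int k) \<alpha>}"
    and w: "w \<in> sub (int k) \<alpha> m"
    and a: "k \<le> N \<Longrightarrow> mean M (sub (int k) \<alpha> m) (\<lambda>x. cmod (apply_kernel (Q k) f x)) \<le> a"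
      "N < k \<Longrightarrow> cmod (apply_kernel (Q k) f w) \<le> a"
  shows "cmod (reproducing_term M N Q Qt f g k (sub (int k) \<alpha> m) w) \<le>
    D * B * term_const N * (\<delta> ^ k) powr \<beta> * (measure M (sub (int k) \<alpha> m) * G w * a)"
proof -
  let ?S = "sub (int k) \<alpha> m" and ?r = "\<delta> ^ k"
  let ?v = "measure M ?S"
  have B: "0 < B" using g by (auto simp: test_bound_def)
  have r: "0 < ?r" "?r \<le> 1" by (rule \<delta>_power)+
  have v: "0 \<le> ?v" by simp
  obtain u where u: "?S \<subseteq> qball d u outer_const" using subcube_balls(2)[OF am] by blast
  have IC: "0 \<le> integral_const c" using integral_const_pos[OF c] by simp
  have size: "cmod (Qt k x y) \<le> D * rep_const * hom_kernel ?r c y (?r + d y x)" for x y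
  proof -
    have "cmod (Qt k x y) \<le> D * R_kernel d M \<delta> c k x y"
      using Qt by (simp add: reproducing_kernels_def)
    also have "\<dots> \<le> D * (rep_const * hom_kernel ?r c y (?r + d y x))"
      unfolding rep_const_def using D \<delta>_pos c \<gamma>_pos by (intro mult_left_mono R_kernel_le) auto
    finally show ?thesis by (simp add: mult.assoc)
  qed
  have mn: "cmod (mean M ?S (apply_kernel (Q k) f)) \<le> a" if "k \<le> N"
    using norm_mean_le[of M ?S "apply_kernel (Q k) f"] a(1)[OF that] by simp
  have a0: "0 \<le> a"
    using mn a(2) by (meson norm_ge_zero not_less order_trans)
  \<comment> \<open>Lets the low levels pretend to have the gain \<open>?r powr \<beta>\<close>, so
    that one estimate covers all levels.\<close>
  have low: "1 \<le> \<delta> powr (- (real N * \<beta>)) * ?r powr \<beta>" if "k \<le> N"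
  proof -
    have "?r powr \<beta> = \<delta> powr (real k * \<beta>)"
      using \<delta>_pos by (simp add: powr_realpow[symmetric] powr_powr)
    then have "\<delta> powr (- (real N * \<beta>)) * ?r powr \<beta> = \<delta> powr (- (real (N - k) * \<beta>))"
      using that by (simp add: powr_add[symmetric] of_nat_diff algebra_simps)
    moreover have "\<delta> powr 0 \<le> \<delta> powr (- (real (N - k) * \<beta>))"
      using \<delta>_pos \<delta>_less_1 \<beta>_pos by (intro powr_mono') auto
    ultimately show ?thesis using \<delta>_pos by simp
  qed
  \<comment> \<open>\<open>X\<close> stands for the factor that a case really produces:
    \<open>shift_const\<close> on level 0, 1 on the other low levels, \<open>?r powr \<beta>\<close>
    above.\<close>
  have shift: "D * rep_const * B * integral_const c * X * (?v * G w * a) \<le>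
     D * B * term_const N * ?r powr \<beta> * (?v * G w * a)"
    if "X \<le> (shift_const + \<delta> powr (- (real N * \<beta>))) * ?r powr \<beta>" for X
  proof -
    have "D * rep_const * B * integral_const c * X \<le>
      D * rep_const * B * integral_const c * ((shift_const + \<delta> powr (- (real N * \<beta>))) * ?r powr \<beta>)"
      using that D B rep_const_nonneg IC by (intro mult_left_mono) auto
    also have "\<dots> = D * B * term_const N * ?r powr \<beta>" by (simp add: term_const_def mult_ac)
    finally show ?thesis using a0 by (intro mult_right_mono) auto
  qed
  consider "k = 0" | "0 < k" "k \<le> N" | "N < k" "0 < k" by linarith
  then show ?thesis
  proof cases
    case 1
    have kb: "cmod (LINT y:?S|M. Qt 0 x y) \<le> (?v * D * rep_const * shift_const) * hom_kernel 1 c w (1 + d w x)" for x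
    proof -
      have "cmod (LINT y:?S|M. Qt 0 x y) \<le> ?v * (D * rep_const * (shift_const * hom_kernel 1 c w (1 + d w x)))"
      proof (rule norm_set_integral_le)
        fix y assume "y \<in> ?S"
        then have "hom_kernel 1 c y (1 + d y x) \<le> shift_const * hom_kernel 1 c w (1 + d w x)"
          using u w by (intro hom_kernel_shift) auto
        then have "D * rep_const * hom_kernel 1 c y (1 + d y x) \<le> D * rep_const * (shift_const * hom_kernel 1 c w (1 + d w x))"
          using D rep_const_nonneg by (intro mult_left_mono) auto
        then show "cmod (Qt 0 x y) \<le> D * rep_const * (shift_const * hom_kernel 1 c w (1 + d w x))"
          using size[of x y] 1 by simp
      qed (use subcube_balls(1)[OF am] subcube_measure(1)[OF am] D rep_const_nonneg shift_const_nonneg in auto)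
      then show ?thesis by (simp add: mult_ac)
    qed
    have "cmod (LINT x|M. (LINT y:?S|M. Qt 0 x y) * g x) \<le> (?v * D * rep_const * shift_const) * B * integral_const c * G w"
    proof (rule kernel_pairing[OF c g])
      show "0 \<le> ?v * D * rep_const * shift_const" using D rep_const_nonneg shift_const_nonneg by simp
      show "cmod (LINT y:?S|M. Qt 0 x y) \<le> ?v * D * rep_const * shift_const * hom_kernel 1 c w (1 + d w x)" for x
        by (rule kb)
    qed simp_all
    then have "cmod (LINT x|M. (LINT y:?S|M. Qt 0 x y) * g x) * cmod (mean M ?S (apply_kernel (Q 0) f)) \<le>
      ((?v * D * rep_const * shift_const) * B * integral_const c * G w) * a"
      using 1 mn B D rep_const_nonneg shift_const_nonneg IC by (intro mult_mono mult_nonneg_nonneg) auto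
    moreover have "cmod (reproducing_term M N Q Qt f g k ?S w) =
      cmod (LINT x|M. (LINT y:?S|M. Qt 0 x y) * g x) * cmod (mean M ?S (apply_kernel (Q 0) f))"
      using 1 by (simp add: reproducing_term_def norm_mult)
    ultimately have "cmod (reproducing_term M N Q Qt f g k ?S w) \<le>
      ((?v * D * rep_const * shift_const) * B * integral_const c * G w) * a" by simp
    also have "\<dots> = D * rep_const * B * integral_const c * shift_const * (?v * G w * a)" by (simp add: mult_ac)
    also have "\<dots> \<le> D * B * term_const N * ?r powr \<beta> * (?v * G w * a)"
      using 1 by (intro shift) simp
    finally show ?thesis .
  next
    case 2
    have "cmod (LINT x|M. Qt k x w * g x) \<le> (D * rep_const) * B * integral_const c * G w"
      using size D rep_const_nonneg r by (intro kernel_pairing[OF c g]) auto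
    then have "cmod (reproducing_term M N Q Qt f g k ?S w) \<le> ?v * ((D * rep_const) * B * integral_const c * G w) * a"
      using 2 mn B D rep_const_nonneg IC
      by (simp add: reproducing_term_def norm_mult) (intro mult_mono mult_left_mono mult_nonneg_nonneg, auto)
    also have "\<dots> = D * rep_const * B * integral_const c * 1 * (?v * G w * a)" by (simp add: mult_ac)
    also have "\<dots> \<le> D * B * term_const N * ?r powr \<beta> * (?v * G w * a)"
      using low[OF 2(2)] shift_const_nonneg by (intro shift) (simp add: distrib_right add_increasing)
    finally show ?thesis .
  next
    case 3
    have m: "(\<lambda>x. Qt k x w) \<in> borel_measurable M" and z: "(LINT x|M. Qt k x w) = 0"
      using Qt 3 kernel_section_measurable[of "Qt k" w]
      by (auto simp: reproducing_kernels_def L2_bounded_kernel_def kernel_integral_def)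
    have "cmod (LINT x|M. Qt k x w * g x) \<le> (D * rep_const) * B * integral_const c * ?r powr \<beta> * G w"
      using size D rep_const_nonneg r m z by (intro kernel_pairing_cancel[OF c g]) auto
    then have "cmod (reproducing_term M N Q Qt f g k ?S w) \<le> ?v * ((D * rep_const) * B * integral_const c * ?r powr \<beta> * G w) * a"
      using 3 a(2) B D rep_const_nonneg IC
      by (simp add: reproducing_term_def norm_mult) (intro mult_mono mult_left_mono mult_nonneg_nonneg, auto)
    also have "\<dots> = D * rep_const * B * integral_const c * ?r powr \<beta> * (?v * G w * a)" by (simp add: mult_ac)
    also have "\<dots> \<le> D * B * term_const N * ?r powr \<beta> * (?v * G w * a)"
    proof (intro shift)
      have "\<delta> powr 0 \<le> \<delta> powr (- (real N * \<beta>))"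
        using \<delta>_pos \<delta>_less_1 \<beta>_pos by (intro powr_mono') auto
      then have "1 \<le> shift_const + \<delta> powr (- (real N * \<beta>))" using shift_const_nonneg \<delta>_pos by simp
      then have "1 * ?r powr \<beta> \<le> (shift_const + \<delta> powr (- (real N * \<beta>))) * ?r powr \<beta>" by (intro mult_right_mono) auto
      then show "?r powr \<beta> \<le> (shift_const + \<delta> powr (- (real N * \<beta>))) * ?r powr \<beta>" by simp
    qed
    finally show ?thesis .
  qed
qed

lemma level_bounds_highD:
  assumes "level_bounds M \<delta> \<A> n sub Q N s p f X" "finite F" "F \<subseteq> \<A> (int k)" "N < k"
    and "\<forall>\<alpha>\<in>F. \<forall>m\<in>{1..n (int k) \<alpha>}. 0 \<le> b (\<alpha>, m) \<and>
      (\<forall>x\<in>sub (int k) \<alpha> m. b (\<alpha>, m) \<le> cmod (apply_kernel (Q k) f x))"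
  shows "powsum_le p (idx k F) (\<lambda>(\<alpha>, m). measure M (sub (int k) \<alpha> m)) b (\<delta> powr (real k * s) * X)"
  using assms(1)[unfolded level_bounds_def, THEN conjunct2, THEN spec[of _ k], THEN spec[of _ F], THEN mp,
    OF conjI[OF assms(2,3)], THEN conjunct2, THEN mp, OF assms(4), THEN spec[of _ b], THEN mp, OF assms(5)] .

text \<open>The ratio collects \<beta> from the pairing, s from the norm of \<open>f\<close> and
  \<open>- \<omega> * excess p\<close> from the passage to the discrete p-norm. The \<epsilon> term
  carries no norm of \<open>f\<close>; it is summed against the weights alone and therefore keeps
  the full gain \<beta>.\<close>

lemma reproducing_level_bound:
  assumes Qt: "reproducing_kernels d A\<^sub>0 M \<delta> N b c D Qt" and D: "0 < D"
    and g: "test_bound d A\<^sub>0 M x\<^sub>0 \<beta> \<gamma> g B"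
    and p: "0 < p" "\<omega> * excess p \<le> \<gamma>"
    and lb: "level_bounds M \<delta> \<A> n sub Q N s p f X" and \<epsilon>: "0 \<le> \<epsilon>"
    and w: "\<And>\<alpha> m. \<alpha> \<in> \<A> (int k) \<Longrightarrow> m \<in> {1..n (int k) \<alpha>} \<Longrightarrow> w \<alpha> m \<in> sub (int k) \<alpha> m"
    and near_inf: "\<And>\<alpha> m x. \<alpha> \<in> \<A> (int k) \<Longrightarrow> m \<in> {1..n (int k) \<alpha>} \<Longrightarrow> x \<in> sub (int k) \<alpha> m \<Longrightarrow>
      cmod (apply_kernel (Q k) f (w \<alpha> m)) \<le> cmod (apply_kernel (Q k) f x) + \<epsilon>"
    and sum: "((\<lambda>\<alpha>. \<Sum>m=1..n (int k) \<alpha>.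
      reproducing_term M N Q Qt f g k (sub (int k) \<alpha> m) (w \<alpha> m)) has_sum t) (\<A> (int k))"
  shows "cmod t \<le> D * B * term_const N *
    (level_const p * \<delta> powr (- (real N * \<bar>s\<bar>)) * X * (\<delta> powr (\<beta> + s - \<omega> * excess p)) ^ k
      + weight_const * \<epsilon> * (\<delta> powr \<beta>) ^ k)"
proof (rule norm_has_sum_le[OF sum])
  fix F assume F: "finite F" "F \<subseteq> \<A> (int k)"
  have B: "0 < B" using g by (auto simp: test_bound_def)
  have X: "0 \<le> X" using lb by (simp add: level_bounds_def)
  have r: "0 < \<delta> ^ k" "\<delta> ^ k \<le> 1" by (rule \<delta>_power)+
  \<comment> \<open>On low levels the norm gives \<open>X\<close> without the power
    \<open>\<delta> powr (real k * s)\<close>; the first factor compensates for all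
    \<open>k \<le> N\<close>, whatever the sign of \<open>s\<close>.\<close>
  let ?A = "\<delta> powr (- (real N * \<bar>s\<bar>)) * \<delta> powr (real k * s) * X"
  have A: "0 \<le> ?A" using X by simp
  \<comment> \<open>On high levels the infimum is used instead of the sample, because it lies below
    \<open>Q k\<close> applied to \<open>f\<close> on the whole cell, as \<open>level_bounds\<close>
    demands; the sample exceeds it by at most \<epsilon>.\<close>
  define a where "a = (\<lambda>(\<alpha>, m). if k \<le> N
    then mean M (sub (int k) \<alpha> m) (\<lambda>x. cmod (apply_kernel (Q k) f x))
    else (INF x\<in>sub (int k) \<alpha> m. cmod (apply_kernel (Q k) f x)))"
  have bdd: "bdd_below ((\<lambda>x. cmod (apply_kernel (Q k) f x)) ` S)" for S
    by (rule bdd_belowI2[of _ 0]) simp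
  have a0: "0 \<le> a i" if i: "i \<in> idx k F" for i
  proof -
    obtain \<alpha> m where am: "i = (\<alpha>, m)" "\<alpha> \<in> \<A> (int k)" "m \<in> {1..n (int k) \<alpha>}" using F i by auto
    show ?thesis
      using subcube_measure(3)[OF am(2,3)] by (auto simp: a_def am(1) intro!: mean_nonneg cINF_greatest)
  qed
  have ps: "powsum_le p (idx k F) (\<lambda>(\<alpha>, m). measure M (sub (int k) \<alpha> m)) a ?A"
  proof (cases "k \<le> N")
    case True
    have "powsum_le p (idx k F) (\<lambda>(\<alpha>, m). measure M (sub (int k) \<alpha> m))
          (\<lambda>(\<alpha>, m). mean M (sub (int k) \<alpha> m) (\<lambda>x. cmod (apply_kernel (Q k) f x))) X"
      using lb F True by (simp add: level_bounds_def)
    then have "powsum_le p (idx k F) (\<lambda>(\<alpha>, m). measure M (sub (int k) \<alpha> m)) a X"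
      using True by (simp add: a_def)
    moreover have "X \<le> ?A"
    proof -
      have "real k * s \<le> real k * \<bar>s\<bar>" by (intro mult_left_mono) auto
      also have "\<dots> \<le> real N * \<bar>s\<bar>" using True by (intro mult_right_mono) auto
      finally have "real k * s \<le> real N * \<bar>s\<bar>" .
      then have "\<delta> powr 0 \<le> \<delta> powr (- (real N * \<bar>s\<bar>) + real k * s)"
        using \<delta>_pos \<delta>_less_1 by (intro powr_mono') auto
      then have "1 \<le> \<delta> powr (- (real N * \<bar>s\<bar>)) * \<delta> powr (real k * s)" 
        using \<delta>_pos by (simp only: powr_add) simp
      then show ?thesis using mult_right_mono[OF _ X] by fastforce
    qed
    ultimately show ?thesis using X by (rule powsum_le_mono)
  next
    case False
    have "powsum_le p (idx k F) (\<lambda>(\<alpha>, m). measure M (sub (int k) \<alpha> m)) a (\<delta> powr (real k * s) * X)"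
    proof -
      have bnd: "\<forall>\<alpha>\<in>F. \<forall>m\<in>{1..n (int k) \<alpha>}. 0 \<le> a (\<alpha>, m) \<and>
            (\<forall>x\<in>sub (int k) \<alpha> m. a (\<alpha>, m) \<le> cmod (apply_kernel (Q k) f x))"
      proof (intro ballI conjI)
        fix \<alpha> m assume am: "\<alpha> \<in> F" "m \<in> {1..n (int k) \<alpha>}"
        then show "0 \<le> a (\<alpha>, m)" by (intro a0) simp
        fix x assume "x \<in> sub (int k) \<alpha> m"
        then have "(INF x\<in>sub (int k) \<alpha> m. cmod (apply_kernel (Q k) f x)) \<le> cmod (apply_kernel (Q k) f x)"
          by (rule cINF_lower[OF bdd])
        then show "a (\<alpha>, m) \<le> cmod (apply_kernel (Q k) f x)" using False by (simp add: a_def)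
      qed
      show ?thesis by (rule level_bounds_highD[OF lb F _ bnd]) (use False in simp)
    qed
    moreover have "\<delta> powr (real k * s) * X \<le> ?A"
    proof -
      have "\<delta> powr 0 \<le> \<delta> powr (- (real N * \<bar>s\<bar>))"
        using \<delta>_pos \<delta>_less_1 by (intro powr_mono') auto
      then have "1 * (\<delta> powr (real k * s) * X) \<le> \<delta> powr (- (real N * \<bar>s\<bar>)) * (\<delta> powr (real k * s) * X)"
        using X \<delta>_pos by (intro mult_right_mono) auto
      then show ?thesis by (simp add: mult.assoc)
    qed
    ultimately show ?thesis by (rule powsum_le_mono) (use X in simp)
  qed
  let ?P = "D * B * term_const N * (\<delta> ^ k) powr \<beta>"
  have P: "0 \<le> ?P" using D B term_const_nonneg by simp
  let ?v = "\<lambda>\<alpha> m. measure M (sub (int k) \<alpha> m)"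
  have "norm (\<Sum>\<alpha>\<in>F. \<Sum>m=1..n (int k) \<alpha>. reproducing_term M N Q Qt f g k (sub (int k) \<alpha> m) (w \<alpha> m)) \<le>
    (\<Sum>\<alpha>\<in>F. \<Sum>m=1..n (int k) \<alpha>. ?P * (?v \<alpha> m * G (w \<alpha> m) * (a (\<alpha>, m) + \<epsilon>)))"
  proof (intro sum_norm_le)
    fix \<alpha> m assume "\<alpha> \<in> F" "m \<in> {1..n (int k) \<alpha>}"
    then have am: "\<alpha> \<in> \<A> (int k)" "m \<in> {1..n (int k) \<alpha>}" using F by auto
    show "norm (reproducing_term M N Q Qt f g k (sub (int k) \<alpha> m) (w \<alpha> m)) \<le>
      ?P * (?v \<alpha> m * G (w \<alpha> m) * (a (\<alpha>, m) + \<epsilon>))"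
    proof (rule reproducing_term_bound[OF Qt D g am w[OF am]])
      assume "N < k"
      have "cmod (apply_kernel (Q k) f (w \<alpha> m)) - \<epsilon> \<le> (INF x\<in>sub (int k) \<alpha> m. cmod (apply_kernel (Q k) f x))"
        using near_inf[OF am] subcube_measure(3)[OF am] by (intro cINF_greatest) (auto simp: algebra_simps)
      then show "cmod (apply_kernel (Q k) f (w \<alpha> m)) \<le> a (\<alpha>, m) + \<epsilon>"
        using \<open>N < k\<close> by (simp add: a_def)
    qed (use \<epsilon> in \<open>simp add: a_def\<close>)
  qed
  also have "\<dots> = ?P * ((\<Sum>(\<alpha>, m)\<in>idx k F. ?v \<alpha> m * G (w \<alpha> m) * a (\<alpha>, m))
      + (\<Sum>(\<alpha>, m)\<in>idx k F. ?v \<alpha> m * G (w \<alpha> m)) * \<epsilon>)"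
    using F by (subst sum.Sigma)
      (auto simp: sum_distrib_left sum_distrib_right sum.distrib[symmetric] algebra_simps intro!: sum.cong)
  also have "\<dots> \<le> ?P * (level_const p * (\<delta> ^ k) powr (- (\<omega> * excess p)) * ?A + weight_const * \<epsilon>)"
    using F w p A a0 ps P \<epsilon>
    by (intro mult_left_mono add_mono mult_right_mono level_weighted_sum level_weight_sum) auto
  also have "\<dots> = D * B * term_const N *
    (level_const p * \<delta> powr (- (real N * \<bar>s\<bar>)) * X *
       ((\<delta> ^ k) powr \<beta> * (\<delta> ^ k) powr (- (\<omega> * excess p)) * \<delta> powr (real k * s))
      + weight_const * \<epsilon> * (\<delta> ^ k) powr \<beta>)"
    by (simp add: algebra_simps)
  also have "(\<delta> ^ k) powr \<beta> * (\<delta> ^ k) powr (- (\<omega> * excess p)) * \<delta> powr (real k * s) =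
    (\<delta> powr (\<beta> + s - \<omega> * excess p)) ^ k"
    using \<delta>_pos by (simp add: powr_realpow[symmetric] powr_powr powr_add[symmetric] algebra_simps)
  also have "(\<delta> ^ k) powr \<beta> = (\<delta> powr \<beta>) ^ k"
    using \<delta>_pos by (simp add: powr_realpow[symmetric] powr_powr mult.commute)
  finally show "norm (\<Sum>\<alpha>\<in>F. \<Sum>m=1..n (int k) \<alpha>. reproducing_term M N Q Qt f g k (sub (int k) \<alpha> m) (w \<alpha> m)) \<le> D * B * term_const N *
    (level_const p * \<delta> powr (- (real N * \<bar>s\<bar>)) * X * (\<delta> powr (\<beta> + s - \<omega> * excess p)) ^ k
      + weight_const * \<epsilon> * (\<delta> powr \<beta>) ^ k)" .
qed

definition pairing_const :: "ennreal \<Rightarrow> real \<Rightarrow> nat \<Rightarrow> real \<Rightarrow> real" where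
  "pairing_const p s N D = D * term_const N * level_const p * \<delta> powr (- (real N * \<bar>s\<bar>))
     / (1 - \<delta> powr (\<beta> + s - \<omega> * excess p))"

text \<open>The points are built from \<open>f\<close> and \<epsilon> after \<open>D\<close> is
  fixed, hence the hypothesis for all \<open>w\<close> with one \<open>D\<close>. Both parts of the
  level bound sum geometrically, and neither the points nor \<open>Qt\<close> survive in the
  conclusion.\<close>

lemma pairing_bound:
  assumes rep: "\<And>w :: nat \<Rightarrow> 'i \<Rightarrow> nat \<Rightarrow> 'a.
      (\<forall>k. \<forall>\<alpha>\<in>\<A> (int k). \<forall>m\<in>{1..n (int k) \<alpha>}. w k \<alpha> m \<in> sub (int k) \<alpha> m) \<Longrightarrow>
      \<exists>Qt t. reproducing_kernels d A\<^sub>0 M \<delta> N b c D Qt \<and>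
        (\<forall>k. ((\<lambda>\<alpha>. \<Sum>m=1..n (int k) \<alpha>.
            reproducing_term M N Q Qt f g k (sub (int k) \<alpha> m) (w k \<alpha> m)) has_sum t k) (\<A> (int k))) \<and>
        t sums f g"
    and D: "0 < D"
    and g: "test_bound d A\<^sub>0 M x\<^sub>0 \<beta> \<gamma> g B"
    and p: "0 < p" "\<omega> * excess p \<le> \<gamma>" and s: "\<omega> * excess p - s < \<beta>"
    and lb: "level_bounds M \<delta> \<A> n sub Q N s p f X"
  shows "cmod (f g) \<le> pairing_const p s N D * B * X"
proof (rule field_le_epsilon)
  have B: "0 < B" using g by (auto simp: test_bound_def)
  define q1 where "q1 = \<delta> powr (\<beta> + s - \<omega> * excess p)"
  define q2 where "q2 = \<delta> powr \<beta>"
  have "q1 < \<delta> powr 0" "q2 < \<delta> powr 0" unfolding q1_def q2_def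
    using \<delta>_pos \<delta>_less_1 s \<beta>_pos by (intro powr_less_mono'; simp)+
  then have q: "0 \<le> q1" "q1 < 1" "0 \<le> q2" "q2 < 1" using \<delta>_pos by (auto simp: q1_def q2_def)
  define U where "U = D * B * term_const N"
  have U: "0 \<le> U" using D B term_const_nonneg by (simp add: U_def)
  define Y where "Y = level_const p * \<delta> powr (- (real N * \<bar>s\<bar>)) * X"
  fix e :: real assume e: "0 < e"
  \<comment> \<open>Makes the total sampling error
    \<open>U * weight_const * \<epsilon> / (1 - q2)\<close> at most \<open>e\<close>; the summand 1
    keeps the denominator positive.\<close>
  define \<epsilon> where "\<epsilon> = e * (1 - q2) / (U * weight_const + 1)"
  have W: "0 \<le> U * weight_const" using U weight_const_nonneg by simp
  have \<epsilon>: "0 < \<epsilon>" using e q W by (simp add: \<epsilon>_def)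
  have \<epsilon>': "U * weight_const * \<epsilon> / (1 - q2) \<le> e"
  proof -
    have "U * weight_const * \<epsilon> / (1 - q2) = e * (U * weight_const / (U * weight_const + 1))"
      using q by (simp add: \<epsilon>_def)
    also have "\<dots> \<le> e * 1" using e W by (intro mult_left_mono) (auto simp: divide_le_eq)
    finally show ?thesis by simp
  qed
  have "\<exists>y. y \<in> sub (int k) \<alpha> m \<and> (\<forall>x\<in>sub (int k) \<alpha> m.
      cmod (apply_kernel (Q k) f y) \<le> cmod (apply_kernel (Q k) f x) + \<epsilon>)"
    if am: "\<alpha> \<in> \<A> (int k)" "m \<in> {1..n (int k) \<alpha>}" for k \<alpha> m
  proof -
    let ?h = "\<lambda>x. cmod (apply_kernel (Q k) f x)" and ?S = "sub (int k) \<alpha> m"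
    have bdd: "bdd_below (?h ` ?S)" by (rule bdd_belowI2[of _ 0]) simp
    have "Inf (?h ` ?S) < Inf (?h ` ?S) + \<epsilon>" using \<epsilon> by simp
    then obtain y where y: "y \<in> ?S" "?h y < Inf (?h ` ?S) + \<epsilon>"
      using subcube_measure(3)[OF am] cINF_less_iff[OF _ bdd] by blast
    then show ?thesis using cINF_lower[OF bdd] by (intro exI[of _ y]) force
  qed
  note ex = this
  define w where "w k \<alpha> m = (SOME y. y \<in> sub (int k) \<alpha> m \<and> (\<forall>x\<in>sub (int k) \<alpha> m.
      cmod (apply_kernel (Q k) f y) \<le> cmod (apply_kernel (Q k) f x) + \<epsilon>))" for k \<alpha> m
  have w: "w k \<alpha> m \<in> sub (int k) \<alpha> m \<and> (\<forall>x\<in>sub (int k) \<alpha> m.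
      cmod (apply_kernel (Q k) f (w k \<alpha> m)) \<le> cmod (apply_kernel (Q k) f x) + \<epsilon>)"
    if "\<alpha> \<in> \<A> (int k)" "m \<in> {1..n (int k) \<alpha>}" for k \<alpha> m
    unfolding w_def using ex[OF that] by (rule someI_ex)
  obtain Qt t where Qt: "reproducing_kernels d A\<^sub>0 M \<delta> N b c D Qt"
    and t: "\<And>k. ((\<lambda>\<alpha>. \<Sum>m=1..n (int k) \<alpha>.
            reproducing_term M N Q Qt f g k (sub (int k) \<alpha> m) (w k \<alpha> m)) has_sum t k) (\<A> (int k))"
    and sums: "t sums f g"
    using rep[of w] w by blast
  have bound: "cmod (t k) \<le> U * (Y * q1 ^ k + weight_const * \<epsilon> * q2 ^ k)" for k
    unfolding U_def Y_def q1_def q2_def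
    by (rule reproducing_level_bound[OF Qt D g p lb _ _ _ t]) (use \<epsilon> w in auto)
  have maj: "(\<lambda>k. U * (Y * q1 ^ k + weight_const * \<epsilon> * q2 ^ k)) sums
      (U * (Y * (1 / (1 - q1)) + weight_const * \<epsilon> * (1 / (1 - q2))))"
    using q by (intro sums_mult sums_add geometric_sums) auto
  have "cmod (f g) = cmod (suminf t)" using sums by (simp add: sums_iff)
  also have "\<dots> \<le> U * (Y * (1 / (1 - q1)) + weight_const * \<epsilon> * (1 / (1 - q2)))"
    using norm_suminf_le[OF bound sums_summable[OF maj]] sums_unique[OF maj] by simp
  also have "\<dots> = U * Y / (1 - q1) + U * weight_const * \<epsilon> / (1 - q2)"
    by (simp add: algebra_simps)
  also have "\<dots> \<le> U * Y / (1 - q1) + e" using \<epsilon>' by simp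
  also have "U * Y / (1 - q1) = pairing_const p s N D * B * X"
    by (simp add: U_def Y_def q1_def pairing_const_def mult_ac)
  finally show "cmod (f g) \<le> pairing_const p s N D * B * X + e" .
qed

lemma pairing_const_nonneg:
  assumes "0 < D" "\<omega> * excess p - s < \<beta>"
  shows "0 \<le> pairing_const p s N D"
proof -
  have "\<delta> powr (\<beta> + s - \<omega> * excess p) < \<delta> powr 0"
    using \<delta>_pos \<delta>_less_1 assms by (intro powr_less_mono') auto
  then show ?thesis
    using assms term_const_nonneg level_const_nonneg \<delta>_pos by (simp add: pairing_const_def)
qed

end

end

subsection \<open>Test function norms and extension by density\<close>

context homogeneous_space
begin

lemma D_weight_nonneg: "0 \<le> D_weight d M x\<^sub>0 \<gamma> x"
  by (simp add: D_weight_def vol_def vol2_def)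

text \<open>The constant of a test bound has to be positive, so for \<open>c = 0\<close> the product
  \<open>cmod c * B\<close> is not admissible; hence the free larger \<open>B'\<close>.\<close>

lemma test_bound_scale:
  assumes f: "test_bound d A\<^sub>0 M x\<^sub>0 \<beta> \<gamma> f B" and B': "cmod c * B \<le> B'" "0 < B'"
  shows "test_bound d A\<^sub>0 M x\<^sub>0 \<beta> \<gamma> (\<lambda>x. c * f x) B'"
proof -
  let ?D = "D_weight d M x\<^sub>0 \<gamma>"
  have "cmod (c * f x) \<le> B' * ?D x" for x
  proof -
    have "cmod c * cmod (f x) \<le> cmod c * (B * ?D x)"
      using f by (intro mult_left_mono) (auto simp: test_bound_def)
    also have "\<dots> \<le> B' * ?D x"
      using mult_right_mono[OF B'(1) D_weight_nonneg] by (simp add: mult.assoc)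
    finally show ?thesis by (simp add: norm_mult)
  qed
  moreover have "cmod (c * f x - c * f y) \<le> B' * (d x y / (1 + d x\<^sub>0 x)) powr \<beta> * ?D x"
    if "d x y \<le> (1 + d x\<^sub>0 x) / (2 * A\<^sub>0)" for x y
  proof -
    have "cmod c * cmod (f x - f y) \<le> cmod c * (B * (d x y / (1 + d x\<^sub>0 x)) powr \<beta> * ?D x)"
      using f that by (intro mult_left_mono) (auto simp: test_bound_def)
    also have "\<dots> = cmod c * B * ((d x y / (1 + d x\<^sub>0 x)) powr \<beta> * ?D x)" by simp
    also have "\<dots> \<le> B' * ((d x y / (1 + d x\<^sub>0 x)) powr \<beta> * ?D x)"
      using B' D_weight_nonneg by (intro mult_right_mono) auto
    finally show ?thesis by (simp add: norm_mult mult.assoc flip: right_diff_distrib)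
  qed
  ultimately show ?thesis using B' by (simp add: test_bound_def)
qed

lemma test_bound_add:
  assumes f: "test_bound d A\<^sub>0 M x\<^sub>0 \<beta> \<gamma> f B" and g: "test_bound d A\<^sub>0 M x\<^sub>0 \<beta> \<gamma> g B'"
  shows "test_bound d A\<^sub>0 M x\<^sub>0 \<beta> \<gamma> (\<lambda>x. f x + g x) (B + B')"
proof -
  let ?D = "D_weight d M x\<^sub>0 \<gamma>"
  have "cmod (f x + g x) \<le> (B + B') * ?D x" for x
    using f g norm_triangle_ineq[of "f x" "g x"]
    by (simp add: test_bound_def distrib_right) (meson add_mono order_trans)
  moreover have "cmod (f x + g x - (f y + g y)) \<le> (B + B') * (d x y / (1 + d x\<^sub>0 x)) powr \<beta> * ?D x"
    if "d x y \<le> (1 + d x\<^sub>0 x) / (2 * A\<^sub>0)" for x y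
  proof -
    have "cmod (f x + g x - (f y + g y)) = cmod ((f x - f y) + (g x - g y))" by (simp add: algebra_simps)
    also have "\<dots> \<le> cmod (f x - f y) + cmod (g x - g y)" by (rule norm_triangle_ineq)
    also have "\<dots> \<le> B * (d x y / (1 + d x\<^sub>0 x)) powr \<beta> * ?D x + B' * (d x y / (1 + d x\<^sub>0 x)) powr \<beta> * ?D x"
      using f g that by (intro add_mono) (auto simp: test_bound_def)
    finally show ?thesis by (simp add: distrib_right)
  qed
  ultimately show ?thesis using f g by (simp add: test_bound_def)
qed

lemma test_norm_le: "test_bound d A\<^sub>0 M x\<^sub>0 \<beta> \<gamma> f B \<Longrightarrow> test_norm d A\<^sub>0 M x\<^sub>0 \<beta> \<gamma> f \<le> B"
  unfolding test_norm_def
  by (rule cInf_lower) (auto intro!: bdd_belowI[of _ 0] simp: test_bound_def)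

lemma le_test_norm:
  assumes "f \<in> test_space d A\<^sub>0 M x\<^sub>0 \<beta> \<gamma>" "\<And>B. test_bound d A\<^sub>0 M x\<^sub>0 \<beta> \<gamma> f B \<Longrightarrow> c \<le> B"
  shows "c \<le> test_norm d A\<^sub>0 M x\<^sub>0 \<beta> \<gamma> f"
  unfolding test_norm_def by (rule cInf_greatest) (use assms in \<open>auto simp: test_space_def\<close>)

lemma test_norm_nonneg: "f \<in> test_space d A\<^sub>0 M x\<^sub>0 \<beta> \<gamma> \<Longrightarrow> 0 \<le> test_norm d A\<^sub>0 M x\<^sub>0 \<beta> \<gamma> f"
  by (rule le_test_norm) (auto simp: test_bound_def)

text \<open>Passes from every admissible constant to their infimum. For \<open>K = 0\<close>, where
  dividing is impossible, some admissible constant is taken from membership of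
  \<open>f\<close>.\<close>

lemma mult_test_norm_greatest:
  assumes f: "f \<in> test_space d A\<^sub>0 M x\<^sub>0 \<beta> \<gamma>" and "0 \<le> K"
    and "\<And>B. test_bound d A\<^sub>0 M x\<^sub>0 \<beta> \<gamma> f B \<Longrightarrow> a \<le> K * B"
  shows "a \<le> K * test_norm d A\<^sub>0 M x\<^sub>0 \<beta> \<gamma> f"
proof (cases "K = 0")
  case True
  then show ?thesis using assms by (auto simp: test_space_def)
next
  case False
  then have "a / K \<le> test_norm d A\<^sub>0 M x\<^sub>0 \<beta> \<gamma> f"
    using assms by (intro le_test_norm) (auto simp: field_simps)
  then show ?thesis using False assms(2) by (simp add: field_simps)
qed

lemma test_space_add:
  "f \<in> test_space d A\<^sub>0 M x\<^sub>0 \<beta> \<gamma> \<Longrightarrow> g \<in> test_space d A\<^sub>0 M x\<^sub>0 \<beta> \<gamma> \<Longrightarrow>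
    (\<lambda>x. f x + g x) \<in> test_space d A\<^sub>0 M x\<^sub>0 \<beta> \<gamma>"
  using test_bound_add by (fastforce simp: test_space_def)

lemma test_space_scale:
  assumes "f \<in> test_space d A\<^sub>0 M x\<^sub>0 \<beta> \<gamma>"
  shows "(\<lambda>x. c * f x) \<in> test_space d A\<^sub>0 M x\<^sub>0 \<beta> \<gamma>"
proof -
  obtain B where B: "test_bound d A\<^sub>0 M x\<^sub>0 \<beta> \<gamma> f B" using assms by (auto simp: test_space_def)
  then have "0 \<le> cmod c * B" by (simp add: test_bound_def)
  with test_bound_scale[OF B, of c "cmod c * B + 1"] show ?thesis by (auto simp: test_space_def)
qed

lemma test_space_diff:
  assumes "f \<in> test_space d A\<^sub>0 M x\<^sub>0 \<beta> \<gamma>" "g \<in> test_space d A\<^sub>0 M x\<^sub>0 \<beta> \<gamma>"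
  shows "(\<lambda>x. f x - g x) \<in> test_space d A\<^sub>0 M x\<^sub>0 \<beta> \<gamma>"
  using test_space_add[OF assms(1) test_space_scale[OF assms(2), of "-1"]] by simp

lemma test_norm_add:
  assumes "f \<in> test_space d A\<^sub>0 M x\<^sub>0 \<beta> \<gamma>" "g \<in> test_space d A\<^sub>0 M x\<^sub>0 \<beta> \<gamma>"
  shows "test_norm d A\<^sub>0 M x\<^sub>0 \<beta> \<gamma> (\<lambda>x. f x + g x) \<le>
    test_norm d A\<^sub>0 M x\<^sub>0 \<beta> \<gamma> f + test_norm d A\<^sub>0 M x\<^sub>0 \<beta> \<gamma> g"
proof -
  let ?n = "test_norm d A\<^sub>0 M x\<^sub>0 \<beta> \<gamma>"
  have "?n (\<lambda>x. f x + g x) - B \<le> ?n f" if "test_bound d A\<^sub>0 M x\<^sub>0 \<beta> \<gamma> g B" for B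
  proof (rule le_test_norm[OF assms(1)])
    fix B' assume "test_bound d A\<^sub>0 M x\<^sub>0 \<beta> \<gamma> f B'"
    from test_norm_le[OF test_bound_add[OF this that]] show "?n (\<lambda>x. f x + g x) - B \<le> B'" by simp
  qed
  then have "?n (\<lambda>x. f x + g x) - ?n f \<le> ?n g"
    by (intro le_test_norm[OF assms(2)]) (simp add: algebra_simps)
  then show ?thesis by simp
qed

lemma test_norm_scale:
  assumes "f \<in> test_space d A\<^sub>0 M x\<^sub>0 \<beta> \<gamma>"
  shows "test_norm d A\<^sub>0 M x\<^sub>0 \<beta> \<gamma> (\<lambda>x. c * f x) \<le> cmod c * test_norm d A\<^sub>0 M x\<^sub>0 \<beta> \<gamma> f"
proof (rule mult_test_norm_greatest[OF assms])
  fix B assume B: "test_bound d A\<^sub>0 M x\<^sub>0 \<beta> \<gamma> f B"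
  then have B0: "0 \<le> cmod c * B" by (simp add: test_bound_def)
  show "test_norm d A\<^sub>0 M x\<^sub>0 \<beta> \<gamma> (\<lambda>x. c * f x) \<le> cmod c * B"
  proof (rule field_le_epsilon)
    fix e :: real assume "0 < e"
    then show "test_norm d A\<^sub>0 M x\<^sub>0 \<beta> \<gamma> (\<lambda>x. c * f x) \<le> cmod c * B + e"
      using B0 by (intro test_norm_le test_bound_scale[OF B]) auto
  qed
qed simp

lemma test_norm_minus:
  assumes "f \<in> test_space d A\<^sub>0 M x\<^sub>0 \<beta> \<gamma>" "g \<in> test_space d A\<^sub>0 M x\<^sub>0 \<beta> \<gamma>"
  shows "test_norm d A\<^sub>0 M x\<^sub>0 \<beta> \<gamma> (\<lambda>x. f x - g x) \<le> test_norm d A\<^sub>0 M x\<^sub>0 \<beta> \<gamma> (\<lambda>x. g x - f x)"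
  using test_norm_scale[OF test_space_diff[OF assms(2,1)], of "-1"] by simp

lemma test_norm_triangle:
  assumes "f \<in> test_space d A\<^sub>0 M x\<^sub>0 \<beta> \<gamma>" "g \<in> test_space d A\<^sub>0 M x\<^sub>0 \<beta> \<gamma>" "h \<in> test_space d A\<^sub>0 M x\<^sub>0 \<beta> \<gamma>"
  shows "test_norm d A\<^sub>0 M x\<^sub>0 \<beta> \<gamma> (\<lambda>x. f x - h x) \<le>
    test_norm d A\<^sub>0 M x\<^sub>0 \<beta> \<gamma> (\<lambda>x. f x - g x) + test_norm d A\<^sub>0 M x\<^sub>0 \<beta> \<gamma> (\<lambda>x. g x - h x)"
  using test_norm_add[OF test_space_diff[OF assms(1,2)] test_space_diff[OF assms(2,3)]] by simp

lemma test_norm_zero: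
  assumes "f \<in> test_space d A\<^sub>0 M x\<^sub>0 \<beta> \<gamma>"
  shows "test_norm d A\<^sub>0 M x\<^sub>0 \<beta> \<gamma> (\<lambda>x. f x - f x) = 0"
  using test_norm_scale[OF assms, of 0] test_norm_nonneg[OF test_space_scale[OF assms, of 0]] by simp

text \<open>In the range of the regularity condition \<open>d x y / (1 + d x\<^sub>0 x)\<close> is
  at most 1 because \<open>A\<^sub>0 \<ge> 1\<close>, so both exponents may be lowered with the same
  constant.\<close>

lemma test_bound_embed:
  assumes f: "test_bound d A\<^sub>0 M x\<^sub>0 b c f B" and le: "\<beta> \<le> b" "\<gamma> \<le> c"
  shows "test_bound d A\<^sub>0 M x\<^sub>0 \<beta> \<gamma> f B"
proof -
  have B: "0 < B" using f by (simp add: test_bound_def)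
  have D: "D_weight d M x\<^sub>0 c x \<le> D_weight d M x\<^sub>0 \<gamma> x" for x
    unfolding D_weight_def using le
    by (intro mult_left_mono powr_mono) (auto simp: vol_def vol2_def)
  have "cmod (f x) \<le> B * D_weight d M x\<^sub>0 \<gamma> x" for x
  proof -
    have "cmod (f x) \<le> B * D_weight d M x\<^sub>0 c x" using f by (simp add: test_bound_def)
    also have "\<dots> \<le> B * D_weight d M x\<^sub>0 \<gamma> x" using B D by (intro mult_left_mono) auto
    finally show ?thesis .
  qed
  moreover have "cmod (f x - f y) \<le> B * (d x y / (1 + d x\<^sub>0 x)) powr \<beta> * D_weight d M x\<^sub>0 \<gamma> x"
    if xy: "d x y \<le> (1 + d x\<^sub>0 x) / (2 * A\<^sub>0)" for x y
  proof -
    have t: "0 < 1 + d x\<^sub>0 x" by (simp add: add_pos_nonneg)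
    have "(1 + d x\<^sub>0 x) / (2 * A\<^sub>0) \<le> (1 + d x\<^sub>0 x) / 1"
      by (rule divide_left_mono) (use A\<^sub>0_ge_1 t in auto)
    with xy have "d x y \<le> 1 + d x\<^sub>0 x" by (simp only: div_by_1)
    with t have "d x y / (1 + d x\<^sub>0 x) \<le> 1" by (simp add: divide_le_eq)
    then have p: "(d x y / (1 + d x\<^sub>0 x)) powr b \<le> (d x y / (1 + d x\<^sub>0 x)) powr \<beta>"
      using t le by (intro powr_mono') auto
    have "cmod (f x - f y) \<le> B * (d x y / (1 + d x\<^sub>0 x)) powr b * D_weight d M x\<^sub>0 c x"
      using f xy by (auto simp: test_bound_def)
    also have "\<dots> \<le> B * (d x y / (1 + d x\<^sub>0 x)) powr \<beta> * D_weight d M x\<^sub>0 \<gamma> x"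
      using B p D D_weight_nonneg by (intro mult_mono) auto
    finally show ?thesis .
  qed
  ultimately show ?thesis using B by (simp add: test_bound_def)
qed

lemma test_space_embed:
  "\<beta> \<le> b \<Longrightarrow> \<gamma> \<le> c \<Longrightarrow> f \<in> test_space d A\<^sub>0 M x\<^sub>0 b c \<Longrightarrow> f \<in> test_space d A\<^sub>0 M x\<^sub>0 \<beta> \<gamma>"
  using test_bound_embed by (fastforce simp: test_space_def)

lemma test_norm_embed:
  "\<beta> \<le> b \<Longrightarrow> \<gamma> \<le> c \<Longrightarrow> f \<in> test_space d A\<^sub>0 M x\<^sub>0 b c \<Longrightarrow>
    test_norm d A\<^sub>0 M x\<^sub>0 \<beta> \<gamma> f \<le> test_norm d A\<^sub>0 M x\<^sub>0 b c f"
  by (rule le_test_norm) (auto intro: test_norm_le test_bound_embed)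

lemma test_space_subset_test_space0:
  assumes "\<beta> \<le> \<eta>" "\<gamma> \<le> \<eta>" "f \<in> test_space d A\<^sub>0 M x\<^sub>0 \<eta> \<eta>"
  shows "f \<in> test_space0 d A\<^sub>0 M x\<^sub>0 \<eta> \<beta> \<gamma>"
proof -
  have f: "f \<in> test_space d A\<^sub>0 M x\<^sub>0 \<beta> \<gamma>" by (rule test_space_embed[OF assms])
  show ?thesis
    unfolding test_space0_def using f assms(3) test_norm_zero[OF f] by (auto intro!: bexI[of _ f])
qed

lemma test_space0_embed:
  assumes le: "\<beta> \<le> b" "\<gamma> \<le> c" "b \<le> \<eta>" "c \<le> \<eta>" and f: "f \<in> test_space0 d A\<^sub>0 M x\<^sub>0 \<eta> b c"
  shows "f \<in> test_space0 d A\<^sub>0 M x\<^sub>0 \<eta> \<beta> \<gamma>"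
proof -
  have fs: "f \<in> test_space d A\<^sub>0 M x\<^sub>0 b c" using f by (simp add: test_space0_def)
  have "\<exists>g\<in>test_space d A\<^sub>0 M x\<^sub>0 \<eta> \<eta>. test_norm d A\<^sub>0 M x\<^sub>0 \<beta> \<gamma> (\<lambda>x. f x - g x) < e" if e: "0 < e" for e
  proof -
    obtain g where g: "g \<in> test_space d A\<^sub>0 M x\<^sub>0 \<eta> \<eta>" "test_norm d A\<^sub>0 M x\<^sub>0 b c (\<lambda>x. f x - g x) < e"
      using f e by (auto simp: test_space0_def)
    have "(\<lambda>x. f x - g x) \<in> test_space d A\<^sub>0 M x\<^sub>0 b c"
      by (intro test_space_diff fs test_space_embed[OF le(3,4) g(1)])
    from test_norm_embed[OF le(1,2) this] g show ?thesis by (intro bexI[of _ g]) auto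
  qed
  then show ?thesis using test_space_embed[OF le(1,2) fs] by (simp add: test_space0_def)
qed

text \<open>Raising the exponents shrinks the test space and enlarges the norm, so the dual grows.
  This admits \<open>f\<close> to a formula with larger exponents.\<close>

lemma distributions_embed:
  assumes le: "\<beta> \<le> b" "\<gamma> \<le> c" "b \<le> \<eta>" "c \<le> \<eta>" and f: "f \<in> distributions d A\<^sub>0 M x\<^sub>0 \<eta> \<beta> \<gamma>"
  shows "f \<in> distributions d A\<^sub>0 M x\<^sub>0 \<eta> b c"
proof -
  note emb = test_space0_embed[OF le]
  obtain K where K: "\<And>g. g \<in> test_space0 d A\<^sub>0 M x\<^sub>0 \<eta> \<beta> \<gamma> \<Longrightarrow> cmod (f g) \<le> K * test_norm d A\<^sub>0 M x\<^sub>0 \<beta> \<gamma> g"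
    using f unfolding distributions_def by blast
  have "cmod (f g) \<le> \<bar>K\<bar> * test_norm d A\<^sub>0 M x\<^sub>0 b c g" if g: "g \<in> test_space0 d A\<^sub>0 M x\<^sub>0 \<eta> b c" for g
  proof -
    have gs: "g \<in> test_space d A\<^sub>0 M x\<^sub>0 b c" using g by (simp add: test_space0_def)
    have "cmod (f g) \<le> K * test_norm d A\<^sub>0 M x\<^sub>0 \<beta> \<gamma> g" by (rule K[OF emb[OF g]])
    also have "\<dots> \<le> \<bar>K\<bar> * test_norm d A\<^sub>0 M x\<^sub>0 b c g"
      using test_norm_embed[OF le(1,2) gs] test_norm_nonneg[OF test_space_embed[OF le(1,2) gs]]
      by (intro mult_mono) auto
    finally show ?thesis .
  qed
  then show ?thesis using f emb by (auto simp: distributions_def)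
qed

text \<open>The constant \<open>K\<close> survives the extension, so a bound proved on the dense
  subspace becomes a bound on the dual norm.\<close>

lemma extension_by_density:
  assumes le: "\<beta> \<le> \<eta>" "\<gamma> \<le> \<eta>" and K: "0 \<le> K"
    and add: "\<And>g h. g \<in> test_space d A\<^sub>0 M x\<^sub>0 \<eta> \<eta> \<Longrightarrow> h \<in> test_space d A\<^sub>0 M x\<^sub>0 \<eta> \<eta> \<Longrightarrow>
      f (\<lambda>x. g x + h x) = f g + f h"
    and scale: "\<And>g c. g \<in> test_space d A\<^sub>0 M x\<^sub>0 \<eta> \<eta> \<Longrightarrow> f (\<lambda>x. c * g x) = c * f g"
    and bound: "\<And>g. g \<in> test_space d A\<^sub>0 M x\<^sub>0 \<eta> \<eta> \<Longrightarrow> cmod (f g) \<le> K * test_norm d A\<^sub>0 M x\<^sub>0 \<beta> \<gamma> g"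
  shows "\<exists>F. extends_test d A\<^sub>0 M x\<^sub>0 \<eta> \<beta> \<gamma> f F \<and>
    (\<forall>g\<in>test_space0 d A\<^sub>0 M x\<^sub>0 \<eta> \<beta> \<gamma>. cmod (F g) \<le> K * test_norm d A\<^sub>0 M x\<^sub>0 \<beta> \<gamma> g)"
proof -
  let ?D = "test_space d A\<^sub>0 M x\<^sub>0 \<eta> \<eta>" and ?S = "test_space d A\<^sub>0 M x\<^sub>0 \<beta> \<gamma>"
    and ?T = "test_space0 d A\<^sub>0 M x\<^sub>0 \<eta> \<beta> \<gamma>" and ?n = "test_norm d A\<^sub>0 M x\<^sub>0 \<beta> \<gamma>"
  have DS: "g \<in> ?S" if "g \<in> ?D" for g by (rule test_space_embed[OF le that])
  have TS: "h \<in> ?S" if "h \<in> ?T" for h using that by (simp add: test_space0_def)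
  have dense: "\<exists>g\<in>?D. ?n (\<lambda>x. h x - g x) < e" if "h \<in> ?T" "0 < e" for h e
    using that by (simp add: test_space0_def)
  have diff: "f (\<lambda>x. g x - h x) = f g - f h" if "g \<in> ?D" "h \<in> ?D" for g h
    using add[OF that(1) test_space_scale[OF that(2), of "-1"]] scale[OF that(2), of "-1"] by simp
  have lip: "cmod (f g - f h) \<le> K * (?n (\<lambda>x. u x - g x) + ?n (\<lambda>x. u x - h x))"
    if "g \<in> ?D" "h \<in> ?D" "u \<in> ?S" for g h u
  proof -
    have "cmod (f g - f h) \<le> K * ?n (\<lambda>x. g x - h x)"
      using bound[OF test_space_diff[OF that(1,2)]] diff[OF that(1,2)] by simp
    also have "\<dots> \<le> K * (?n (\<lambda>x. u x - g x) + ?n (\<lambda>x. u x - h x))"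
      using test_norm_triangle[OF DS[OF that(1)] that(3) DS[OF that(2)]]
        test_norm_minus[OF DS[OF that(1)] that(3)] K by (intro mult_left_mono) auto
    finally show ?thesis .
  qed
  \<comment> \<open>\<open>L\<close> is the value at \<open>h\<close> of a
    \<open>K\<close>-Lipschitz extension. A Cauchy sequence is used only for existence; afterwards
    linearity and the bound are read off from this property, with no compatible choice of
    sequences.\<close>
  define P where "P h L \<longleftrightarrow> (\<forall>g\<in>?D. cmod (f g - L) \<le> K * ?n (\<lambda>x. h x - g x))" for h L
  have ex: "\<exists>L. P h L" if h: "h \<in> ?T" for h
  proof -
    have "\<exists>g\<in>?D. ?n (\<lambda>x. h x - g x) < 1 / real (Suc j)" for j by (rule dense[OF h]) simp
    then obtain u where u: "\<And>j. u j \<in> ?D" "\<And>j. ?n (\<lambda>x. h x - u j x) < 1 / real (Suc j)" by metis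
    have lim: "(\<lambda>j. 1 / real (Suc j)) \<longlonglongrightarrow> 0" using LIMSEQ_inverse_real_of_nat by (simp add: inverse_eq_divide)
    have est: "cmod (f g - f (u j)) \<le> K * (?n (\<lambda>x. h x - g x) + 1 / real (Suc j))" if "g \<in> ?D" for g j
      using lip[OF that u(1)[of j] TS[OF h]] u(2)[of j] K
      by (meson add_left_mono less_imp_le mult_left_mono order_trans)
    have "Cauchy (\<lambda>j. f (u j))"
    proof (rule CauchyI)
      fix e :: real assume e: "0 < e"
      have "(\<lambda>j. K * (2 * (1 / real (Suc j)))) \<longlonglongrightarrow> K * (2 * 0)" by (intro tendsto_intros lim)
      then have "\<forall>\<^sub>F j in sequentially. K * (2 * (1 / real (Suc j))) < e"
        using e by (intro order_tendstoD(2)[of _ "K * (2 * 0)"]) auto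
      then obtain J where J: "K * (2 * (1 / real (Suc J))) < e" by (auto simp: eventually_sequentially)
      have "cmod (f (u i) - f (u j)) < e" if "J \<le> i" "J \<le> j" for i j
      proof -
        have "cmod (f (u i) - f (u j)) \<le> K * (?n (\<lambda>x. h x - u i x) + 1 / real (Suc j))"
          by (rule est[OF u(1)])
        also have "\<dots> \<le> K * (1 / real (Suc J) + 1 / real (Suc J))"
        proof (intro mult_left_mono add_mono K)
          have "1 / real (Suc i) \<le> 1 / real (Suc J)" using that by (intro divide_left_mono) auto
          then show "?n (\<lambda>x. h x - u i x) \<le> 1 / real (Suc J)" using u(2)[of i] by linarith
          show "1 / real (Suc j) \<le> 1 / real (Suc J)" using that by (intro divide_left_mono) auto
        qed
        also have "\<dots> < e" using J by simp
        finally show ?thesis .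
      qed
      then show "\<exists>J. \<forall>i\<ge>J. \<forall>j\<ge>J. norm (f (u i) - f (u j)) < e" by blast
    qed
    then obtain L where L: "(\<lambda>j. f (u j)) \<longlonglongrightarrow> L" using Cauchy_convergent_iff convergent_def by metis
    have "cmod (f g - L) \<le> K * ?n (\<lambda>x. h x - g x)" if "g \<in> ?D" for g
    proof (rule LIMSEQ_le)
      show "(\<lambda>j. cmod (f g - f (u j))) \<longlonglongrightarrow> cmod (f g - L)" by (intro tendsto_intros L)
      have "(\<lambda>j. K * (?n (\<lambda>x. h x - g x) + 1 / real (Suc j))) \<longlonglongrightarrow> K * (?n (\<lambda>x. h x - g x) + 0)"
        by (intro tendsto_intros lim)
      then show "(\<lambda>j. K * (?n (\<lambda>x. h x - g x) + 1 / real (Suc j))) \<longlonglongrightarrow> K * ?n (\<lambda>x. h x - g x)" by simp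
      show "\<exists>N. \<forall>j\<ge>N. cmod (f g - f (u j)) \<le> K * (?n (\<lambda>x. h x - g x) + 1 / real (Suc j))"
        using est[OF that] by blast
    qed
    then show ?thesis by (auto simp: P_def)
  qed
  define F where "F h = (SOME L. P h L)" for h
  have F: "cmod (f g - F h) \<le> K * ?n (\<lambda>x. h x - g x)" if "h \<in> ?T" "g \<in> ?D" for h g
    using someI_ex[OF ex[OF that(1)]] that(2) by (simp add: F_def P_def)
  have DT: "g \<in> ?T" if "g \<in> ?D" for g by (rule test_space_subset_test_space0[OF le that])
  have Ff: "F g = f g" if "g \<in> ?D" for g
    using F[OF DT[OF that] that] test_norm_zero[OF DS[OF that]] by simp
  have approx: "\<exists>g\<in>?D. ?n (\<lambda>x. h x - g x) < e \<and> cmod (f g - F h) \<le> K * e" if "h \<in> ?T" "0 < e" for h e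
    using dense[OF that] F[OF that(1)] K by (meson less_imp_le mult_left_mono order_trans)
  have addT: "(\<lambda>x. g x + h x) \<in> ?T" if g: "g \<in> ?T" and h: "h \<in> ?T" for g h
  proof -
    have "\<exists>u\<in>?D. ?n (\<lambda>x. g x + h x - u x) < e" if e: "0 < e" for e
    proof -
      obtain g' h' where gh: "g' \<in> ?D" "?n (\<lambda>x. g x - g' x) < e / 2" "h' \<in> ?D" "?n (\<lambda>x. h x - h' x) < e / 2"
        using dense[OF g, of "e / 2"] dense[OF h, of "e / 2"] e by auto
      have "?n (\<lambda>x. (g x - g' x) + (h x - h' x)) \<le> ?n (\<lambda>x. g x - g' x) + ?n (\<lambda>x. h x - h' x)"
        using g h gh by (intro test_norm_add test_space_diff TS DS)
      then have "?n (\<lambda>x. g x + h x - (g' x + h' x)) < e"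
        using gh by (simp add: algebra_simps)
      then show ?thesis using test_space_add[OF gh(1,3)] by (intro bexI[of _ "\<lambda>x. g' x + h' x"]) auto
    qed
    then show ?thesis using test_space_add[OF TS[OF g] TS[OF h]] by (simp add: test_space0_def)
  qed
  have scaleT: "(\<lambda>x. c * g x) \<in> ?T" if g: "g \<in> ?T" for g c
  proof -
    have "\<exists>u\<in>?D. ?n (\<lambda>x. c * g x - u x) < e" if e: "0 < e" for e
    proof -
      have e': "0 < e / (cmod c + 1)" using e by (simp add: add_nonneg_pos)
      obtain g' where g': "g' \<in> ?D" "?n (\<lambda>x. g x - g' x) < e / (cmod c + 1)"
        using dense[OF g e'] by auto
      have "?n (\<lambda>x. c * (g x - g' x)) \<le> cmod c * ?n (\<lambda>x. g x - g' x)"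
        using g g' by (intro test_norm_scale test_space_diff TS DS)
      also have "\<dots> \<le> cmod c * (e / (cmod c + 1))" using g' by (intro mult_left_mono) auto
      also have "\<dots> < e"
        using e by (simp add: pos_divide_less_eq add_nonneg_pos distrib_left mult.commute)
      finally have "?n (\<lambda>x. c * g x - c * g' x) < e" by (simp add: algebra_simps)
      then show ?thesis using test_space_scale[OF g'(1)] by (intro bexI[of _ "\<lambda>x. c * g' x"]) auto
    qed
    then show ?thesis using test_space_scale[OF TS[OF g]] by (simp add: test_space0_def)
  qed
  \<comment> \<open>Each defect of linearity of \<open>F\<close> will be at most a fixed multiple of
    the approximation error.\<close>
  have zero: "v = 0" if "\<And>e. 0 < e \<Longrightarrow> cmod v \<le> R * e" "0 \<le> R" for v R
  proof -
    have "cmod v \<le> 0"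
    proof (rule field_le_epsilon)
      fix e :: real assume e: "0 < e"
      have "cmod v \<le> R * (e / (R + 1))" using that e by (intro that(1)) auto
      also have "\<dots> \<le> e" using that e by (simp add: field_simps)
      finally show "cmod v \<le> 0 + e" by simp
    qed
    then show ?thesis by simp
  qed
  have Fadd: "F (\<lambda>x. g x + h x) = F g + F h" if g: "g \<in> ?T" and h: "h \<in> ?T" for g h
  proof -
    have "F (\<lambda>x. g x + h x) - (F g + F h) = 0"
    proof (rule zero)
      fix e :: real assume e: "0 < e"
      obtain g' where g': "g' \<in> ?D" "?n (\<lambda>x. g x - g' x) < e" "cmod (f g' - F g) \<le> K * e"
        using approx[OF g e] by auto
      obtain h' where h': "h' \<in> ?D" "?n (\<lambda>x. h x - h' x) < e" "cmod (f h' - F h) \<le> K * e"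
        using approx[OF h e] by auto
      have "?n (\<lambda>x. (g x - g' x) + (h x - h' x)) \<le> ?n (\<lambda>x. g x - g' x) + ?n (\<lambda>x. h x - h' x)"
        using g h g' h' by (intro test_norm_add test_space_diff TS DS)
      then have "?n (\<lambda>x. g x + h x - (g' x + h' x)) \<le> 2 * e"
        using g' h' by (simp add: algebra_simps)
      then have "K * ?n (\<lambda>x. g x + h x - (g' x + h' x)) \<le> K * (2 * e)" using K by (rule mult_left_mono)
      then have 1: "cmod (f (\<lambda>x. g' x + h' x) - F (\<lambda>x. g x + h x)) \<le> K * (2 * e)"
        using F[OF addT[OF g h] test_space_add[OF g'(1) h'(1)]] by linarith
      have "F (\<lambda>x. g x + h x) - (F g + F h) =
        (f g' - F g) + (f h' - F h) - (f (\<lambda>x. g' x + h' x) - F (\<lambda>x. g x + h x))"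
        using add[OF g'(1) h'(1)] by simp
      also have "cmod \<dots> \<le> cmod (f g' - F g) + cmod (f h' - F h) + cmod (f (\<lambda>x. g' x + h' x) - F (\<lambda>x. g x + h x))"
        by (meson norm_triangle_ineq norm_triangle_ineq4 add_right_mono order_trans)
      also have "\<dots> \<le> 4 * K * e" using 1 g' h' by simp
      finally show "cmod (F (\<lambda>x. g x + h x) - (F g + F h)) \<le> 4 * K * e" .
    qed (use K in simp)
    then show ?thesis by simp
  qed
  have Fscale: "F (\<lambda>x. c * g x) = c * F g" if g: "g \<in> ?T" for g c
  proof -
    have "F (\<lambda>x. c * g x) - c * F g = 0"
    proof (rule zero)
      fix e :: real assume e: "0 < e"
      obtain g' where g': "g' \<in> ?D" "?n (\<lambda>x. g x - g' x) < e" "cmod (f g' - F g) \<le> K * e"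
        using approx[OF g e] by auto
      have "?n (\<lambda>x. c * (g x - g' x)) \<le> cmod c * ?n (\<lambda>x. g x - g' x)"
        using g g' by (intro test_norm_scale test_space_diff TS DS)
      also have "\<dots> \<le> cmod c * e" using g' by (intro mult_left_mono) auto
      finally have "?n (\<lambda>x. c * g x - c * g' x) \<le> cmod c * e" by (simp add: algebra_simps)
      then have "K * ?n (\<lambda>x. c * g x - c * g' x) \<le> K * (cmod c * e)" using K by (rule mult_left_mono)
      then have 1: "cmod (f (\<lambda>x. c * g' x) - F (\<lambda>x. c * g x)) \<le> K * (cmod c * e)"
        using F[OF scaleT[OF g] test_space_scale[OF g'(1)], of c c] by linarith
      have 2: "cmod (c * (f g' - F g)) \<le> cmod c * (K * e)"
        using g' by (simp add: norm_mult mult_left_mono)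
      have "F (\<lambda>x. c * g x) - c * F g = c * (f g' - F g) - (f (\<lambda>x. c * g' x) - F (\<lambda>x. c * g x))"
        using scale[OF g'(1)] by (simp add: algebra_simps)
      also have "cmod \<dots> \<le> cmod (c * (f g' - F g)) + cmod (f (\<lambda>x. c * g' x) - F (\<lambda>x. c * g x))"
        by (rule norm_triangle_ineq4)
      also have "\<dots> \<le> 2 * K * cmod c * e" using 1 2 by (simp add: algebra_simps)
      finally show "cmod (F (\<lambda>x. c * g x) - c * F g) \<le> 2 * K * cmod c * e" .
    qed (use K in simp)
    then show ?thesis by simp
  qed
  \<comment> \<open>The Lipschitz bound at \<open>g = 0\<close>, with the zero function written as a
    multiple of \<open>h\<close>.\<close>
  have Fbound: "cmod (F h) \<le> K * ?n h" if h: "h \<in> ?T" for h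
  proof -
    have z: "(\<lambda>x. 0 * h x) \<in> ?D"
    proof -
      obtain g where "g \<in> ?D" using dense[OF h, of 1] by auto
      from test_space_scale[OF this, of 0] show ?thesis by simp
    qed
    from scale[OF z, of 0] have "f (\<lambda>x. 0 * h x) = 0" by simp
    with F[OF h z] show ?thesis by simp
  qed
  have "F \<in> distributions d A\<^sub>0 M x\<^sub>0 \<eta> \<beta> \<gamma>"
    unfolding distributions_def using Fadd Fscale Fbound by blast
  then show ?thesis using Ff Fbound by (intro exI[of _ F]) (simp add: extends_test_def)
qed

end

section \<open>The dual norm estimate for all distributions with level bounds\<close>

context dyadic_setting
begin

text \<open>\<beta> and \<gamma> of the locale are the new exponents, \<open>b\<^sub>0\<close> and
  \<open>c\<^sub>1\<close> those of the dual in which \<open>f\<close> is given; neither pair has to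
  dominate the other. The constant is fixed before \<open>f\<close> and \<open>X\<close>.\<close>

lemma dual_extension:
  assumes \<eta>: "\<beta> < \<eta>" "\<gamma> < \<eta>" and bc: "0 < b\<^sub>0" "b\<^sub>0 < \<eta>" "0 < c\<^sub>1" "c\<^sub>1 < \<eta>"
    and rep: "reproducing_formula d A\<^sub>0 M x\<^sub>0 \<eta> \<delta> \<A> n sub Q N"
    and p: "0 < p" and adm: "\<omega> * excess p \<le> \<gamma>" "\<omega> * excess p - s < \<beta>"
  shows "\<exists>C>0. \<forall>f X. f \<in> distributions d A\<^sub>0 M x\<^sub>0 \<eta> b\<^sub>0 c\<^sub>1 \<longrightarrow>
    level_bounds M \<delta> \<A> n sub Q N s p f X \<longrightarrow>
    (\<exists>F. extends_test d A\<^sub>0 M x\<^sub>0 \<eta> \<beta> \<gamma> f F \<and> dual_norm d A\<^sub>0 M x\<^sub>0 \<eta> \<beta> \<gamma> F \<le> ennreal (C * X))"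
proof -
  define b where "b = max b\<^sub>0 \<beta>"
  define c where "c = (max c\<^sub>1 (max \<beta> \<gamma>) + \<eta>) / 2"
  have b: "b\<^sub>0 \<le> b" "0 < b" "b < \<eta>" and c: "\<beta> < c" "\<gamma> \<le> c" "c\<^sub>1 \<le> c" "0 < c" "c < \<eta>"
    using \<eta> bc by (auto simp: b_def c_def max_def)
  obtain D where D: "0 < D" and formula: "\<And>w :: nat \<Rightarrow> 'i \<Rightarrow> nat \<Rightarrow> 'a.
      (\<forall>k. \<forall>\<alpha>\<in>\<A> (int k). \<forall>m\<in>{1..n (int k) \<alpha>}. w k \<alpha> m \<in> sub (int k) \<alpha> m) \<Longrightarrow>
      \<exists>Qt. reproducing_kernels d A\<^sub>0 M \<delta> N b c D Qt \<and>
        (\<forall>f\<in>distributions d A\<^sub>0 M x\<^sub>0 \<eta> b c. \<forall>g\<in>test_space0 d A\<^sub>0 M x\<^sub>0 \<eta> b c.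
          \<exists>t. (\<forall>k. ((\<lambda>\<alpha>. \<Sum>m=1..n (int k) \<alpha>.
                reproducing_term M N Q Qt f g k (sub (int k) \<alpha> m) (w k \<alpha> m)) has_sum t k) (\<A> (int k))) \<and>
              t sums f g)"
    using rep[unfolded reproducing_formula_def, THEN spec[of _ b], THEN spec[of _ c], THEN mp] b c by blast
  define C where "C = pairing_const c p s N D"
  have C: "0 \<le> C" unfolding C_def by (rule pairing_const_nonneg[OF c(1,2) D adm(2)])
  \<comment> \<open>\<open>C\<close> is only known to be nonnegative, while a positive constant is
    claimed.\<close>
  have "\<exists>F. extends_test d A\<^sub>0 M x\<^sub>0 \<eta> \<beta> \<gamma> f F \<and> dual_norm d A\<^sub>0 M x\<^sub>0 \<eta> \<beta> \<gamma> F \<le> ennreal ((C + 1) * X)"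
    if f: "f \<in> distributions d A\<^sub>0 M x\<^sub>0 \<eta> b\<^sub>0 c\<^sub>1" and lb: "level_bounds M \<delta> \<A> n sub Q N s p f X" for f X
  proof -
    have X: "0 \<le> X" using lb by (simp add: level_bounds_def)
    have fbc: "f \<in> distributions d A\<^sub>0 M x\<^sub>0 \<eta> b c"
      by (rule distributions_embed[OF _ _ _ _ f]) (use b c in auto)
    have D0: "g \<in> test_space0 d A\<^sub>0 M x\<^sub>0 \<eta> b\<^sub>0 c\<^sub>1" if "g \<in> test_space d A\<^sub>0 M x\<^sub>0 \<eta> \<eta>" for g
      using that bc by (intro test_space_subset_test_space0) auto
    have bound: "cmod (f g) \<le> C * X * test_norm d A\<^sub>0 M x\<^sub>0 \<beta> \<gamma> g"
      if g: "g \<in> test_space d A\<^sub>0 M x\<^sub>0 \<eta> \<eta>" for g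
    proof (rule mult_test_norm_greatest)
      show "g \<in> test_space d A\<^sub>0 M x\<^sub>0 \<beta> \<gamma>"
        by (rule test_space_embed[OF _ _ g]) (use \<eta> in auto)
      show "0 \<le> C * X" using C X by simp
      fix B assume B: "test_bound d A\<^sub>0 M x\<^sub>0 \<beta> \<gamma> g B"
      have gbc: "g \<in> test_space0 d A\<^sub>0 M x\<^sub>0 \<eta> b c"
        using g b c by (intro test_space_subset_test_space0) auto
      have "cmod (f g) \<le> C * B * X"
        unfolding C_def
      proof (rule pairing_bound[OF c(1,2) _ D B p adm lb])
        fix w :: "nat \<Rightarrow> 'i \<Rightarrow> nat \<Rightarrow> 'a"
        assume "\<forall>k. \<forall>\<alpha>\<in>\<A> (int k). \<forall>m\<in>{1..n (int k) \<alpha>}. w k \<alpha> m \<in> sub (int k) \<alpha> m"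
        from formula[OF this] fbc gbc
        show "\<exists>Qt t. reproducing_kernels d A\<^sub>0 M \<delta> N b c D Qt \<and>
          (\<forall>k. ((\<lambda>\<alpha>. \<Sum>m=1..n (int k) \<alpha>.
              reproducing_term M N Q Qt f g k (sub (int k) \<alpha> m) (w k \<alpha> m)) has_sum t k) (\<A> (int k))) \<and>
          t sums f g" by blast
      qed
      then show "cmod (f g) \<le> C * X * B" by (simp add: mult_ac)
    qed
    obtain F where F: "extends_test d A\<^sub>0 M x\<^sub>0 \<eta> \<beta> \<gamma> f F"
      "\<And>g. g \<in> test_space0 d A\<^sub>0 M x\<^sub>0 \<eta> \<beta> \<gamma> \<Longrightarrow> cmod (F g) \<le> C * X * test_norm d A\<^sub>0 M x\<^sub>0 \<beta> \<gamma> g"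
    proof -
      have "\<exists>F. extends_test d A\<^sub>0 M x\<^sub>0 \<eta> \<beta> \<gamma> f F \<and>
        (\<forall>g\<in>test_space0 d A\<^sub>0 M x\<^sub>0 \<eta> \<beta> \<gamma>. cmod (F g) \<le> C * X * test_norm d A\<^sub>0 M x\<^sub>0 \<beta> \<gamma> g)"
      proof (rule extension_by_density[OF _ _ _ _ _ bound])
        show "f (\<lambda>x. g x + h x) = f g + f h"
          if "g \<in> test_space d A\<^sub>0 M x\<^sub>0 \<eta> \<eta>" "h \<in> test_space d A\<^sub>0 M x\<^sub>0 \<eta> \<eta>" for g h
          using f D0[OF that(1)] D0[OF that(2)] by (simp add: distributions_def)
        show "f (\<lambda>x. a * g x) = a * f g" if "g \<in> test_space d A\<^sub>0 M x\<^sub>0 \<eta> \<eta>" for g a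
          using f D0[OF that] by (simp add: distributions_def)
      qed (use \<eta> C X in auto)
      then show ?thesis using that by blast
    qed
    have "dual_norm d A\<^sub>0 M x\<^sub>0 \<eta> \<beta> \<gamma> F \<le> ennreal ((C + 1) * X)"
      unfolding dual_norm_def
    proof (rule SUP_least)
      fix g assume "g \<in> {g \<in> test_space0 d A\<^sub>0 M x\<^sub>0 \<eta> \<beta> \<gamma>. test_norm d A\<^sub>0 M x\<^sub>0 \<beta> \<gamma> g \<le> 1}"
      then have g: "g \<in> test_space0 d A\<^sub>0 M x\<^sub>0 \<eta> \<beta> \<gamma>" "test_norm d A\<^sub>0 M x\<^sub>0 \<beta> \<gamma> g \<le> 1" by auto
      have "cmod (F g) \<le> C * X * test_norm d A\<^sub>0 M x\<^sub>0 \<beta> \<gamma> g" by (rule F(2)[OF g(1)])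
      also have "\<dots> \<le> C * X * 1" using g C X by (intro mult_left_mono) auto
      also have "\<dots> \<le> (C + 1) * X" using X by (simp add: distrib_right)
      finally show "ennreal (cmod (F g)) \<le> ennreal ((C + 1) * X)" by (rule ennreal_leI)
    qed
    with F(1) show ?thesis by blast
  qed
  then show ?thesis using C by (intro exI[of _ "C + 1"]) auto
qed

end

theorem proposition4p4:
  fixes d :: "'a \<Rightarrow> 'a \<Rightarrow> real" and M :: "'a measure" and x\<^sub>0 :: 'a
    and A\<^sub>0 C\<^sub>\<mu> c\<^sub>0 C\<^sub>0 \<delta> \<eta> \<beta> \<gamma> s \<omega> :: real
    and p q :: ennreal
    and \<A> :: "int \<Rightarrow> 'i set" and z :: "int \<Rightarrow> 'i \<Rightarrow> 'a" and cube :: "int \<Rightarrow> 'i \<Rightarrow> 'a set"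
    and j\<^sub>0 N :: nat and n :: "int \<Rightarrow> 'i \<Rightarrow> nat" and sub :: "int \<Rightarrow> 'i \<Rightarrow> nat \<Rightarrow> 'a set"
    and Q :: "nat \<Rightarrow> 'a \<Rightarrow> 'a \<Rightarrow> complex"
  assumes "homogeneous_type d A\<^sub>0 M C\<^sub>\<mu>"
    and "\<omega> = upper_dim C\<^sub>\<mu>"
    and "dyadic_system d A\<^sub>0 M c\<^sub>0 C\<^sub>0 \<delta> \<A> z cube"
    and "subcube_enumeration A\<^sub>0 C\<^sub>0 \<delta> \<A> cube j\<^sub>0 n sub"
    and "0 < \<eta>" "\<eta> < 1"
    and "exp_IATI d M \<delta> \<A> z \<eta> Q"
    and "1 \<le> N" "reproducing_formula d A\<^sub>0 M x\<^sub>0 \<eta> \<delta> \<A> n sub Q N"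
    and "0 < \<beta>" "\<beta> < \<eta>" "0 < \<gamma>" "\<gamma> < \<eta>"
    and "- min \<beta> \<gamma> < s" "s < min \<beta> \<gamma>"
    and "0 < p" "0 < q"
    and "admissible \<omega> \<eta> s p \<beta> \<gamma>"
  shows
    "(ennreal (p_index \<omega> s (min \<beta> \<gamma>)) < p \<longrightarrow>
       (\<forall>\<beta>' \<gamma>'. - min \<beta>' \<gamma>' < s \<and> s < min \<beta>' \<gamma>' \<and>
          ennreal (p_index \<omega> s (min \<beta>' \<gamma>')) < p \<and>
          admissible \<omega> \<eta> s p \<beta>' \<gamma>' \<longrightarrow>
          (\<exists>C>0. \<forall>f\<in>besov_space d A\<^sub>0 M x\<^sub>0 \<eta> \<delta> \<A> n sub Q N \<beta> \<gamma> s p q.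
             \<exists>F. extends_test d A\<^sub>0 M x\<^sub>0 \<eta> \<beta>' \<gamma>' f F \<and>
                 dual_norm d A\<^sub>0 M x\<^sub>0 \<eta> \<beta>' \<gamma>' F
                   \<le> ennreal C * besov_norm M \<delta> \<A> n sub Q N s p q f))) \<and>
     (ennreal (p_index \<omega> s (min \<beta> \<gamma>)) < p \<and> p < top \<and>
      ennreal (p_index \<omega> s (min \<beta> \<gamma>)) < q \<longrightarrow>
       (\<forall>\<beta>' \<gamma>'. - min \<beta>' \<gamma>' < s \<and> s < min \<beta>' \<gamma>' \<and>
          ennreal (p_index \<omega> s (min \<beta>' \<gamma>')) < p \<and>
          ennreal (p_index \<omega> s (min \<beta>' \<gamma>')) < q \<and>
          admissible \<omega> \<eta> s p \<beta>' \<gamma>' \<longrightarrow>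
          (\<exists>C>0. \<forall>f\<in>triebel_lizorkin_space d A\<^sub>0 M x\<^sub>0 \<eta> \<delta> \<A> n sub Q N \<beta> \<gamma> s p q.
             \<exists>F. extends_test d A\<^sub>0 M x\<^sub>0 \<eta> \<beta>' \<gamma>' f F \<and>
                 dual_norm d A\<^sub>0 M x\<^sub>0 \<eta> \<beta>' \<gamma>' F
                   \<le> ennreal C * triebel_lizorkin_norm M \<delta> \<A> n sub Q N s p q f)))"
proof -
  interpret homogeneous_space d A\<^sub>0 M C\<^sub>\<mu> by standard (rule assms(1))
  have \<omega>: "\<omega> = upper_dim C\<^sub>\<mu>" by (rule assms(2))
  have p: "0 < p" and q: "0 < q" by fact+
  \<comment> \<open>One constant serves both norms, since each of them is a possible
    \<open>X\<close> in \<open>level_bounds\<close>.\<close>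
  have key: "\<exists>C>0. \<forall>f\<in>distributions d A\<^sub>0 M x\<^sub>0 \<eta> \<beta> \<gamma>.
      (besov_norm M \<delta> \<A> n sub Q N s p q f < top \<longrightarrow>
        (\<exists>F. extends_test d A\<^sub>0 M x\<^sub>0 \<eta> \<beta>' \<gamma>' f F \<and>
          dual_norm d A\<^sub>0 M x\<^sub>0 \<eta> \<beta>' \<gamma>' F \<le> ennreal C * besov_norm M \<delta> \<A> n sub Q N s p q f)) \<and>
      (p < top \<and> triebel_lizorkin_norm M \<delta> \<A> n sub Q N s p q f < top \<longrightarrow>
        (\<exists>F. extends_test d A\<^sub>0 M x\<^sub>0 \<eta> \<beta>' \<gamma>' f F \<and>
          dual_norm d A\<^sub>0 M x\<^sub>0 \<eta> \<beta>' \<gamma>' F \<le> ennreal C * triebel_lizorkin_norm M \<delta> \<A> n sub Q N s p q f))"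
    if adm: "admissible \<omega> \<eta> s p \<beta>' \<gamma>'" for \<beta>' \<gamma>'
  proof -
    have a: "0 < \<beta>'" "\<omega> * excess p - s < \<beta>'" "\<beta>' < \<eta>" "\<omega> * excess p < \<gamma>'" "\<gamma>' < \<eta>"
      using adm by (auto simp: admissible_def excess_def)
    have "0 < \<gamma>'"
      using a(4) mult_nonneg_nonneg[OF upper_dim_nonneg excess_nonneg[of p]] \<omega> by simp
    \<comment> \<open>The locale is taken at the new exponents; the original pair becomes
      \<open>b\<^sub>0\<close>, \<open>c\<^sub>1\<close> of \<open>dual_extension\<close>.\<close>
    then interpret dyadic_setting d A\<^sub>0 M C\<^sub>\<mu> x\<^sub>0 \<beta>' \<gamma>' c\<^sub>0 C\<^sub>0 \<delta> \<A> z cube j\<^sub>0 n sub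
      by unfold_locales (use a assms(3,4) in auto)
    note cells = subcube_balls(1) subcube_measure(1,2)
    have besov: "level_bounds M \<delta> \<A> n sub Q N s p f (enn2real (besov_norm M \<delta> \<A> n sub Q N s p q f))"
      if "besov_norm M \<delta> \<A> n sub Q N s p q f < top" for f
      by (rule level_bounds_besov[OF _ subcubes_disjoint p q \<delta>_pos that]) (use cells in blast)
    have tl: "level_bounds M \<delta> \<A> n sub Q N s p f (enn2real (triebel_lizorkin_norm M \<delta> \<A> n sub Q N s p q f))"
      if "p < top" "triebel_lizorkin_norm M \<delta> \<A> n sub Q N s p q f < top" for f
      by (rule level_bounds_triebel_lizorkin[OF _ subcubes_disjoint p q \<delta>_pos that]) (use cells in blast)
    obtain C where C: "0 < C" and ext: "\<And>f X. f \<in> distributions d A\<^sub>0 M x\<^sub>0 \<eta> \<beta> \<gamma> \<Longrightarrow>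
        level_bounds M \<delta> \<A> n sub Q N s p f X \<Longrightarrow>
        \<exists>F. extends_test d A\<^sub>0 M x\<^sub>0 \<eta> \<beta>' \<gamma>' f F \<and> dual_norm d A\<^sub>0 M x\<^sub>0 \<eta> \<beta>' \<gamma>' F \<le> ennreal (C * X)"
      using dual_extension[OF a(3,5) assms(10-13) assms(9) p, of s] a(2,4) \<omega> by auto
    have conv: "ennreal (C * enn2real y) = ennreal C * y" if "y < top" for y
      using C that by (simp add: ennreal_mult)
    show ?thesis
    proof (intro exI[of _ C] conjI ballI impI)
      fix f assume f: "f \<in> distributions d A\<^sub>0 M x\<^sub>0 \<eta> \<beta> \<gamma>"
      show "\<exists>F. extends_test d A\<^sub>0 M x\<^sub>0 \<eta> \<beta>' \<gamma>' f F \<and>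
          dual_norm d A\<^sub>0 M x\<^sub>0 \<eta> \<beta>' \<gamma>' F \<le> ennreal C * besov_norm M \<delta> \<A> n sub Q N s p q f"
        if fin: "besov_norm M \<delta> \<A> n sub Q N s p q f < top"
        using ext[OF f besov[OF fin]] unfolding conv[OF fin] .
      show "\<exists>F. extends_test d A\<^sub>0 M x\<^sub>0 \<eta> \<beta>' \<gamma>' f F \<and>
          dual_norm d A\<^sub>0 M x\<^sub>0 \<eta> \<beta>' \<gamma>' F \<le> ennreal C * triebel_lizorkin_norm M \<delta> \<A> n sub Q N s p q f"
        if fin: "p < top \<and> triebel_lizorkin_norm M \<delta> \<A> n sub Q N s p q f < top"
        using ext[OF f tl] fin conv by metis
    qed (rule C)
  qed
  show ?thesis
  proof (intro conjI impI allI)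
    fix \<beta>' \<gamma>'
    assume "- min \<beta>' \<gamma>' < s \<and> s < min \<beta>' \<gamma>' \<and> ennreal (p_index \<omega> s (min \<beta>' \<gamma>')) < p \<and>
      admissible \<omega> \<eta> s p \<beta>' \<gamma>'"
    then have "admissible \<omega> \<eta> s p \<beta>' \<gamma>'" by simp
    from key[OF this] show "\<exists>C>0. \<forall>f\<in>besov_space d A\<^sub>0 M x\<^sub>0 \<eta> \<delta> \<A> n sub Q N \<beta> \<gamma> s p q.
             \<exists>F. extends_test d A\<^sub>0 M x\<^sub>0 \<eta> \<beta>' \<gamma>' f F \<and>
                 dual_norm d A\<^sub>0 M x\<^sub>0 \<eta> \<beta>' \<gamma>' F
                   \<le> ennreal C * besov_norm M \<delta> \<A> n sub Q N s p q f"
      unfolding besov_space_def by blast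
  next
    fix \<beta>' \<gamma>'
    assume "ennreal (p_index \<omega> s (min \<beta> \<gamma>)) < p \<and> p < top \<and> ennreal (p_index \<omega> s (min \<beta> \<gamma>)) < q"
      and "- min \<beta>' \<gamma>' < s \<and> s < min \<beta>' \<gamma>' \<and> ennreal (p_index \<omega> s (min \<beta>' \<gamma>')) < p \<and>
        ennreal (p_index \<omega> s (min \<beta>' \<gamma>')) < q \<and> admissible \<omega> \<eta> s p \<beta>' \<gamma>'"
    then have "admissible \<omega> \<eta> s p \<beta>' \<gamma>'" and "p < top" by simp_all
    from key[OF this(1)] this(2) show "\<exists>C>0. \<forall>f\<in>triebel_lizorkin_space d A\<^sub>0 M x\<^sub>0 \<eta> \<delta> \<A> n sub Q N \<beta> \<gamma> s p q.
             \<exists>F. extends_test d A\<^sub>0 M x\<^sub>0 \<eta> \<beta>' \<gamma>' f F \<and>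
                 dual_norm d A\<^sub>0 M x\<^sub>0 \<eta> \<beta>' \<gamma>' F
                   \<le> ennreal C * triebel_lizorkin_norm M \<delta> \<A> n sub Q N s p q f"
      unfolding triebel_lizorkin_space_def by blast
  qed
qed

end
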